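(* Fix a positive integer $k$ and set $n=k+1$. Let $J$ be an open interval containing the origin $0$, and let $U(s)$ be a positive valued smooth function on $J$ such that $U^{(i)}(0)=0$ for all $i$ with $1\le i\le k$, where $U^{(i)}=d^iU/ds^i$. Take a smooth function $V(s)$ on $J$ such that $U'(s)=s^kV(s)$. Suppose that there exist a positive number $m>0$ and a real number $h$ such that the function $$\rho_{h,m}(s):=\sqrt{m^2U(s)^2-h^2-m^4U(s)^2V(s)^2}$$ is a smooth function on $J$ which satisfies $\rho_{h,m}(0)\neq 0$ (call this condition $( * )_{h,m}$). For $\epsilon_0,\epsilon_1,\epsilon_2\in\{+1,-1\}$ set $$x(s)=\epsilon_0\sqrt{m^2U(s)^2-h^2},\qquad z(s)=\epsilon_2 m\int_0^s\frac{\zeta^kU(\zeta)\rho_{h,m}(\zeta)}{m^2U(\zeta)^2-h^2}\,d\zeta,$$ $$\theta(s,t)=\frac1m\left(\epsilon_1t-\epsilon_2h\int_0^s\frac{\zeta^k\rho_{h,m}(\zeta)}{U(\zeta)(m^2U(\zeta)^2-h^2)}\,d\zeta\right).$$ Then the map $\Psi:J\times\mathbb{R}\to\mathbb{R}^3$ defined by $$\Psi(s,t):=\bigl(x(s)\cos\theta(s,t),\ x(s)\sin\theta(s,t),\ z(s)+h\theta(s,t)\bigr)$$ is a generic helicoidal $n$-type edge whose first fundamental form coincides with $g=s^{2k}ds^2+U(s)^2dt^2$. Conversely, on a neighborhood of a singular point, every generic helicoidal $n$-type edge whose first fundamental form coincides with $g=s^{2k}ds^2+U(s)^2dt^2$ is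 given in this manner (i.e. for some $m>0$, $h\in\mathbb{R}$ satisfying $( * )_{h,m}$ on a neighborhood of $0$ and some signs $\epsilon_0,\epsilon_1,\epsilon_2$), up to a rigid motion of $\mathbb{R}^3$.
   Context: All manifolds and maps are $C^\infty$. Let $\Sigma$ be an oriented smooth $2$-manifold and $f:\Sigma\to\mathbb{R}^3$ a smooth map. A point where $f$ is not an immersion is a singular point; $S(f)$ is the set of singular points. $f$ is a surface if $\Sigma\setminus S(f)$ is dense. The first fundamental form of $f$ is the pullback by $f$ of the Euclidean metric. A surface $f$ is a frontal if each point has an open neighborhood $D$ with a smooth map $\nu:D\to S^2$ (unit normal vector field) such that $df_q(v)\cdot\nu(q)=0$ for all $q\in D$, $v\in T_q\Sigma$. Two map-germs $f_i:(\Sigma_i,p_i)\to(\mathbb{R}^N,q_i)$ $(i=1,2)$ are $\mathcal{A}$-equivalent if there are diffeomorphism-germs $\varphi:(\Sigma_1,p_1)\to(\Sigma_2,p_2)$ and $\Phi:(\mathbb{R}^N,q_1)\to(\mathbb{R}^N,q_2)$ with $f_2=\Phi\circ f_1\circ\varphi^{-1}$. A point $p$ is an $n$-type edge singular point of $f$ if there is a smooth function $a(u,v)$ such that the germ of $f$ at $p$ is $\mathcal{A}$-equivalent to the germ at the origin of $(u,v)\mapsto(u^n,u^{n+1}a(u,v),v)$. A singular point $p$ is of rank one if $\operatorname{rank}(df_p)=1$. For a frontal $f$ and a rank one singular point $p$, take an orientation-compatible coordinate system $(u,v)$ with $f_u(p)=0$; the limiting normal curvature is $\kappa_\nu(p)=\dfrac{f_{vv}(p)\cdot\nu(p)}{\|f_v(p)\|^2}$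 (it does not depend on the choice of such coordinates). A rank one singular point is generic if $\kappa_\nu(p)\ne0$. A helicoidal motion is a non-trivial one-parameter subgroup of the isometry group of $\mathbb{R}^3$. For an integer $n>1$, a generic helicoidal $n$-type edge is a frontal in $\mathbb{R}^3$ that is invariant under a helicoidal motion, has non-empty singular set, and all of whose singular points are generic $n$-type edge singular points.
   Formalization: The direct half additionally assumes m²U(s)²−h² ≠ 0 on all of J: condition ( * ) allows a zero away from 0, where the integrands for z and θ are undefined and Ψ is either undefined or not smooth. *)

theory Defs
  imports "HOL-Analysis.Analysis"
begin

section \<open>Smooth maps between Euclidean spaces\<close>

text \<open>Both notions are meant for open \<open>S\<close> only.\<close>

primrec C_times_on :: "nat \<Rightarrow> ('a::euclidean_space \<Rightarrow> 'b::real_normed_vector) \<Rightarrow> 'a set \<Rightarrow> bool" where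
  "C_times_on 0 f S \<longleftrightarrow> continuous_on S f"
| "C_times_on (Suc n) f S \<longleftrightarrow>
     (\<forall>x\<in>S. f differentiable (at x)) \<and>
     (\<forall>v. C_times_on n (\<lambda>x. frechet_derivative f (at x) v) S)"

definition smooth_on :: "'a::euclidean_space set \<Rightarrow> ('a \<Rightarrow> 'b::real_normed_vector) \<Rightarrow> bool" where
  "smooth_on S f \<longleftrightarrow> (\<forall>n. C_times_on n f S)"

definition partial_u :: "(real \<times> real \<Rightarrow> 'b::real_normed_vector) \<Rightarrow> real \<times> real \<Rightarrow> 'b" where
  "partial_u F x = frechet_derivative F (at x) (1, 0)"

definition partial_v :: "(real \<times> real \<Rightarrow> 'b::real_normed_vector) \<Rightarrow> real \<times> real \<Rightarrow> 'b" where
  "partial_v F x = frechet_derivative F (at x) (0, 1)"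

definition jacobian_det :: "(real \<times> real \<Rightarrow> real \<times> real) \<Rightarrow> real \<times> real \<Rightarrow> real" where
  "jacobian_det F x =
     fst (partial_u F x) * snd (partial_v F x) - fst (partial_v F x) * snd (partial_u F x)"

definition diffeo_open :: "'a::euclidean_space set \<Rightarrow> 'a set \<Rightarrow> ('a \<Rightarrow> 'a) \<Rightarrow> bool" where
  "diffeo_open W1 W2 \<Phi> \<longleftrightarrow>
     open W1 \<and> open W2 \<and> bij_betw \<Phi> W1 W2 \<and> smooth_on W1 \<Phi> \<and> smooth_on W2 (inv_into W1 \<Phi>)"


section \<open>Oriented smooth 2-manifolds\<close>

text \<open>A manifold is an abstract topology \<open>X\<close> with an atlas \<open>A\<close> (not required to be maximal).
  A chart is a pair \<open>(D, c)\<close> of an open domain and a map, of which only the values on \<open>D\<close> matter.\<close>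

type_synonym 'a chart = "'a set \<times> ('a \<Rightarrow> real \<times> real)"

definition oriented_surface_manifold :: "'a topology \<Rightarrow> 'a chart set \<Rightarrow> bool" where
  "oriented_surface_manifold X A \<longleftrightarrow>
     Hausdorff_space X \<and> second_countable X \<and>
     (\<Union>(D, c)\<in>A. D) = topspace X \<and>
     (\<forall>(D, c)\<in>A. openin X D \<and> open (c ` D) \<and>
        homeomorphic_map (subtopology X D) (top_of_set (c ` D)) c) \<and>
     (\<forall>(D, c)\<in>A. \<forall>(D', c')\<in>A.
        smooth_on (c ` (D \<inter> D')) (c' \<circ> inv_into D c) \<and>
        (\<forall>x\<in>c ` (D \<inter> D'). jacobian_det (c' \<circ> inv_into D c) x > 0))"

text \<open>The standard structure of an open subset \<open>S\<close> of the plane is \<open>(top_of_set S, plane_atlas S)\<close>.\<close>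

definition plane_atlas :: "(real \<times> real) set \<Rightarrow> (real \<times> real) chart set" where
  "plane_atlas S = {(S, id)}"

definition smooth_manifold_map ::
  "'a topology \<Rightarrow> 'a chart set \<Rightarrow> 'b topology \<Rightarrow> 'b chart set \<Rightarrow> 'a set \<Rightarrow> ('a \<Rightarrow> 'b) \<Rightarrow> bool" where
  "smooth_manifold_map X A Y B D \<phi> \<longleftrightarrow>
     continuous_map (subtopology X D) Y \<phi> \<and>
     (\<forall>(E, c)\<in>A. \<forall>(E', c')\<in>B.
        smooth_on (c ` {q \<in> D \<inter> E. \<phi> q \<in> E'}) (c' \<circ> \<phi> \<circ> inv_into E c))"

definition diffeo_manifold ::
  "'a topology \<Rightarrow> 'a chart set \<Rightarrow> 'a set \<Rightarrow> 'b topology \<Rightarrow> 'b chart set \<Rightarrow> 'b set \<Rightarrow> ('a \<Rightarrow> 'b) \<Rightarrow> bool" where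
  "diffeo_manifold X A D1 Y B D2 \<phi> \<longleftrightarrow>
     openin X D1 \<and> openin Y D2 \<and> bij_betw \<phi> D1 D2 \<and>
     smooth_manifold_map X A Y B D1 \<phi> \<and> smooth_manifold_map Y B X A D2 (inv_into D1 \<phi>)"

definition coordinates :: "'a topology \<Rightarrow> 'a chart set \<Rightarrow> 'a set \<Rightarrow> ('a \<Rightarrow> real \<times> real) \<Rightarrow> bool" where
  "coordinates X A D c \<longleftrightarrow>
     diffeo_manifold X A D (top_of_set UNIV) (plane_atlas UNIV) (c ` D) c"

definition oriented_coordinates ::
  "'a topology \<Rightarrow> 'a chart set \<Rightarrow> 'a set \<Rightarrow> ('a \<Rightarrow> real \<times> real) \<Rightarrow> bool" where
  "oriented_coordinates X A D c \<longleftrightarrow>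
     coordinates X A D c \<and>
     (\<forall>(E, e)\<in>A. \<forall>x\<in>e ` (D \<inter> E). jacobian_det (c \<circ> inv_into E e) x > 0)"

definition smooth_vector_map :: "'a chart set \<Rightarrow> 'a set \<Rightarrow> ('a \<Rightarrow> 'b::real_normed_vector) \<Rightarrow> bool" where
  "smooth_vector_map A D f \<longleftrightarrow> (\<forall>(E, c)\<in>A. smooth_on (c ` (D \<inter> E)) (f \<circ> inv_into E c))"


section \<open>Surfaces, frontals and their singular points\<close>

definition singular_points :: "'a topology \<Rightarrow> 'a chart set \<Rightarrow> ('a \<Rightarrow> real^3) \<Rightarrow> 'a set" where
  "singular_points X A f =
     {p \<in> topspace X. \<exists>(D, c)\<in>A. p \<in> D \<and>
        \<not> inj (frechet_derivative (f \<circ> inv_into D c) (at (c p)))}"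

definition rank_one_at :: "'a chart set \<Rightarrow> ('a \<Rightarrow> real^3) \<Rightarrow> 'a \<Rightarrow> bool" where
  "rank_one_at A f p \<longleftrightarrow>
     (\<exists>(D, c)\<in>A. p \<in> D \<and> dim (range (frechet_derivative (f \<circ> inv_into D c) (at (c p)))) = 1)"

definition surface :: "'a topology \<Rightarrow> 'a chart set \<Rightarrow> ('a \<Rightarrow> real^3) \<Rightarrow> bool" where
  "surface X A f \<longleftrightarrow>
     oriented_surface_manifold X A \<and> smooth_vector_map A (topspace X) f \<and>
     X closure_of (topspace X - singular_points X A f) = topspace X"

definition unit_normal_field ::
  "'a topology \<Rightarrow> 'a chart set \<Rightarrow> ('a \<Rightarrow> real^3) \<Rightarrow> 'a set \<Rightarrow> ('a \<Rightarrow> real^3) \<Rightarrow> bool" where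
  "unit_normal_field X A f D \<nu> \<longleftrightarrow>
     openin X D \<and> smooth_vector_map A D \<nu> \<and>
     (\<forall>q\<in>D. norm (\<nu> q) = 1 \<and>
        (\<forall>(E, c)\<in>A. q \<in> E \<longrightarrow>
           (\<forall>v. frechet_derivative (f \<circ> inv_into E c) (at (c q)) v \<bullet> \<nu> q = 0)))"

definition frontal :: "'a topology \<Rightarrow> 'a chart set \<Rightarrow> ('a \<Rightarrow> real^3) \<Rightarrow> bool" where
  "frontal X A f \<longleftrightarrow>
     surface X A f \<and> (\<forall>p\<in>topspace X. \<exists>D \<nu>. p \<in> D \<and> unit_normal_field X A f D \<nu>)"

text \<open>\<open>\<A>\<close>-equivalence of the germs of \<open>f1\<close> at \<open>p1\<close> and of \<open>f2\<close> at \<open>p2\<close>; the base points in the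
  target are \<open>f1 p1\<close> and \<open>f2 p2\<close>, and \<open>\<Phi> (f1 p1) = f2 p2\<close> is a consequence.\<close>

definition A_equivalent ::
  "'a topology \<Rightarrow> 'a chart set \<Rightarrow> 'a \<Rightarrow> ('a \<Rightarrow> 'e::euclidean_space) \<Rightarrow>
   'b topology \<Rightarrow> 'b chart set \<Rightarrow> 'b \<Rightarrow> ('b \<Rightarrow> 'e) \<Rightarrow> bool" where
  "A_equivalent X A p1 f1 Y B p2 f2 \<longleftrightarrow>
     (\<exists>D1 D2 \<phi> W1 W2 \<Phi>.
        p1 \<in> D1 \<and> diffeo_manifold X A D1 Y B D2 \<phi> \<and> \<phi> p1 = p2 \<and>
        diffeo_open W1 W2 \<Phi> \<and> f1 ` D1 \<subseteq> W1 \<and>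
        (\<forall>y\<in>D2. f2 y = \<Phi> (f1 (inv_into D1 \<phi> y))))"

definition edge_normal_form :: "nat \<Rightarrow> (real \<times> real \<Rightarrow> real) \<Rightarrow> real \<times> real \<Rightarrow> real^3" where
  "edge_normal_form n a = (\<lambda>(u, v). vector [u ^ n, u ^ (n + 1) * a (u, v), v])"

definition edge_singular_point ::
  "nat \<Rightarrow> 'a topology \<Rightarrow> 'a chart set \<Rightarrow> ('a \<Rightarrow> real^3) \<Rightarrow> 'a \<Rightarrow> bool" where
  "edge_singular_point n X A f p \<longleftrightarrow>
     (\<exists>N a. open N \<and> (0, 0) \<in> N \<and> smooth_on N a \<and>
        A_equivalent X A p f (top_of_set UNIV) (plane_atlas UNIV) (0, 0) (edge_normal_form n a))"

text \<open>The limiting normal curvature at \<open>p\<close> computed in coordinates \<open>(D, c)\<close>. It is meaningful for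
  orientation-compatible coordinates whose first coordinate vector is annihilated by the
  differential of \<open>f\<close> at \<open>p\<close>, and its value then does not depend on them.\<close>

definition limiting_normal_curvature ::
  "'a set \<Rightarrow> ('a \<Rightarrow> real \<times> real) \<Rightarrow> ('a \<Rightarrow> real^3) \<Rightarrow> ('a \<Rightarrow> real^3) \<Rightarrow> 'a \<Rightarrow> real" where
  "limiting_normal_curvature D c f \<nu> p =
     (let F = f \<circ> inv_into D c
      in (partial_v (partial_v F) (c p) \<bullet> \<nu> p) / (norm (partial_v F (c p)))\<^sup>2)"

definition generic_singular_point :: "'a topology \<Rightarrow> 'a chart set \<Rightarrow> ('a \<Rightarrow> real^3) \<Rightarrow> 'a \<Rightarrow> bool" where
  "generic_singular_point X A f p \<longleftrightarrow>
     p \<in> singular_points X A f \<and> rank_one_at A f p \<and>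
     (\<exists>W \<nu> D c. p \<in> W \<and> unit_normal_field X A f W \<nu> \<and>
        p \<in> D \<and> oriented_coordinates X A D c \<and> partial_u (f \<circ> inv_into D c) (c p) = 0 \<and>
        limiting_normal_curvature D c f \<nu> p \<noteq> 0)"


section \<open>Helicoidal motions\<close>

definition helicoidal_motion :: "(real \<Rightarrow> real^3 \<Rightarrow> real^3) \<Rightarrow> bool" where
  "helicoidal_motion G \<longleftrightarrow>
     (\<forall>\<tau> x y. dist (G \<tau> x) (G \<tau> y) = dist x y) \<and>
     G 0 = id \<and> (\<forall>\<sigma> \<tau>. G (\<sigma> + \<tau>) = G \<sigma> \<circ> G \<tau>) \<and>
     (\<forall>x. smooth_on UNIV (\<lambda>\<tau>. G \<tau> x)) \<and>
     (\<exists>\<tau>. G \<tau> \<noteq> id)"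

definition one_parameter_group ::
  "'a topology \<Rightarrow> 'a chart set \<Rightarrow> (real \<Rightarrow> 'a \<Rightarrow> 'a) \<Rightarrow> bool" where
  "one_parameter_group X A \<phi> \<longleftrightarrow>
     continuous_map (prod_topology euclideanreal X) X (\<lambda>(\<tau>, q). \<phi> \<tau> q) \<and>
     (\<forall>q\<in>topspace X. \<phi> 0 q = q) \<and>
     (\<forall>\<sigma> \<tau>. \<forall>q\<in>topspace X. \<phi> (\<sigma> + \<tau>) q = \<phi> \<sigma> (\<phi> \<tau> q)) \<and>
     (\<forall>(E, c)\<in>A. \<forall>(E', c')\<in>A.
        smooth_on {(\<tau>, x). x \<in> c ` E \<and> \<phi> \<tau> (inv_into E c x) \<in> E'}
          (\<lambda>(\<tau>, x). c' (\<phi> \<tau> (inv_into E c x))))"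

text \<open>Invariance is understood for the map and not merely for its image: each motion \<open>G \<tau>\<close>
  moves \<open>f\<close> along itself, by a one-parameter group of diffeomorphisms of the source.\<close>

definition invariant_under ::
  "'a topology \<Rightarrow> 'a chart set \<Rightarrow> ('a \<Rightarrow> real^3) \<Rightarrow> (real \<Rightarrow> real^3 \<Rightarrow> real^3) \<Rightarrow> bool" where
  "invariant_under X A f G \<longleftrightarrow>
     (\<exists>\<phi>. one_parameter_group X A \<phi> \<and> (\<forall>\<tau>. \<forall>q\<in>topspace X. f (\<phi> \<tau> q) = G \<tau> (f q)))"

definition generic_helicoidal_edge ::
  "nat \<Rightarrow> 'a topology \<Rightarrow> 'a chart set \<Rightarrow> ('a \<Rightarrow> real^3) \<Rightarrow> bool" where
  "generic_helicoidal_edge n X A f \<longleftrightarrow>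
     1 < n \<and> frontal X A f \<and>
     (\<exists>G. helicoidal_motion G \<and> invariant_under X A f G) \<and>
     singular_points X A f \<noteq> {} \<and>
     (\<forall>p\<in>singular_points X A f. edge_singular_point n X A f p \<and> generic_singular_point X A f p)"

text \<open>Orientation-preserving isometries of space.\<close>

definition rigid_motion :: "(real^3 \<Rightarrow> real^3) \<Rightarrow> bool" where
  "rigid_motion T \<longleftrightarrow> (\<exists>R b. rotation_matrix R \<and> T = (\<lambda>x. R *v x + b))"


section \<open>First fundamental forms\<close>

definition first_fundamental_form ::
  "(real \<times> real \<Rightarrow> real^3) \<Rightarrow> real \<times> real \<Rightarrow> real \<times> real \<Rightarrow> real \<times> real \<Rightarrow> real" where
  "first_fundamental_form F x v w = frechet_derivative F (at x) v \<bullet> frechet_derivative F (at x) w"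

text \<open>The form \<open>s\<^bsup>2k\<^esup> ds\<^sup>2 + U(s)\<^sup>2 dt\<^sup>2\<close> at the point \<open>x = (s, t)\<close>.\<close>

definition edge_metric ::
  "nat \<Rightarrow> (real \<Rightarrow> real) \<Rightarrow> real \<times> real \<Rightarrow> real \<times> real \<Rightarrow> real \<times> real \<Rightarrow> real" where
  "edge_metric k U x v w = fst x ^ (2 * k) * (fst v * fst w) + (U (fst x))\<^sup>2 * (snd v * snd w)"


section \<open>The family of helicoidal edges\<close>

definition bour_rho ::
  "real \<Rightarrow> real \<Rightarrow> (real \<Rightarrow> real) \<Rightarrow> (real \<Rightarrow> real) \<Rightarrow> real \<Rightarrow> real" where
  "bour_rho m h U V s = sqrt (m\<^sup>2 * (U s)\<^sup>2 - h\<^sup>2 - m ^ 4 * (U s)\<^sup>2 * (V s)\<^sup>2)"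

text \<open>Since \<open>sqrt\<close> is total, the requirement that the radicand be nonnegative on \<open>J\<close>, implicit in
  \<open>bour_rho\<close> being a function on \<open>J\<close>, is stated separately.\<close>

definition star_condition ::
  "real set \<Rightarrow> (real \<Rightarrow> real) \<Rightarrow> (real \<Rightarrow> real) \<Rightarrow> real \<Rightarrow> real \<Rightarrow> bool" where
  "star_condition J U V h m \<longleftrightarrow>
     (\<forall>s\<in>J. m\<^sup>2 * (U s)\<^sup>2 - h\<^sup>2 - m ^ 4 * (U s)\<^sup>2 * (V s)\<^sup>2 \<ge> 0) \<and>
     smooth_on J (bour_rho m h U V) \<and> bour_rho m h U V 0 \<noteq> 0"

text \<open>The expressions below divide by \<open>m\<^sup>2 U(s)\<^sup>2 - h\<^sup>2\<close>. The condition above makes this nonnegative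
  on \<open>J\<close> and positive near \<open>0\<close>, but does not exclude a zero of it elsewhere in \<open>J\<close>, where the
  integrands are undefined (and the integrals may diverge).\<close>

definition bour_defined :: "real set \<Rightarrow> (real \<Rightarrow> real) \<Rightarrow> real \<Rightarrow> real \<Rightarrow> bool" where
  "bour_defined J U h m \<longleftrightarrow> (\<forall>s\<in>J. m\<^sup>2 * (U s)\<^sup>2 - h\<^sup>2 \<noteq> 0)"

definition bour_x :: "real \<Rightarrow> real \<Rightarrow> (real \<Rightarrow> real) \<Rightarrow> real \<Rightarrow> real \<Rightarrow> real" where
  "bour_x m h U \<epsilon>0 s = \<epsilon>0 * sqrt (m\<^sup>2 * (U s)\<^sup>2 - h\<^sup>2)"

definition bour_z ::
  "nat \<Rightarrow> real \<Rightarrow> real \<Rightarrow> (real \<Rightarrow> real) \<Rightarrow> (real \<Rightarrow> real) \<Rightarrow> real \<Rightarrow> real \<Rightarrow> real" where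
  "bour_z k m h U V \<epsilon>2 s =
     \<epsilon>2 * m * (LBINT \<zeta>=ereal 0..ereal s.
       \<zeta> ^ k * U \<zeta> * bour_rho m h U V \<zeta> / (m\<^sup>2 * (U \<zeta>)\<^sup>2 - h\<^sup>2))"

definition bour_theta ::
  "nat \<Rightarrow> real \<Rightarrow> real \<Rightarrow> (real \<Rightarrow> real) \<Rightarrow> (real \<Rightarrow> real) \<Rightarrow> real \<Rightarrow> real \<Rightarrow> real \<Rightarrow> real \<Rightarrow> real" where
  "bour_theta k m h U V \<epsilon>1 \<epsilon>2 s t =
     1 / m * (\<epsilon>1 * t - \<epsilon>2 * h * (LBINT \<zeta>=ereal 0..ereal s.
       \<zeta> ^ k * bour_rho m h U V \<zeta> / (U \<zeta> * (m\<^sup>2 * (U \<zeta>)\<^sup>2 - h\<^sup>2))))"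

definition bour_map ::
  "nat \<Rightarrow> real \<Rightarrow> real \<Rightarrow> (real \<Rightarrow> real) \<Rightarrow> (real \<Rightarrow> real) \<Rightarrow> real \<Rightarrow> real \<Rightarrow> real \<Rightarrow>
   real \<times> real \<Rightarrow> real^3" where
  "bour_map k m h U V \<epsilon>0 \<epsilon>1 \<epsilon>2 = (\<lambda>(s, t).
     vector [bour_x m h U \<epsilon>0 s * cos (bour_theta k m h U V \<epsilon>1 \<epsilon>2 s t),
             bour_x m h U \<epsilon>0 s * sin (bour_theta k m h U V \<epsilon>1 \<epsilon>2 s t),
             bour_z k m h U V \<epsilon>2 s + h * bour_theta k m h U V \<epsilon>1 \<epsilon>2 s t])"

end

theory Submission
  imports Defs
begin

text \<open>
  Direct half. Because \<open>U' = s\<^sup>k V\<close>, the derivatives in \<open>s\<close> of the radius, the angle and the height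
  function \<open>z\<close> are all divisible by \<open>s\<^sup>k\<close>, so the partial derivatives of the surface are \<open>s\<^sup>k P\<close> and \<open>Q\<close>
  with smooth \<open>P\<close> and \<open>Q\<close>. The two integrals in the definition of the family are chosen such that \<open>P\<close> is
  a unit vector orthogonal to \<open>Q\<close>, and \<open>\<bar>Q\<bar> = U\<close> (\<open>PQ_inner\<close>). This one computation yields the first
  fundamental form, the singular set \<open>s = 0\<close>, and the unit normal \<open>P \<times> Q / U\<close> that extends across it. The
  condition \<open>\<rho>(0) \<noteq> 0\<close> says that \<open>z'\<close> vanishes to order exactly \<open>k\<close> at \<open>0\<close>. It makes \<open>\<plusminus> (z - z(0))\<close> the
  \<open>(k+1)\<close>-st power of a parameter \<open>u\<close> of the profile (\<open>profile_normal_form\<close>), from which the normal form of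
  the edge follows in cylindrical coordinates, and it makes the limiting normal curvature nonzero.

  Converse. The velocity field \<open>K\<close> of the motion is tangent to the surface \<open>F\<close>, and bounded
  coefficients \<open>\<alpha>\<close>, \<open>\<beta>\<close> express it as \<open>K(F) = \<alpha> F\<^sub>s + \<beta> F\<^sub>t\<close> (\<open>tangential_velocity\<close>). Since \<open>K\<close> generates
  isometries, this is a Killing field of \<open>s\<^bsup>2k\<^esup> ds\<^sup>2 + U\<^sup>2 dt\<^sup>2\<close>; Killing's equation makes \<open>s\<^sup>k \<alpha>\<close> independent
  of \<open>s\<close> on each side of the edge, so \<open>\<alpha> = 0\<close> by boundedness, and then \<open>\<beta>\<close> is a constant
  (\<open>killing_field_is_translation\<close>). It is nonzero because a nontrivial infinitesimal isometry does not
  vanish on a surface. Thus \<open>F\<^sub>t\<close> is a screw field along \<open>F\<close>, which by genericity is not a translation: the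
  lines \<open>s = const\<close> are helices about a common axis, and \<open>m\<close>, \<open>h\<close> are read off from their velocity.

  It remains to determine one line \<open>t = const\<close> (\<open>helicoidal_profile\<close>). The metric prescribes its distance
  from the axis, the rotation in terms of the ascent \<open>\<eta>\<close>, and the square of \<open>\<eta>\<close>, namely
  \<open>m\<^sup>2 U\<^sup>2 \<eta>\<^sup>2 = s\<^bsup>2k\<^esup> \<rho>\<^sup>2\<close>. As \<open>\<eta>\<close> is smooth, it is \<open>s\<^sup>k\<close> times a smooth function (\<open>smooth_square_divide\<close>), whose
  value at \<open>0\<close> is nonzero by genericity; so one sign \<open>\<epsilon>\<^sub>2\<close> is valid on both sides of the edge. The signs
  \<open>\<epsilon>\<^sub>0\<close> and \<open>\<epsilon>\<^sub>1\<close> can be taken to be \<open>1\<close> by the choice of the axis direction and of the frame around it.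
\<close>

section \<open>Smooth maps\<close>

lemma C_times_on_SucD: "C_times_on (Suc n) f S \<Longrightarrow> C_times_on n f S"
proof (induction n arbitrary: f)
  case 0
  then show ?case
    using differentiable_at_withinI
    by (fastforce intro!: differentiable_imp_continuous_on simp: differentiable_on_def)
next
  case (Suc n)
  have "C_times_on n (\<lambda>x. frechet_derivative f (at x) v) S" for v
    using Suc.prems by (intro Suc.IH) auto
  then show ?case
    using Suc.prems by (subst C_times_on.simps) simp
qed

lemma C_times_on_le: "C_times_on n f S \<Longrightarrow> m \<le> n \<Longrightarrow> C_times_on m f S"
  by (induction n) (auto simp: le_Suc_eq simp del: C_times_on.simps dest: C_times_on_SucD)

lemma C_times_on_imp_continuous_on: "C_times_on n f S \<Longrightarrow> continuous_on S f"
  using C_times_on_le[of n f S 0] by simp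

lemma C_times_on_SucI:
  assumes "\<And>x. x \<in> S \<Longrightarrow> f differentiable (at x)"
    and "\<And>v. C_times_on n (\<lambda>x. frechet_derivative f (at x) v) S"
  shows "C_times_on (Suc n) f S"
  using assms by simp

text \<open>Derivatives are taken in the whole space, so openness of \<open>S\<close> is what makes them depend only on the
  values on \<open>S\<close>.\<close>

lemma C_times_on_cong:
  assumes "open S" and "\<And>x. x \<in> S \<Longrightarrow> f x = g x"
  shows "C_times_on n f S \<longleftrightarrow> C_times_on n g S"
proof -
  have imp: "C_times_on n f S \<Longrightarrow> (\<And>x. x \<in> S \<Longrightarrow> f x = g x) \<Longrightarrow> C_times_on n g S"
    for f g :: "'a \<Rightarrow> 'b"
  proof (induction n arbitrary: f g)
    case 0
    have "continuous_on S f" using "0.prems"(1) by simp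
    then have "continuous_on S g"
      by (rule continuous_on_eq) (rule "0.prems"(2))
    then show ?case by simp
  next
    case (Suc n)
    note prem = Suc.prems(1)[unfolded C_times_on.simps]
    have d: "(g has_derivative frechet_derivative f (at x)) (at x)" if x: "x \<in> S" for x
    proof (rule has_derivative_transform_within_open[OF _ assms(1) x Suc.prems(2)])
      show "(f has_derivative frechet_derivative f (at x)) (at x)"
        using prem x frechet_derivative_works by blast
    qed
    have e: "frechet_derivative f (at x) v = frechet_derivative g (at x) v" if "x \<in> S" for x v
      using frechet_derivative_at[OF d[OF that]] by simp
    show ?case
    proof (rule C_times_on_SucI)
      show "C_times_on n (\<lambda>x. frechet_derivative g (at x) v) S" for v
      proof (rule Suc.IH)
        show "C_times_on n (\<lambda>x. frechet_derivative f (at x) v) S" using prem by blast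
      qed (rule e)
      show "g differentiable (at x)" if "x \<in> S" for x
        using d[OF that] differentiableI by blast
    qed
  qed
  show ?thesis using imp[of f g] imp[of g f] assms(2) by auto
qed

text \<open>The form in which the recursion is used: any formula for the derivative will do.\<close>

lemma C_times_on_Suc_derivI:
  assumes "open S" and "\<And>x. x \<in> S \<Longrightarrow> (f has_derivative f' x) (at x)"
    and "\<And>v. C_times_on n (\<lambda>x. f' x v) S"
  shows "C_times_on (Suc n) f S"
proof (rule C_times_on_SucI)
  show "f differentiable at x" if "x \<in> S" for x
    using assms(2)[OF that] by (auto simp: differentiable_def)
  have e: "frechet_derivative f (at x) v = f' x v" if "x \<in> S" for x v
    using frechet_derivative_at[OF assms(2)[OF that]] by simp
  show "C_times_on n (\<lambda>x. frechet_derivative f (at x) v) S" for v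
    by (rule C_times_on_cong[OF assms(1), THEN iffD2, OF e assms(3)])
qed

lemma C_times_on_derivD:
  assumes "C_times_on (Suc n) f S" "x \<in> S"
  shows "(f has_derivative frechet_derivative f (at x)) (at x)"
  using assms by (simp add: frechet_derivative_works[symmetric])

lemma C_times_on_subset: "C_times_on n f S \<Longrightarrow> T \<subseteq> S \<Longrightarrow> C_times_on n f T"
  by (induction n arbitrary: f) (auto intro: continuous_on_subset)

lemma C_times_on_const: "C_times_on n (\<lambda>x. c) S"
  by (induction n arbitrary: c) auto

lemma C_times_on_bounded_linear:
  assumes "open S" "bounded_linear L"
  shows "C_times_on n L S"
proof (cases n)
  case 0
  then show ?thesis
    using assms(2) by (simp add: linear_continuous_on)
next
  case (Suc m)
  then show ?thesis
    using assms C_times_on_const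
    by (auto intro!: C_times_on_Suc_derivI[of S L "\<lambda>x. L"] bounded_linear_imp_has_derivative
        simp del: C_times_on.simps)
qed

lemma C_times_on_add:
  assumes "open S"
  shows "C_times_on n f S \<Longrightarrow> C_times_on n g S \<Longrightarrow> C_times_on n (\<lambda>x. f x + g x) S"
proof (induction n arbitrary: f g)
  case 0
  then show ?case by (simp add: continuous_on_add)
next
  case (Suc n)
  have "((\<lambda>x. f x + g x) has_derivative
      (\<lambda>v. frechet_derivative f (at x) v + frechet_derivative g (at x) v)) (at x)" if "x \<in> S" for x
    by (intro has_derivative_add C_times_on_derivD[OF Suc.prems(1) that]
        C_times_on_derivD[OF Suc.prems(2) that])
  moreover have "C_times_on n (\<lambda>x. frechet_derivative f (at x) v + frechet_derivative g (at x) v) S" for v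
    using Suc by auto
  ultimately show ?case by (rule C_times_on_Suc_derivI[OF assms])
qed

lemma C_times_on_bilinear:
  assumes "open S" "bounded_bilinear B"
  shows "C_times_on n f S \<Longrightarrow> C_times_on n g S \<Longrightarrow> C_times_on n (\<lambda>x. B (f x) (g x)) S"
proof (induction n arbitrary: f g)
  case 0
  then show ?case by (simp add: bounded_bilinear.continuous_on[OF assms(2)])
next
  case (Suc n)
  have "((\<lambda>x. B (f x) (g x)) has_derivative
      (\<lambda>v. B (f x) (frechet_derivative g (at x) v) + B (frechet_derivative f (at x) v) (g x))) (at x)"
    if "x \<in> S" for x
    by (intro bounded_bilinear.FDERIV[OF assms(2)] C_times_on_derivD[OF Suc.prems(1) that]
        C_times_on_derivD[OF Suc.prems(2) that])
  moreover have "C_times_on n (\<lambda>x. B (f x) (frechet_derivative g (at x) v)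
      + B (frechet_derivative f (at x) v) (g x)) S" for v
    using Suc.prems C_times_on_SucD[OF Suc.prems(1)] C_times_on_SucD[OF Suc.prems(2)]
    by (intro C_times_on_add[OF assms(1)] Suc.IH) auto
  ultimately show ?case by (rule C_times_on_Suc_derivI[OF assms(1)])
qed

lemma C_times_on_sum:
  assumes "open S" "finite I"
  shows "(\<And>i. i \<in> I \<Longrightarrow> C_times_on n (f i) S) \<Longrightarrow> C_times_on n (\<lambda>x. \<Sum>i\<in>I. f i x) S"
  using assms(2) by (induction I) (auto intro: C_times_on_const C_times_on_add[OF assms(1)])

text \<open>Expanding the inner direction in the standard basis turns the chain rule into a finite sum of
  products, each factor of which is covered by the induction hypothesis.\<close>

lemma C_times_on_compose:
  fixes f :: "'a::euclidean_space \<Rightarrow> 'b::euclidean_space" and g :: "'b \<Rightarrow> 'c::real_normed_vector"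
  assumes "open S" "open T" "f ` S \<subseteq> T"
  shows "C_times_on n f S \<Longrightarrow> C_times_on n g T \<Longrightarrow> C_times_on n (\<lambda>x. g (f x)) S"
proof (induction n arbitrary: g)
  case 0
  then show ?case using assms(3) by (auto intro: continuous_on_compose2)
next
  case (Suc n)
  let ?D = "\<lambda>x v. \<Sum>b\<in>Basis. (frechet_derivative f (at x) v \<bullet> b) *\<^sub>R frechet_derivative g (at (f x)) b"
  have "((\<lambda>x. g (f x)) has_derivative ?D x) (at x)" if x: "x \<in> S" for x
  proof -
    have df: "(f has_derivative frechet_derivative f (at x)) (at x)"
      by (rule C_times_on_derivD[OF Suc.prems(1) x])
    have dg: "(g has_derivative frechet_derivative g (at (f x))) (at (f x))"
      using assms(3) x by (intro C_times_on_derivD[OF Suc.prems(2)]) auto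
    interpret L: linear "frechet_derivative g (at (f x))"
      using dg has_derivative_linear by blast
    have "frechet_derivative g (at (f x)) w
        = (\<Sum>b\<in>Basis. (w \<bullet> b) *\<^sub>R frechet_derivative g (at (f x)) b)" for w
    proof -
      have "frechet_derivative g (at (f x)) w
          = frechet_derivative g (at (f x)) (\<Sum>b\<in>Basis. (w \<bullet> b) *\<^sub>R b)"
        by (simp only: euclidean_representation)
      then show ?thesis by (simp only: L.sum L.scale)
    qed
    from this[symmetric] have "?D x = (\<lambda>v. frechet_derivative g (at (f x)) (frechet_derivative f (at x) v))"
      by (rule ext)
    then show ?thesis
      using has_derivative_compose[OF df dg] by (simp only:)
  qed
  moreover have "C_times_on n (\<lambda>x. ?D x v) S" for v
  proof (intro C_times_on_sum C_times_on_bilinear[OF assms(1) bounded_bilinear_scaleR] assms(1))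
    show "C_times_on n (\<lambda>x. frechet_derivative f (at x) v \<bullet> b) S" for b
      using Suc.prems(1)
      by (intro C_times_on_bilinear[OF assms(1) bounded_bilinear_inner] C_times_on_const) auto
    show "C_times_on n (\<lambda>x. frechet_derivative g (at (f x)) b) S" for b
      using Suc.prems C_times_on_SucD[OF Suc.prems(1)] by (intro Suc.IH) auto
  qed auto
  ultimately show ?case by (rule C_times_on_Suc_derivI[OF assms(1)])
qed

lemma smooth_on_cong:
  "open S \<Longrightarrow> (\<And>x. x \<in> S \<Longrightarrow> f x = g x) \<Longrightarrow> smooth_on S f \<longleftrightarrow> smooth_on S g"
  unfolding smooth_on_def using C_times_on_cong by blast

lemma smooth_on_subset: "smooth_on S f \<Longrightarrow> T \<subseteq> S \<Longrightarrow> smooth_on T f"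
  unfolding smooth_on_def using C_times_on_subset by blast

lemma smooth_on_imp_continuous_on: "smooth_on S f \<Longrightarrow> continuous_on S f"
  unfolding smooth_on_def using C_times_on_imp_continuous_on by blast

lemma smooth_on_has_derivative:
  "smooth_on S f \<Longrightarrow> x \<in> S \<Longrightarrow> (f has_derivative frechet_derivative f (at x)) (at x)"
  unfolding smooth_on_def using C_times_on_derivD by blast

lemma smooth_on_frechet_derivative:
  "smooth_on S f \<Longrightarrow> smooth_on S (\<lambda>x. frechet_derivative f (at x) v)"
  unfolding smooth_on_def using C_times_on.simps(2) by blast

lemma smooth_on_const: "smooth_on S (\<lambda>x. c)"
  by (simp add: smooth_on_def C_times_on_const)

lemma smooth_on_bounded_linear: "open S \<Longrightarrow> bounded_linear L \<Longrightarrow> smooth_on S L"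
  by (simp add: smooth_on_def C_times_on_bounded_linear)

lemma smooth_on_id: "open S \<Longrightarrow> smooth_on S (\<lambda>x. x)"
  by (rule smooth_on_bounded_linear) (auto simp: bounded_linear_ident)

lemma smooth_on_add:
  "open S \<Longrightarrow> smooth_on S f \<Longrightarrow> smooth_on S g \<Longrightarrow> smooth_on S (\<lambda>x. f x + g x)"
  by (simp add: smooth_on_def C_times_on_add)

lemma smooth_on_bilinear:
  "open S \<Longrightarrow> bounded_bilinear B \<Longrightarrow> smooth_on S f \<Longrightarrow> smooth_on S g
    \<Longrightarrow> smooth_on S (\<lambda>x. B (f x) (g x))"
  by (simp add: smooth_on_def C_times_on_bilinear)

lemmas smooth_on_scaleR = smooth_on_bilinear[OF _ bounded_bilinear_scaleR]
lemmas smooth_on_inner = smooth_on_bilinear[OF _ bounded_bilinear_inner]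

lemma smooth_on_mult:
  fixes f g :: "'a::euclidean_space \<Rightarrow> real"
  shows "open S \<Longrightarrow> smooth_on S f \<Longrightarrow> smooth_on S g \<Longrightarrow> smooth_on S (\<lambda>x. f x * g x)"
  by (rule smooth_on_bilinear[OF _ bounded_bilinear_mult])

lemma smooth_on_compose:
  fixes f :: "'a::euclidean_space \<Rightarrow> 'b::euclidean_space" and g :: "'b \<Rightarrow> 'c::real_normed_vector"
  shows "open S \<Longrightarrow> open T \<Longrightarrow> f ` S \<subseteq> T \<Longrightarrow> smooth_on S f \<Longrightarrow> smooth_on T g
    \<Longrightarrow> smooth_on S (\<lambda>x. g (f x))"
  unfolding smooth_on_def using C_times_on_compose by blast

lemma smooth_on_linear_compose:
  fixes f :: "'a::euclidean_space \<Rightarrow> 'b::euclidean_space" and L :: "'b \<Rightarrow> 'c::real_normed_vector"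
  shows "open S \<Longrightarrow> bounded_linear L \<Longrightarrow> smooth_on S f \<Longrightarrow> smooth_on S (\<lambda>x. L (f x))"
  using smooth_on_compose[of S UNIV f L] smooth_on_bounded_linear[of UNIV L] by auto

lemma smooth_on_minus:
  fixes f :: "'a::euclidean_space \<Rightarrow> 'b::euclidean_space"
  shows "open S \<Longrightarrow> smooth_on S f \<Longrightarrow> smooth_on S (\<lambda>x. - f x)"
  by (rule smooth_on_linear_compose[OF _ bounded_linear_minus[OF bounded_linear_ident]])

lemma smooth_on_diff:
  fixes f :: "'a::euclidean_space \<Rightarrow> 'b::euclidean_space"
  shows "open S \<Longrightarrow> smooth_on S f \<Longrightarrow> smooth_on S g \<Longrightarrow> smooth_on S (\<lambda>x. f x - g x)"
  using smooth_on_add[of S f "\<lambda>x. - g x"] smooth_on_minus[of S g] by simp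

lemma smooth_on_power:
  fixes f :: "'a::euclidean_space \<Rightarrow> real"
  shows "open S \<Longrightarrow> smooth_on S f \<Longrightarrow> smooth_on S (\<lambda>x. f x ^ n)"
  by (induction n) (auto intro: smooth_on_const smooth_on_mult)

lemma smooth_on_fst: 
  fixes f :: "'a::euclidean_space \<Rightarrow> 'b::euclidean_space \<times> 'c::euclidean_space"
  shows "open S \<Longrightarrow> smooth_on S f \<Longrightarrow> smooth_on S (\<lambda>x. fst (f x))"
  by (rule smooth_on_linear_compose[OF _ bounded_linear_fst])

lemma smooth_on_snd: 
  fixes f :: "'a::euclidean_space \<Rightarrow> 'b::euclidean_space \<times> 'c::euclidean_space"
  shows "open S \<Longrightarrow> smooth_on S f \<Longrightarrow> smooth_on S (\<lambda>x. snd (f x))"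
  by (rule smooth_on_linear_compose[OF _ bounded_linear_snd])

lemma smooth_on_vec_nth: 
  fixes f :: "'a::euclidean_space \<Rightarrow> real^'n"
  shows "open S \<Longrightarrow> smooth_on S f \<Longrightarrow> smooth_on S (\<lambda>x. f x $ i)"
  by (rule smooth_on_linear_compose[OF _ bounded_linear_vec_nth])

lemma smooth_on_Pair:
  fixes f :: "'a::euclidean_space \<Rightarrow> 'b::euclidean_space" and g :: "'a \<Rightarrow> 'c::euclidean_space"
  assumes "open S" "smooth_on S f" "smooth_on S g"
  shows "smooth_on S (\<lambda>x. (f x, g x))"
proof -
  have "bounded_linear (\<lambda>y::'b. (y, 0::'c))" "bounded_linear (\<lambda>y::'c. (0::'b, y))"
    by (auto intro!: bounded_linear_Pair bounded_linear_ident bounded_linear_zero)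
  from smooth_on_add[OF assms(1) smooth_on_linear_compose[OF assms(1) this(1) assms(2)]
      smooth_on_linear_compose[OF assms(1) this(2) assms(3)]]
  show ?thesis by simp
qed

lemma vector3_eq: "(vector [a, b, c] :: real^3) = a *\<^sub>R axis 1 1 + b *\<^sub>R axis 2 1 + c *\<^sub>R axis 3 1"
  by (simp add: vec_eq_iff forall_3 axis_def)

lemma smooth_on_vector3:
  fixes a b c :: "'a::euclidean_space \<Rightarrow> real"
  assumes "open S" "smooth_on S a" "smooth_on S b" "smooth_on S c"
  shows "smooth_on S (\<lambda>x. vector [a x, b x, c x] :: real^3)"
  unfolding vector3_eq by (intro smooth_on_add smooth_on_scaleR smooth_on_const assms)

section \<open>Smooth functions of one variable\<close>

lemma C_times_on_Suc_realI:
  fixes f :: "real \<Rightarrow> 'b::real_normed_vector"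
  assumes "open S" "\<And>x. x \<in> S \<Longrightarrow> (f has_vector_derivative f' x) (at x)" "C_times_on n f' S"
  shows "C_times_on (Suc n) f S"
  by (rule C_times_on_Suc_derivI[of S f "\<lambda>x v. v *\<^sub>R f' x"])
     (use assms in \<open>auto simp: has_vector_derivative_def
       intro: C_times_on_bilinear[OF _ bounded_bilinear_scaleR] C_times_on_const\<close>)

text \<open>A differential equation raises the regularity of its solution by one as long as its right-hand side
  is as regular as the solution. The standard functions below, and local inverses later, satisfy such
  an equation: \<open>y' = - y\<^sup>2\<close> for the reciprocal, for instance.\<close>

lemma smooth_on_bootstrap:
  fixes f :: "real \<Rightarrow> 'b::real_normed_vector"
  assumes "open S" "\<And>x. x \<in> S \<Longrightarrow> (f has_vector_derivative f' x) (at x)"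
    and "\<And>n. C_times_on n f S \<Longrightarrow> C_times_on n f' S"
  shows "smooth_on S f"
proof -
  have "C_times_on n f S" for n
  proof (induction n)
    case 0
    have "continuous_on S f"
      using assms(2) has_vector_derivative_continuous
      by (intro continuous_at_imp_continuous_on) blast
    then show ?case by simp
  next
    case (Suc n)
    show ?case
      using assms(2) by (rule C_times_on_Suc_realI[OF assms(1)]) (auto intro: assms(3) Suc)
  qed
  then show ?thesis by (simp add: smooth_on_def)
qed

lemma smooth_on_antiderivative:
  fixes f :: "real \<Rightarrow> 'b::real_normed_vector"
  assumes "open S" "\<And>x. x \<in> S \<Longrightarrow> (f has_vector_derivative f' x) (at x)" "smooth_on S f'"
  shows "smooth_on S f"
  using assms(3) by (intro smooth_on_bootstrap[OF assms(1,2)]) (auto simp: smooth_on_def)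

lemma smooth_on_has_vector_derivative:
  fixes f :: "real \<Rightarrow> 'b::real_normed_vector"
  assumes "smooth_on S f" "x \<in> S"
  shows "(f has_vector_derivative frechet_derivative f (at x) 1) (at x)"
proof -
  note d = smooth_on_has_derivative[OF assms]
  have "frechet_derivative f (at x) v = v *\<^sub>R frechet_derivative f (at x) 1" for v
    using linear_scale[OF has_derivative_linear[OF d], of v 1] by simp
  then have "frechet_derivative f (at x) = (\<lambda>v. v *\<^sub>R frechet_derivative f (at x) 1)"
    by (rule ext)
  with d show ?thesis by (simp only: has_vector_derivative_def)
qed

lemma smooth_on_real_derivativeE:
  fixes f :: "real \<Rightarrow> real"
  assumes "smooth_on S f"
  obtains f' where "smooth_on S f'" "\<And>x. x \<in> S \<Longrightarrow> (f has_real_derivative f' x) (at x)"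
  using smooth_on_frechet_derivative[OF assms, of 1] smooth_on_has_vector_derivative[OF assms]
  by (auto simp: has_real_derivative_iff_has_vector_derivative)

lemma smooth_on_inverse_real: "smooth_on (- {0}) (inverse :: real \<Rightarrow> real)"
proof (rule smooth_on_bootstrap)
  show "(inverse has_vector_derivative - (inverse x * inverse x)) (at x)" if "x \<in> - {0}" for x :: real
    using that DERIV_inverse[of x UNIV]
    by (simp add: has_real_derivative_iff_has_vector_derivative power2_eq_square numeral_2_eq_2)
  show "C_times_on n (\<lambda>x::real. - (inverse x * inverse x)) (- {0})"
    if "C_times_on n (inverse :: real \<Rightarrow> real) (- {0})" for n
  proof -
    have "C_times_on n (\<lambda>x. (-1) * (inverse x * inverse x) :: real) (- {0})"
      by (intro C_times_on_bilinear[OF _ bounded_bilinear_mult] C_times_on_const that) auto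
    then show ?thesis by simp
  qed
qed auto

lemma smooth_on_inverse:
  fixes f :: "'a::euclidean_space \<Rightarrow> real"
  assumes "open S" "smooth_on S f" "\<And>x. x \<in> S \<Longrightarrow> f x \<noteq> 0"
  shows "smooth_on S (\<lambda>x. inverse (f x))"
  using assms by (intro smooth_on_compose[OF _ _ _ _ smooth_on_inverse_real]) auto

lemma smooth_on_divide:
  fixes f g :: "'a::euclidean_space \<Rightarrow> real"
  assumes "open S" "smooth_on S f" "smooth_on S g" "\<And>x. x \<in> S \<Longrightarrow> g x \<noteq> 0"
  shows "smooth_on S (\<lambda>x. f x / g x)"
  unfolding divide_inverse using assms by (intro smooth_on_mult smooth_on_inverse)

lemma smooth_on_exp_real: "smooth_on UNIV (exp :: real \<Rightarrow> real)"
  by (rule smooth_on_bootstrap[of _ _ exp])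
     (auto simp flip: has_real_derivative_iff_has_vector_derivative)

lemma smooth_on_sin_cos_real:
  "smooth_on UNIV (sin :: real \<Rightarrow> real)" "smooth_on UNIV (cos :: real \<Rightarrow> real)"
proof -
  have "smooth_on UNIV (\<lambda>x::real. (sin x, cos x))"
  proof (rule smooth_on_bootstrap)
    show "((\<lambda>x. (sin x, cos x)) has_vector_derivative (cos x, - sin x)) (at x)" for x :: real
      by (intro has_vector_derivative_Pair)
         (auto intro!: derivative_eq_intros simp flip: has_real_derivative_iff_has_vector_derivative)
    have "bounded_linear (\<lambda>p :: real \<times> real. (snd p, - fst p))"
      by (auto intro!: bounded_linear_Pair bounded_linear_minus bounded_linear_fst bounded_linear_snd)
    from C_times_on_compose[OF _ _ _ _ C_times_on_bounded_linear[OF _ this], of UNIV UNIV "\<lambda>x. (sin x, cos x)"]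
    show "C_times_on n (\<lambda>x::real. (cos x, - sin x)) UNIV" if "C_times_on n (\<lambda>x::real. (sin x, cos x)) UNIV" for n
      using that by simp
  qed auto
  then show "smooth_on UNIV (sin :: real \<Rightarrow> real)" "smooth_on UNIV (cos :: real \<Rightarrow> real)"
    using smooth_on_fst[of UNIV "\<lambda>x. (sin x, cos x)"] smooth_on_snd[of UNIV "\<lambda>x. (sin x, cos x)"] by auto
qed

lemma smooth_on_ln_real: "smooth_on {0<..} (ln :: real \<Rightarrow> real)"
proof (rule smooth_on_antiderivative)
  show "(ln has_vector_derivative inverse x) (at x)" if "x \<in> {0<..}" for x :: real
    using that DERIV_ln[of x] by (simp add: has_real_derivative_iff_has_vector_derivative)
qed (auto intro: smooth_on_subset[OF smooth_on_inverse_real])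

lemma smooth_on_arctan_real: "smooth_on UNIV arctan"
proof (rule smooth_on_antiderivative)
  show "(arctan has_vector_derivative inverse (1 + x\<^sup>2)) (at x)" for x
    using DERIV_arctan[of x] by (simp add: has_real_derivative_iff_has_vector_derivative)
  show "smooth_on UNIV (\<lambda>x::real. inverse (1 + x\<^sup>2))"
    by (intro smooth_on_inverse smooth_on_add smooth_on_const smooth_on_power smooth_on_id)
       (auto simp: add_nonneg_eq_0_iff)
qed auto

lemma smooth_on_exp: "open S \<Longrightarrow> smooth_on S f \<Longrightarrow> smooth_on S (\<lambda>x. exp (f x :: real))"
  by (erule smooth_on_compose[OF _ _ _ _ smooth_on_exp_real, rotated 3]) auto

lemma smooth_on_sin: "open S \<Longrightarrow> smooth_on S f \<Longrightarrow> smooth_on S (\<lambda>x. sin (f x :: real))"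
  by (erule smooth_on_compose[OF _ _ _ _ smooth_on_sin_cos_real(1), rotated 3]) auto

lemma smooth_on_cos: "open S \<Longrightarrow> smooth_on S f \<Longrightarrow> smooth_on S (\<lambda>x. cos (f x :: real))"
  by (erule smooth_on_compose[OF _ _ _ _ smooth_on_sin_cos_real(2), rotated 3]) auto

lemma smooth_on_arctan: "open S \<Longrightarrow> smooth_on S f \<Longrightarrow> smooth_on S (\<lambda>x. arctan (f x))"
  by (erule smooth_on_compose[OF _ _ _ _ smooth_on_arctan_real, rotated 3]) auto

lemma smooth_on_ln:
  fixes f :: "'a::euclidean_space \<Rightarrow> real"
  shows "open S \<Longrightarrow> smooth_on S f \<Longrightarrow> (\<And>x. x \<in> S \<Longrightarrow> f x > 0) \<Longrightarrow> smooth_on S (\<lambda>x. ln (f x))"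
  by (erule smooth_on_compose[OF _ _ _ _ smooth_on_ln_real, rotated 3]) auto

lemma smooth_on_powr:
  fixes f :: "'a::euclidean_space \<Rightarrow> real"
  assumes "open S" "smooth_on S f" "\<And>x. x \<in> S \<Longrightarrow> f x > 0"
  shows "smooth_on S (\<lambda>x. f x powr r)"
proof -
  have "smooth_on S (\<lambda>x. exp (r * ln (f x)))"
    by (intro smooth_on_exp smooth_on_mult smooth_on_const smooth_on_ln assms)
  then show ?thesis
    by (rule smooth_on_cong[OF assms(1), THEN iffD1, rotated]) (use assms(3) in \<open>force simp: powr_def\<close>)
qed

lemma smooth_on_sqrt:
  fixes f :: "'a::euclidean_space \<Rightarrow> real"
  assumes "open S" "smooth_on S f" "\<And>x. x \<in> S \<Longrightarrow> f x > 0"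
  shows "smooth_on S (\<lambda>x. sqrt (f x))"
  by (rule smooth_on_cong[OF assms(1), THEN iffD1, OF _ smooth_on_powr[OF assms, of "1/2"]])
     (use assms(3) in \<open>force simp: powr_half_sqrt less_imp_le\<close>)

lemmas smooth_on_intros = smooth_on_const smooth_on_id smooth_on_add smooth_on_diff smooth_on_minus
  smooth_on_mult smooth_on_scaleR smooth_on_inner smooth_on_power smooth_on_fst smooth_on_snd
  smooth_on_vec_nth smooth_on_Pair smooth_on_vector3 smooth_on_inverse smooth_on_divide smooth_on_exp
  smooth_on_sin smooth_on_cos smooth_on_arctan smooth_on_ln smooth_on_powr smooth_on_sqrt

section \<open>Division by powers and local inversion\<close>

lemma open_interval_enclose:
  fixes J :: "real set"
  assumes "open J" "is_interval J" "x \<in> J" "y \<in> J"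
  obtains a b where "a < x" "a < y" "x < b" "y < b" "{a..b} \<subseteq> J"
proof -
  have "min x y \<in> J" "max x y \<in> J"
    using assms by (auto simp: min_def max_def)
  then obtain d e where d: "d > 0" "cball (min x y) d \<subseteq> J" and e: "e > 0" "cball (max x y) e \<subseteq> J"
    using assms(1) open_contains_cball by meson
  have "min x y - d \<in> J" "max x y + e \<in> J"
    using d e by (auto simp: subset_iff dist_real_def)
  then have "{min x y - d..max x y + e} \<subseteq> J"
    using assms(2) unfolding is_interval_1 by (meson atLeastAtMost_iff subsetI)
  with d e show ?thesis by (intro that[of "min x y - d" "max x y + e"]) auto
qed

lemma LBINT_has_real_derivative:
  fixes f :: "real \<Rightarrow> real"
  assumes "open J" "is_interval J" "c \<in> J" "x \<in> J" "continuous_on J f"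
  shows "((\<lambda>u. LBINT y=ereal c..ereal u. f y) has_real_derivative f x) (at x)"
proof -
  obtain a b where ab: "a < c" "a < x" "c < b" "x < b" "{a..b} \<subseteq> J"
    using open_interval_enclose[OF assms(1-4)] by blast
  have "((\<lambda>u. LBINT y=ereal c..ereal u. f y) has_vector_derivative f x) (at x within {a..b})"
    using ab assms(5) by (intro interval_integral_FTC2) (auto intro: continuous_on_subset)
  moreover have "at x within {a..b} = at x"
    using ab by (intro at_within_interior) auto
  ultimately show ?thesis
    unfolding has_real_derivative_iff_has_vector_derivative by (simp only:)
qed

lemma scale_mem_interval:
  fixes J :: "real set"
  assumes "is_interval J" "0 \<in> J" "s \<in> J" "0 \<le> r" "r \<le> 1"
  shows "r * s \<in> J"
proof (cases "s \<ge> 0")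
  case True
  then have "0 \<le> r * s" "r * s \<le> s"
    using assms(4,5) by (auto intro: mult_left_le_one_le)
  then show ?thesis using assms(1-3) unfolding is_interval_1 by blast
next
  case False
  then have "r * s \<le> 0" "s \<le> r * s"
    using assms(4,5) mult_left_le_one_le[of "- s" r] by (auto simp: mult_nonneg_nonpos)
  then show ?thesis using assms(1-3) unfolding is_interval_1 by blast
qed

text \<open>Differentiation under the integral sign replaces \<open>\<tau>\<^sup>k a(\<tau> s)\<close> by \<open>\<tau>\<^bsup>k+1\<^esup> a'(\<tau> s)\<close>, an integral of
  the same kind.\<close>

lemma smooth_on_scaling_integral:
  fixes a :: "real \<Rightarrow> real"
  assumes J: "open J" "is_interval J" "0 \<in> J" and "smooth_on J a"
  shows "smooth_on J (\<lambda>s. integral {0..1} (\<lambda>r. r ^ k * a (r * s)))"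
proof -
  have cont: "continuous_on (J \<times> {0..1}) (\<lambda>(s, r). r ^ k * a (r * s))" if "smooth_on J a" for k a
  proof -
    have "continuous_on (J \<times> {0..1}) (\<lambda>x. a (snd x * fst x))"
      using scale_mem_interval[OF J(2,3)]
      by (intro continuous_on_compose2[OF smooth_on_imp_continuous_on[OF that]] continuous_intros) auto
    then show ?thesis unfolding split_beta by (intro continuous_intros)
  qed
  have cont1: "continuous_on {0..1} (\<lambda>r. r ^ k * a (r * s))" if "smooth_on J a" "s \<in> J" for k a s
  proof -
    have "continuous_on {0..1::real} (Pair s)" by (intro continuous_intros)
    from continuous_on_compose2[OF cont[OF that(1), of k] this] that(2) show ?thesis
      by (simp add: image_subset_iff)
  qed
  have "C_times_on n (\<lambda>s. integral {0..1} (\<lambda>r. r ^ k * a (r * s))) J" if "smooth_on J a" for n k a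
    using that
  proof (induction n arbitrary: k a)
    case 0
    show ?case
      using integral_continuous_on_param[of J 0 1 "\<lambda>s r. r ^ k * a (r * s)"] cont[OF 0] by simp
  next
    case (Suc n)
    obtain a' where a': "smooth_on J a'" "\<And>x. x \<in> J \<Longrightarrow> (a has_real_derivative a' x) (at x)"
      using smooth_on_real_derivativeE[OF Suc.prems] by blast
    have deriv: "((\<lambda>s. integral {0..1} (\<lambda>r. r ^ k * a (r * s))) has_vector_derivative
        integral {0..1} (\<lambda>r. r ^ Suc k * a' (r * s))) (at s)" if s: "s \<in> J" for s
    proof -
      have "((\<lambda>s. integral (cbox 0 1) (\<lambda>r. r ^ k * a (r * s))) has_vector_derivative
        integral (cbox 0 1) (\<lambda>r. r ^ Suc k * a' (r * s))) (at s within J)"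
      proof (rule leibniz_rule_vector_derivative[where fx = "\<lambda>s r. r ^ Suc k * a' (r * s)"])
        show "((\<lambda>s. r ^ k * a (r * s)) has_vector_derivative r ^ Suc k * a' (r * s)) (at s within J)"
          if "s \<in> J" "r \<in> cbox 0 1" for s r :: real
        proof -
          have "(a has_real_derivative a' (r * s)) (at (r * s))"
            using that scale_mem_interval[OF J(2,3)] by (intro a') auto
          then have "((\<lambda>s. a (r * s)) has_real_derivative a' (r * s) * r) (at s)"
            by (rule DERIV_chain2) (auto intro!: derivative_eq_intros)
          then have "((\<lambda>s. r ^ k * a (r * s)) has_real_derivative r ^ Suc k * a' (r * s)) (at s)"
            by (auto intro!: derivative_eq_intros)
          then show ?thesis
            by (simp add: has_real_derivative_iff_has_vector_derivative has_vector_derivative_at_within)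
        qed
        show "(\<lambda>r. r ^ k * a (r * s)) integrable_on cbox 0 1" if "s \<in> J" for s
          using cont1[OF Suc.prems that] by (intro integrable_continuous) simp
        show "continuous_on (J \<times> cbox 0 1) (\<lambda>(s, r). r ^ Suc k * a' (r * s))"
          using cont[OF a'(1), of "Suc k"] by simp
        show "convex J" using J(2) is_interval_convex by blast
      qed (rule s)
      then show ?thesis
        using at_within_open[OF s J(1)] by simp
    qed
    show ?case
      by (rule C_times_on_Suc_realI[OF J(1) deriv Suc.IH[OF a'(1)]])
  qed
  then show ?thesis using assms(4) by (simp add: smooth_on_def)
qed

text \<open>Hadamard's lemma for a zero of order \<open>k + 1\<close>: substituting \<open>r s\<close> for the integration variable in
  \<open>f(s) - f(0) = \<integral>f'\<close> exhibits the quotient as \<open>\<integral>\<^sub>0\<^sup>1 r\<^sup>k a(r s) dr\<close>.\<close>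

lemma smooth_factor_power:
  fixes f a :: "real \<Rightarrow> real"
  assumes J: "open J" "is_interval J" "0 \<in> J" and a: "smooth_on J a"
    and f: "\<And>s. s \<in> J \<Longrightarrow> (f has_real_derivative s ^ k * a s) (at s)"
  obtains A where "smooth_on J A" "\<And>s. s \<in> J \<Longrightarrow> f s = f 0 + s ^ Suc k * A s"
    "A 0 = a 0 / Suc k"
proof
  show "smooth_on J (\<lambda>s. integral {0..1} (\<lambda>r. r ^ k * a (r * s)))"
    by (rule smooth_on_scaling_integral[OF J a])
  show "f s = f 0 + s ^ Suc k * integral {0..1} (\<lambda>r. r ^ k * a (r * s))" if s: "s \<in> J" for s
  proof -
    have cont: "continuous_on {0..1} (\<lambda>r. r ^ k * a (r * s))"
      using scale_mem_interval[OF J(2,3) s]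
      by (intro continuous_intros continuous_on_compose2[OF smooth_on_imp_continuous_on[OF a]]) auto
    have "((\<lambda>r. s ^ Suc k * (r ^ k * a (r * s))) has_integral f (1 * s) - f (0 * s)) {0..1}"
    proof (rule fundamental_theorem_of_calculus)
      show "((\<lambda>r. f (r * s)) has_vector_derivative s ^ Suc k * (r ^ k * a (r * s)))
          (at r within {0..1})" if "r \<in> {0..1}" for r
      proof -
        have "(f has_real_derivative (r * s) ^ k * a (r * s)) (at (r * s))"
          using that scale_mem_interval[OF J(2,3) s] by (intro f) auto
        then have "((\<lambda>r. f (r * s)) has_real_derivative (r * s) ^ k * a (r * s) * s) (at r)"
          by (rule DERIV_chain2) (auto intro!: derivative_eq_intros)
        then have "((\<lambda>r. f (r * s)) has_real_derivative s ^ Suc k * (r ^ k * a (r * s))) (at r)"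
          by (simp add: power_mult_distrib mult_ac)
        then show ?thesis
          by (simp add: has_real_derivative_iff_has_vector_derivative has_vector_derivative_at_within)
      qed
    qed simp
    moreover have "((\<lambda>r. s ^ Suc k * (r ^ k * a (r * s))) has_integral
        s ^ Suc k * integral {0..1} (\<lambda>r. r ^ k * a (r * s))) {0..1}"
      using cont by (intro has_integral_mult_right integrable_integral integrable_continuous_interval)
    ultimately have "f (1 * s) - f (0 * s) = s ^ Suc k * integral {0..1} (\<lambda>r. r ^ k * a (r * s))"
      by (rule has_integral_unique)
    then show ?thesis by simp
  qed
  have "((\<lambda>r. r ^ k * a 0) has_integral 1 ^ Suc k * (a 0 / Suc k) - 0 ^ Suc k * (a 0 / Suc k)) {0..1}"
  proof (rule fundamental_theorem_of_calculus)
    show "((\<lambda>r. r ^ Suc k * (a 0 / Suc k)) has_vector_derivative r ^ k * a 0) (at r within {0..1})" for r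
      using DERIV_cmult_right[OF DERIV_pow[of "Suc k" r "{0..1}"], of "a 0 / Suc k"]
      by (simp add: has_real_derivative_iff_has_vector_derivative del: power_Suc of_nat_Suc)
  qed simp
  from integral_unique[OF this] show "integral {0..1} (\<lambda>r. r ^ k * a (r * 0)) = a 0 / Suc k"
    by (simp only: mult_zero_right power_one mult_1 power_0_Suc mult_zero_left diff_0_right)
qed

text \<open>Monotonicity gives the inverse, and \<open>w' = 1 / f'(w)\<close> its smoothness.\<close>

lemma smooth_local_inverse:
  fixes f :: "real \<Rightarrow> real"
  assumes "open S" "x0 \<in> S" "smooth_on S f" "(f has_real_derivative D) (at x0)" "D > 0"
  obtains d where "d > 0" "{x0 - d<..<x0 + d} \<subseteq> S" "inj_on f {x0 - d<..<x0 + d}"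
    "open (f ` {x0 - d<..<x0 + d})"
    "smooth_on (f ` {x0 - d<..<x0 + d}) (inv_into {x0 - d<..<x0 + d} f)"
proof -
  obtain f' where f': "smooth_on S f'" "\<And>x. x \<in> S \<Longrightarrow> (f has_real_derivative f' x) (at x)"
    using smooth_on_real_derivativeE[OF assms(3)] by blast
  have "f' x0 > 0"
    using DERIV_unique[OF assms(4) f'(2)[OF assms(2)]] assms(5) by simp
  moreover have "isCont f' x0"
    using smooth_on_imp_continuous_on[OF f'(1)] assms(1,2) by (simp add: continuous_on_eq_continuous_at)
  ultimately have "eventually (\<lambda>x. f' x > 0) (nhds x0)"
    unfolding isCont_def tendsto_at_iff_tendsto_nhds by (rule order_tendstoD(1)[rotated])
  moreover have "eventually (\<lambda>x. x \<in> S) (nhds x0)"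
    using assms(1,2) eventually_nhds by blast
  ultimately have "eventually (\<lambda>x. f' x > 0 \<and> x \<in> S) (nhds x0)" by eventually_elim simp
  then obtain d where d: "d > 0" "\<And>x. dist x x0 < d \<Longrightarrow> f' x > 0 \<and> x \<in> S"
    by (auto simp: eventually_nhds_metric)
  define I where "I = {x0 - d<..<x0 + d}"
  have I: "f' x > 0" "x \<in> S" if "x \<in> I" for x
    using d(2)[of x] that by (auto simp: I_def dist_real_def)
  have "strict_mono_on I f"
  proof (rule strict_mono_onI)
    show "f x < f y" if "x \<in> I" "y \<in> I" "x < y" for x y
    proof (rule DERIV_pos_imp_increasing[OF that(3)])
      show "\<exists>z. (f has_real_derivative z) (at w) \<and> z > 0" if "x \<le> w" "w \<le> y" for w
      proof -
        have "w \<in> I" using that \<open>x \<in> I\<close> \<open>y \<in> I\<close> by (auto simp: I_def)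
        then show ?thesis using I f'(2) by blast
      qed
    qed
  qed
  then have inj: "inj_on f I" by (rule strict_mono_on_imp_inj_on)
  have contf: "continuous_on I f"
    using smooth_on_imp_continuous_on[OF assms(3)] I(2) by (auto intro: continuous_on_subset)
  have "connected I" "open I" by (auto simp: I_def)
  then have op: "open (f ` I)"
    using injective_into_1d_imp_open_map_UNIV[of I I f] contf inj by (simp add: is_interval_connected_1)
  have der: "(inv_into I f has_vector_derivative inverse (f' (inv_into I f y))) (at y)" if y: "y \<in> f ` I" for y
  proof -
    define x where "x = inv_into I f y"
    have x: "x \<in> I" "f x = y"
      using y by (auto simp: x_def inv_into_into f_inv_into_f)
    have "(inv_into I f has_derivative (\<lambda>v. v * inverse (f' x))) (at (f x))"
    proof (rule has_derivative_inverse_strong[OF \<open>open I\<close> x(1) contf])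
      show "inv_into I f (f z) = z" if "z \<in> I" for z using inj that by simp
      show "(f has_derivative (*) (f' x)) (at x)"
        using f'(2)[OF I(2)[OF x(1)]] by (simp add: has_field_derivative_def)
      show "(*) (f' x) \<circ> (\<lambda>v. v * inverse (f' x)) = id"
        using I(1)[OF x(1)] by (auto simp: fun_eq_iff)
    qed
    then show ?thesis unfolding x(2) x_def[symmetric] has_vector_derivative_def by simp
  qed
  have sm: "smooth_on (f ` I) (inv_into I f)"
  proof (rule smooth_on_bootstrap[OF op der])
    show "C_times_on n (\<lambda>y. inverse (f' (inv_into I f y))) (f ` I)"
      if "C_times_on n (inv_into I f) (f ` I)" for n
    proof (rule C_times_on_compose[OF op \<open>open I\<close> _ that])
      have "smooth_on I (\<lambda>x. inverse (f' x))"
        using I smooth_on_subset[OF f'(1), of I] by (intro smooth_on_inverse \<open>open I\<close>) fastforce+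
      then show "C_times_on n (\<lambda>x. inverse (f' x)) I" by (simp add: smooth_on_def)
    qed (auto intro: inv_into_into)
  qed
  have "I \<subseteq> S" using I(2) by blast
  from that[of d, folded I_def, OF d(1) this inj op sm] show ?thesis .
qed

lemma diffeo_openI:
  assumes "open W1" "open W2" "smooth_on W1 \<Phi>" "smooth_on W2 \<Psi>"
    and "\<And>x. x \<in> W1 \<Longrightarrow> \<Phi> x \<in> W2 \<and> \<Psi> (\<Phi> x) = x"
    and "\<And>y. y \<in> W2 \<Longrightarrow> \<Psi> y \<in> W1 \<and> \<Phi> (\<Psi> y) = y"
  shows "diffeo_open W1 W2 \<Phi>"
proof -
  have bij: "bij_betw \<Phi> W1 W2"
    by (rule bij_betw_byWitness[of _ \<Psi>]) (use assms(5,6) in auto)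
  have "inv_into W1 \<Phi> y = \<Psi> y" if "y \<in> W2" for y
    using bij assms(6)[OF that] by (intro inv_into_f_eq) (auto simp: bij_betw_def)
  then have "smooth_on W2 (inv_into W1 \<Phi>)"
    using smooth_on_cong[OF assms(2), of "inv_into W1 \<Phi>" \<Psi>] assms(4) by blast
  then show ?thesis using assms bij by (simp add: diffeo_open_def)
qed

section \<open>Maps of two variables\<close>

lemma has_derivative_partials:
  assumes "(F has_derivative F') (at x)"
  shows "partial_u F x = F' (1, 0)" "partial_v F x = F' (0, 1)"
  using frechet_derivative_at[OF assms] by (auto simp: partial_u_def partial_v_def)

lemma smooth_on_partial:
  assumes "smooth_on S F"
  shows "smooth_on S (partial_u F)" "smooth_on S (partial_v F)"
  using smooth_on_frechet_derivative[OF assms] by (auto simp: partial_u_def[abs_def] partial_v_def[abs_def])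

lemma frechet_derivative_partials:
  assumes "F differentiable (at x)"
  shows "frechet_derivative F (at x) v = fst v *\<^sub>R partial_u F x + snd v *\<^sub>R partial_v F x"
proof -
  interpret linear "frechet_derivative F (at x)" by (rule linear_frechet_derivative[OF assms])
  have "v = fst v *\<^sub>R (1, 0) + snd v *\<^sub>R (0, 1)" by (cases v) simp
  then have "frechet_derivative F (at x) v
      = frechet_derivative F (at x) (fst v *\<^sub>R (1, 0) + snd v *\<^sub>R (0, 1))" by simp
  also have "\<dots> = fst v *\<^sub>R partial_u F x + snd v *\<^sub>R partial_v F x"
    by (simp only: add scale partial_u_def partial_v_def)
  finally show ?thesis .
qed

lemma partial_has_vector_derivative:
  assumes "F differentiable (at (s, t))"
  shows "((\<lambda>s. F (s, t)) has_vector_derivative partial_u F (s, t)) (at s)"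
    "((\<lambda>t. F (s, t)) has_vector_derivative partial_v F (s, t)) (at t)"
proof -
  note d = assms[unfolded frechet_derivative_works]
  have "((\<lambda>s. F (s, t)) has_derivative (\<lambda>v. frechet_derivative F (at (s, t)) (v, 0))) (at s)"
    by (rule has_derivative_compose[where g = F and f = "\<lambda>s. (s, t)", OF _ d])
       (auto intro!: derivative_eq_intros)
  then show "((\<lambda>s. F (s, t)) has_vector_derivative partial_u F (s, t)) (at s)"
    by (simp add: has_vector_derivative_def frechet_derivative_partials[OF assms])
  have "((\<lambda>t. F (s, t)) has_derivative (\<lambda>v. frechet_derivative F (at (s, t)) (0, v))) (at t)"
    by (rule has_derivative_compose[where g = F and f = "Pair s", OF _ d])
       (auto intro!: derivative_eq_intros)
  then show "((\<lambda>t. F (s, t)) has_vector_derivative partial_v F (s, t)) (at t)"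
    by (simp add: has_vector_derivative_def frechet_derivative_partials[OF assms])
qed

lemma smooth_on_differentiable: "smooth_on S F \<Longrightarrow> x \<in> S \<Longrightarrow> F differentiable (at x)"
  using smooth_on_has_derivative differentiableI by blast

lemma partials_inner_const:
  assumes "F differentiable (at x)"
  shows "partial_u (\<lambda>x. F x \<bullet> w) x = partial_u F x \<bullet> w" "partial_v (\<lambda>x. F x \<bullet> w) x = partial_v F x \<bullet> w"
  using has_derivative_partials[OF has_derivative_inner_left[OF assms[unfolded frechet_derivative_works], of w]]
  by (auto simp: partial_u_def partial_v_def)

lemma mixed_difference_quotient:
  fixes f :: "real \<Rightarrow> real \<Rightarrow> real"
  assumes "h > 0"
    and f: "\<And>x y. a \<le> x \<Longrightarrow> x \<le> a + h \<Longrightarrow> b \<le> y \<Longrightarrow> y \<le> b + h \<Longrightarrow>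
      ((\<lambda>x. f x y) has_real_derivative g x y) (at x)"
    and g: "\<And>x y. a \<le> x \<Longrightarrow> x \<le> a + h \<Longrightarrow> b \<le> y \<Longrightarrow> y \<le> b + h \<Longrightarrow>
      ((\<lambda>y. g x y) has_real_derivative k x y) (at y)"
  obtains x y where "a < x" "x < a + h" "b < y" "y < b + h"
    "f (a + h) (b + h) - f (a + h) b - f a (b + h) + f a b = h * h * k x y"
proof -
  have "((\<lambda>x. f x (b + h) - f x b) has_real_derivative g x (b + h) - g x b) (at x)"
    if "a \<le> x" "x \<le> a + h" for x
    using that assms(1) by (intro DERIV_diff f) auto
  then obtain x where x: "a < x" "x < a + h"
    "(f (a + h) (b + h) - f (a + h) b) - (f a (b + h) - f a b) = h * (g x (b + h) - g x b)"
    using MVT2[of a "a + h" "\<lambda>x. f x (b + h) - f x b" "\<lambda>x. g x (b + h) - g x b"] assms(1) by auto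
  have "((\<lambda>y. g x y) has_real_derivative k x y) (at y)" if "b \<le> y" "y \<le> b + h" for y
    using that x by (intro g) auto
  then obtain y where "b < y" "y < b + h" "g x (b + h) - g x b = h * k x y"
    using MVT2[of b "b + h" "g x" "k x"] assms(1) by auto
  with x show ?thesis by (intro that[of x y]) (auto simp: algebra_simps)
qed

text \<open>Both mixed derivatives are limits of the same second difference quotient.\<close>

lemma mixed_partials_commute_real:
  fixes F :: "real \<times> real \<Rightarrow> real"
  assumes "open S" "smooth_on S F" "p \<in> S"
  shows "partial_u (partial_v F) p = partial_v (partial_u F) p"
proof (rule ccontr)
  assume ne: "partial_u (partial_v F) p \<noteq> partial_v (partial_u F) p"
  define e where "e = \<bar>partial_u (partial_v F) p - partial_v (partial_u F) p\<bar> / 2"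
  have e: "e > 0" using ne by (simp add: e_def)
  obtain a b where p: "p = (a, b)" by (cases p)
  note smu = smooth_on_partial(1)[OF assms(2)] and smv = smooth_on_partial(2)[OF assms(2)]
  have c: "isCont (partial_u (partial_v F)) p" "isCont (partial_v (partial_u F)) p"
    using smooth_on_partial[OF smu] smooth_on_partial[OF smv] assms(1,3)
      smooth_on_imp_continuous_on continuous_on_eq_continuous_at by blast+
  obtain d1 where d1: "d1 > 0" "\<And>x. dist x p < d1 \<Longrightarrow>
      dist (partial_u (partial_v F) x) (partial_u (partial_v F) p) < e"
    using c(1) e unfolding continuous_at_eps_delta by blast
  obtain d2 where d2: "d2 > 0" "\<And>x. dist x p < d2 \<Longrightarrow>
      dist (partial_v (partial_u F) x) (partial_v (partial_u F) p) < e"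
    using c(2) e unfolding continuous_at_eps_delta by blast
  obtain d3 where d3: "d3 > 0" "\<And>x. dist x p < d3 \<Longrightarrow> x \<in> S"
    using assms(1,3) open_dist by metis
  define h where "h = min d1 (min d2 d3) / 3"
  have h: "h > 0" using d1 d2 d3 by (simp add: h_def)
  have near: "dist (x, y) p < d1 \<and> dist (x, y) p < d2 \<and> (x, y) \<in> S"
    if "a \<le> x" "x \<le> a + h" "b \<le> y" "y \<le> b + h" for x y
  proof -
    have "dist (x, y) p \<le> \<bar>x - a\<bar> + \<bar>y - b\<bar>"
      using sqrt_sum_squares_le_sum_abs[of "x - a" "y - b"]
      by (simp add: p dist_Pair_Pair dist_real_def)
    also have "\<dots> < min d1 (min d2 d3)" using that h h_def by auto
    finally show ?thesis using d3(2) by auto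
  qed
  have uD: "((\<lambda>x. G (x, y)) has_real_derivative partial_u G (x, y)) (at x)"
    and vD: "((\<lambda>y. G (x, y)) has_real_derivative partial_v G (x, y)) (at y)"
    if "smooth_on S G" "a \<le> x" "x \<le> a + h" "b \<le> y" "y \<le> b + h" for x y and G :: "_ \<Rightarrow> real"
    using partial_has_vector_derivative[OF smooth_on_differentiable[OF that(1)], of x y] near that
    by (auto simp: has_real_derivative_iff_has_vector_derivative)
  obtain x y where xy: "a < x" "x < a + h" "b < y" "y < b + h"
    "F (a + h, b + h) - F (a + h, b) - F (a, b + h) + F (a, b) = h * h * partial_v (partial_u F) (x, y)"
    by (rule mixed_difference_quotient[of h a b "\<lambda>x y. F (x, y)" "\<lambda>x y. partial_u F (x, y)"
        "\<lambda>x y. partial_v (partial_u F) (x, y)"])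
       (use h uD[OF assms(2)] vD[OF smu] in auto)
  obtain y' x' where xy': "b < y'" "y' < b + h" "a < x'" "x' < a + h"
    "F (a + h, b + h) - F (a, b + h) - F (a + h, b) + F (a, b) = h * h * partial_u (partial_v F) (x', y')"
    by (rule mixed_difference_quotient[of h b a "\<lambda>y x. F (x, y)" "\<lambda>y x. partial_v F (x, y)"
        "\<lambda>y x. partial_u (partial_v F) (x, y)"])
       (use h vD[OF assms(2)] uD[OF smv] in auto)
  have "partial_v (partial_u F) (x, y) = partial_u (partial_v F) (x', y')"
  proof -
    have "h * h * partial_v (partial_u F) (x, y) = h * h * partial_u (partial_v F) (x', y')"
      using xy(5) xy'(5) by linarith
    then show ?thesis using h by simp
  qed
  moreover have "dist (partial_v (partial_u F) (x, y)) (partial_v (partial_u F) p) < e"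
    using near[of x y] xy by (intro d2(2)) auto
  moreover have "dist (partial_u (partial_v F) (x', y')) (partial_u (partial_v F) p) < e"
    using near[of x' y'] xy' by (intro d1(2)) auto
  moreover have "dist (partial_u (partial_v F) p) (partial_v (partial_u F) p)
      \<le> dist (partial_u (partial_v F) (x', y')) (partial_u (partial_v F) p)
        + dist (partial_u (partial_v F) (x', y')) (partial_v (partial_u F) p)"
    by (rule dist_triangle3)
  moreover have "dist (partial_u (partial_v F) p) (partial_v (partial_u F) p) = 2 * e"
    by (simp add: e_def dist_real_def)
  ultimately show False by simp
qed

lemma mixed_partials_commute:
  fixes F :: "real \<times> real \<Rightarrow> 'b::euclidean_space"
  assumes "open S" "smooth_on S F" "p \<in> S"
  shows "partial_u (partial_v F) p = partial_v (partial_u F) p"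
proof (rule euclidean_eqI)
  fix w :: 'b
  have sm: "smooth_on S (\<lambda>x. F x \<bullet> w)"
    by (intro smooth_on_inner smooth_on_const assms)
  have uv: "partial_u (partial_v (\<lambda>x. F x \<bullet> w)) p = partial_u (\<lambda>x. partial_v F x \<bullet> w) p"
    "partial_v (partial_u (\<lambda>x. F x \<bullet> w)) p = partial_v (\<lambda>x. partial_u F x \<bullet> w) p"
  proof -
    have tr: "partial_u G p = partial_u H p \<and> partial_v G p = partial_v H p"
      if "\<And>x. x \<in> S \<Longrightarrow> G x = H x" "smooth_on S H" for G H :: "real \<times> real \<Rightarrow> real"
    proof -
      have "(G has_derivative frechet_derivative H (at p)) (at p)"
        using smooth_on_has_derivative[OF that(2) assms(3)]
        by (rule has_derivative_transform_within_open[OF _ assms(1,3)]) (simp add: that(1))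
      from has_derivative_partials[OF this] show ?thesis by (simp add: partial_u_def partial_v_def)
    qed
    have "smooth_on S (\<lambda>x. partial_v F x \<bullet> w)" "smooth_on S (\<lambda>x. partial_u F x \<bullet> w)"
      by (intro smooth_on_inner smooth_on_const smooth_on_partial assms)+
    note sm = this and pd = partials_inner_const[OF smooth_on_differentiable[OF assms(2)]]
    show "partial_u (partial_v (\<lambda>x. F x \<bullet> w)) p = partial_u (\<lambda>x. partial_v F x \<bullet> w) p"
      by (rule tr[THEN conjunct1, OF pd(2) sm(1)])
    show "partial_v (partial_u (\<lambda>x. F x \<bullet> w)) p = partial_v (\<lambda>x. partial_u F x \<bullet> w) p"
      by (rule tr[THEN conjunct2, OF pd(1) sm(2)])
  qed
  have "partial_u (partial_v F) p \<bullet> w = partial_u (partial_v (\<lambda>x. F x \<bullet> w)) p"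
    using uv partials_inner_const[OF smooth_on_differentiable[OF smooth_on_partial(2)[OF assms(2)] assms(3)]]
    by simp
  also have "\<dots> = partial_v (partial_u (\<lambda>x. F x \<bullet> w)) p"
    by (rule mixed_partials_commute_real[OF assms(1) sm assms(3)])
  also have "\<dots> = partial_v (partial_u F) p \<bullet> w"
    using uv partials_inner_const[OF smooth_on_differentiable[OF smooth_on_partial(1)[OF assms(2)] assms(3)]]
    by simp
  finally show "partial_u (partial_v F) p \<bullet> w = partial_v (partial_u F) p \<bullet> w" .
qed

section \<open>Open subsets of the plane as surfaces\<close>

lemma inv_into_id: "x \<in> S \<Longrightarrow> inv_into S id x = x"
  using inv_into_f_f[of id S x] by simp

text \<open>Stated without differentiability, because \<open>f \<circ> inv_into S id\<close> and \<open>f\<close> have to be exchanged inside the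
  definitions of singular points and of curvature before anything is known about \<open>f\<close>.\<close>

lemma frechet_derivative_cong_open:
  assumes "open S" "x \<in> S" "\<And>y. y \<in> S \<Longrightarrow> f y = g y"
  shows "frechet_derivative f (at x) = frechet_derivative g (at x)"
proof -
  have "(f has_derivative D) (at x) \<longleftrightarrow> (g has_derivative D) (at x)" for D
    using has_derivative_transform_within_open[OF _ assms(1,2)] assms(3) by metis
  then show ?thesis unfolding frechet_derivative_def by simp
qed

lemma frechet_derivative_plane_chart:
  "open S \<Longrightarrow> x \<in> S \<Longrightarrow> frechet_derivative (f \<circ> inv_into S id) (at x) = frechet_derivative f (at x)"
  by (rule frechet_derivative_cong_open[of S]) (auto simp: inv_into_id)

lemma smooth_on_plane_chart:
  "open D \<Longrightarrow> D \<subseteq> S \<Longrightarrow> smooth_on D (f \<circ> inv_into S id) \<longleftrightarrow> smooth_on D f"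
  by (rule smooth_on_cong) (auto simp: inv_into_id)

lemma smooth_vector_map_plane:
  assumes "open S" "open D" "D \<subseteq> S" "smooth_on D f"
  shows "smooth_vector_map (plane_atlas S) D f"
  using assms smooth_on_plane_chart[of D S f] by (simp add: smooth_vector_map_def plane_atlas_def Int_absorb2)

lemma jacobian_det_id_plane:
  assumes "open S" "x \<in> S"
  shows "jacobian_det (id \<circ> inv_into S id) x = 1"
  using assms frechet_derivative_plane_chart[OF assms, of id]
  by (simp add: jacobian_det_def partial_u_def partial_v_def)

lemma oriented_surface_manifold_plane:
  assumes "open S"
  shows "oriented_surface_manifold (top_of_set S) (plane_atlas S)"
proof -
  have "Hausdorff_space (top_of_set S)"
    by (simp add: Hausdorff_space_subtopology)
  moreover have "second_countable (top_of_set S)"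
  proof (rule second_countable_subtopology)
    obtain B :: "(real \<times> real) set set" where B: "countable B" "topological_basis B"
      using ex_countable_basis by blast
    show "second_countable (euclidean :: (real \<times> real) topology)"
      unfolding second_countable_def open_openin[symmetric]
    proof (intro exI[of _ B] conjI ballI allI impI)
      show "\<exists>T\<in>B. x \<in> T \<and> T \<subseteq> O'" if "open O' \<and> x \<in> O'" for O' x
        using topological_basisE[OF B(2)] that by metis
    qed (use B topological_basis_open in auto)
  qed
  moreover have "homeomorphic_map (subtopology (top_of_set S) S) (top_of_set S) id"
    by (simp add: subtopology_subtopology homeomorphic_map_id)
  moreover have "smooth_on S (id \<circ> inv_into S id)"
    using smooth_on_plane_chart[OF assms, of S id] smooth_on_id[OF assms] by (simp add: id_def)
  ultimately show ?thesis
    using assms jacobian_det_id_plane[OF assms]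
    by (simp add: oriented_surface_manifold_def plane_atlas_def)
qed

lemma smooth_manifold_map_plane:
  assumes "open S" "open T" "open D" "D \<subseteq> S" "\<phi> ` D \<subseteq> T" "smooth_on D \<phi>"
  shows "smooth_manifold_map (top_of_set S) (plane_atlas S) (top_of_set T) (plane_atlas T) D \<phi>"
proof -
  have "continuous_map (subtopology (top_of_set S) D) (top_of_set T) \<phi>"
    using assms smooth_on_imp_continuous_on[OF assms(6)]
    by (auto simp: subtopology_subtopology Int_absorb1)
  moreover have "{q \<in> D. q \<in> S \<and> \<phi> q \<in> T} = D" using assms by auto
  moreover have "smooth_on D (id \<circ> \<phi> \<circ> inv_into S id)"
    using smooth_on_plane_chart[OF assms(3,4), of "id \<circ> \<phi>"] assms(6) by simp
  ultimately show ?thesis by (simp add: smooth_manifold_map_def plane_atlas_def)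
qed

lemma diffeo_manifold_planeI:
  assumes "open S" "open T" "open D1" "open D2" "D1 \<subseteq> S" "D2 \<subseteq> T"
    and "smooth_on D1 \<phi>" "smooth_on D2 \<psi>"
    and "\<And>x. x \<in> D1 \<Longrightarrow> \<phi> x \<in> D2 \<and> \<psi> (\<phi> x) = x"
    and "\<And>y. y \<in> D2 \<Longrightarrow> \<psi> y \<in> D1 \<and> \<phi> (\<psi> y) = y"
  shows "diffeo_manifold (top_of_set S) (plane_atlas S) D1 (top_of_set T) (plane_atlas T) D2 \<phi>"
proof -
  have d: "diffeo_open D1 D2 \<phi>" by (rule diffeo_openI[of _ _ _ \<psi>]) (use assms in auto)
  then have b: "bij_betw \<phi> D1 D2" and i: "smooth_on D2 (inv_into D1 \<phi>)"
    by (auto simp: diffeo_open_def)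
  have "\<phi> ` D1 \<subseteq> T" "inv_into D1 \<phi> ` D2 \<subseteq> S"
    using b assms bij_betw_inv_into[OF b] by (auto simp: bij_betw_def)
  then show ?thesis
    using assms b i smooth_manifold_map_plane[of S T D1 \<phi>] smooth_manifold_map_plane[of T S D2 "inv_into D1 \<phi>"]
    by (auto simp: diffeo_manifold_def intro: open_subset)
qed

lemma singular_points_plane:
  "open S \<Longrightarrow> singular_points (top_of_set S) (plane_atlas S) f = {p \<in> S. \<not> inj (frechet_derivative f (at p))}"
  by (auto simp: singular_points_def plane_atlas_def frechet_derivative_plane_chart)

lemma oriented_coordinates_plane:
  assumes "open S"
  shows "oriented_coordinates (top_of_set S) (plane_atlas S) S id"
proof -
  have "coordinates (top_of_set S) (plane_atlas S) S id"
    unfolding coordinates_def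
    by (rule diffeo_manifold_planeI[of _ _ _ _ _ id]) (use assms smooth_on_id[OF assms] in \<open>auto simp: id_def\<close>)
  then show ?thesis
    using jacobian_det_id_plane[OF assms] by (simp add: oriented_coordinates_def plane_atlas_def)
qed

section \<open>Screw motions\<close>

text \<open>Rotation about the third axis by \<open>\<tau>\<close> combined with the translation by \<open>h \<tau>\<close> along it.\<close>

definition screw :: "real \<Rightarrow> real \<Rightarrow> real^3 \<Rightarrow> real^3" where
  "screw h \<tau> y = vector [y $ 1 * cos \<tau> - y $ 2 * sin \<tau>, y $ 1 * sin \<tau> + y $ 2 * cos \<tau>, y $ 3 + h * \<tau>]"

lemma norm3_sq: "(norm (y :: real^3))\<^sup>2 = (y $ 1)\<^sup>2 + (y $ 2)\<^sup>2 + (y $ 3)\<^sup>2"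
  unfolding power2_norm_eq_inner inner_vec_def sum_3 by (simp add: power2_eq_square)

lemma helicoidal_motion_screw: "helicoidal_motion (screw h)"
proof -
  have "dist (screw h \<tau> y) (screw h \<tau> w) = dist y w" for \<tau> y w
  proof -
    have rot: "(a * c - b * s)\<^sup>2 + (a * s + b * c)\<^sup>2 = a\<^sup>2 + b\<^sup>2" if "s\<^sup>2 + c\<^sup>2 = 1" for a b c s :: real
      using that by algebra
    have "(norm (screw h \<tau> y - screw h \<tau> w))\<^sup>2 = (norm (y - w))\<^sup>2"
      using rot[of "sin \<tau>" "cos \<tau>" "y $ 1 - w $ 1" "y $ 2 - w $ 2"]
      by (simp add: norm3_sq screw_def algebra_simps)
    then show ?thesis by (simp add: dist_norm)
  qed
  moreover have "screw h 0 = id"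
    by (simp add: fun_eq_iff screw_def vec_eq_iff forall_3)
  moreover have "screw h (\<sigma> + \<tau>) = screw h \<sigma> \<circ> screw h \<tau>" for \<sigma> \<tau>
    by (simp add: fun_eq_iff screw_def vec_eq_iff forall_3 sin_add cos_add algebra_simps)
  moreover have "smooth_on UNIV (\<lambda>\<tau>. screw h \<tau> y)" for y
    unfolding screw_def by (intro smooth_on_intros open_UNIV)
  moreover have "screw h pi \<noteq> id"
  proof
    assume "screw h pi = id"
    then have "screw h pi (axis 1 1) $ 1 = axis 1 1 $ 1" by simp
    then show False by (simp add: screw_def)
  qed
  ultimately show ?thesis unfolding helicoidal_motion_def by blast
qed

lemma has_derivative_fst_compose:
  fixes g :: "real \<Rightarrow> real"
  assumes "(g has_real_derivative D) (at (fst p))"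
  shows "((\<lambda>p. g (fst p)) has_derivative (\<lambda>v. D * fst v)) (at p)"
  using has_derivative_compose[OF has_derivative_fst[OF has_derivative_ident] assms[unfolded has_field_derivative_def]]
  by simp

section \<open>Geometry of the helicoidal family\<close>

locale helicoidal_family =
  fixes k :: nat and J :: "real set" and U V :: "real \<Rightarrow> real" and m h e0 e1 e2 :: real
  assumes k: "k > 0" and J: "open J" "is_interval J" "0 \<in> J"
    and U: "smooth_on J U" "\<And>s. s \<in> J \<Longrightarrow> U s > 0"
    and V: "smooth_on J V" "\<And>s. s \<in> J \<Longrightarrow> (U has_real_derivative s ^ k * V s) (at s)"
    and m: "m > 0" and star: "star_condition J U V h m" and defined: "bour_defined J U h m"
    and e0: "e0 \<in> {1, -1}" and e1: "e1 \<in> {1, -1}" and e2: "e2 \<in> {1, -1}"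
begin

text \<open>The derivatives of the radius \<open>x\<close>, of the angle \<open>\<theta>\<close> in the direction of \<open>s\<close>, and of \<open>z\<close> are
  \<open>s\<^sup>k\<close> times \<open>a\<close>, \<open>b\<close> and \<open>c\<close>. Hence the derivatives of the surface \<open>F\<close> are \<open>s\<^sup>k P\<close> and \<open>Q\<close>, where \<open>P\<close>
  stays a unit vector at \<open>s = 0\<close>: it is the direction of the profile across the edge.\<close>

definition "R s = m\<^sup>2 * (U s)\<^sup>2 - h\<^sup>2"
definition "\<rho> = bour_rho m h U V"
definition "x = bour_x m h U e0"
definition "z = bour_z k m h U V e2"
definition "\<theta> p = bour_theta k m h U V e1 e2 (fst p) (snd p)"
definition "a s = m\<^sup>2 * U s * V s / x s"
definition "b s = - e2 * h * \<rho> s / (m * U s * R s)"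
definition "c s = e2 * m * U s * \<rho> s / R s"
definition "F = bour_map k m h U V e0 e1 e2"
definition "P p = (vector [a (fst p) * cos (\<theta> p) - x (fst p) * b (fst p) * sin (\<theta> p),
  a (fst p) * sin (\<theta> p) + x (fst p) * b (fst p) * cos (\<theta> p), c (fst p) + h * b (fst p)] :: real^3)"
definition "Q p = (vector [- x (fst p) * sin (\<theta> p) * e1 / m, x (fst p) * cos (\<theta> p) * e1 / m, h * e1 / m] :: real^3)"

abbreviation "S \<equiv> J \<times> (UNIV :: real set)"

lemma signs: "e0 * e0 = 1" "e1 * e1 = 1" "e2 * e2 = 1" "e0 \<noteq> 0" "e1 \<noteq> 0" "e2 \<noteq> 0"
  using e0 e1 e2 by auto

lemma open_S: "open S"
  by (intro open_Times J open_UNIV)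

lemma \<rho>_sq: "s \<in> J \<Longrightarrow> (\<rho> s)\<^sup>2 = R s - m ^ 4 * (U s)\<^sup>2 * (V s)\<^sup>2"
  using star by (auto simp: star_condition_def \<rho>_def bour_rho_def R_def)

lemma R_pos: "s \<in> J \<Longrightarrow> R s > 0"
proof -
  assume s: "s \<in> J"
  have "0 \<le> m ^ 4 * (U s)\<^sup>2 * (V s)\<^sup>2" by simp
  then have "R s \<ge> 0" using \<rho>_sq[OF s] zero_le_power2[of "\<rho> s"] by linarith
  moreover have "R s \<noteq> 0" using defined s by (auto simp: bour_defined_def R_def)
  ultimately show ?thesis by simp
qed

lemma x_sq: "s \<in> J \<Longrightarrow> (x s)\<^sup>2 = R s"
  using R_pos[of s] signs(1) by (simp add: x_def bour_x_def R_def power_mult_distrib power2_eq_square[of e0])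

lemma x_nz: "s \<in> J \<Longrightarrow> x s \<noteq> 0"
  using x_sq[of s] R_pos[of s] by auto

lemma U_nz: "s \<in> J \<Longrightarrow> U s \<noteq> 0"
  using U(2)[of s] by simp

lemma smooth_on_\<rho>: "smooth_on J \<rho>"
  using star by (auto simp: star_condition_def \<rho>_def)

lemma smooth_on_R: "smooth_on J R"
  unfolding R_def[abs_def] by (intro smooth_on_intros J U)

lemma smooth_on_x: "smooth_on J x"
proof -
  have "smooth_on J (\<lambda>s. e0 * sqrt (R s))"
    using R_pos by (intro smooth_on_mult smooth_on_const smooth_on_sqrt J smooth_on_R)
  then show ?thesis by (simp add: x_def bour_x_def[abs_def] R_def)
qed

lemma R_nz: "s \<in> J \<Longrightarrow> R s \<noteq> 0"
  using R_pos[of s] by simp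

lemma smooth_on_abc: "smooth_on J a" "smooth_on J b" "smooth_on J c"
proof -
  show "smooth_on J a" unfolding a_def[abs_def]
    by (intro smooth_on_divide smooth_on_mult smooth_on_const smooth_on_x J(1) U(1) V(1)) (rule x_nz)
  show "smooth_on J b" unfolding b_def[abs_def]
    by (intro smooth_on_divide smooth_on_mult smooth_on_const smooth_on_R smooth_on_\<rho> J(1) U(1))
       (use R_nz U_nz m in auto)
  show "smooth_on J c" unfolding c_def[abs_def]
    by (intro smooth_on_divide smooth_on_mult smooth_on_const smooth_on_R smooth_on_\<rho> J(1) U(1)) (rule R_nz)
qed

lemma x_deriv:
  assumes s: "s \<in> J"
  shows "(x has_real_derivative s ^ k * a s) (at s)"
proof -
  have "(R has_real_derivative m\<^sup>2 * (2 * U s * (s ^ k * V s))) (at s)"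
    unfolding R_def[abs_def] using V(2)[OF s]
    by (auto intro!: derivative_eq_intros)
  from DERIV_cmult[OF DERIV_chain2[OF DERIV_real_sqrt[OF R_pos[OF s]] this], of e0]
  have "((\<lambda>s. e0 * sqrt (R s)) has_real_derivative
      e0 * (inverse (sqrt (R s)) / 2 * (m\<^sup>2 * (2 * U s * (s ^ k * V s))))) (at s)" .
  moreover have "e0 * (inverse (sqrt (R s)) / 2 * (m\<^sup>2 * (2 * U s * (s ^ k * V s)))) = s ^ k * a s"
  proof -
    define q where "q = sqrt (R s)"
    have "q \<noteq> 0" using R_pos[OF s] by (simp add: q_def)
    moreover have "x s = e0 * q" by (simp add: q_def x_def bour_x_def R_def)
    ultimately show ?thesis
      using e0 unfolding a_def q_def[symmetric] by (auto simp: divide_simps)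
  qed
  moreover have "x = (\<lambda>s. e0 * sqrt (R s))"
    by (simp add: fun_eq_iff x_def bour_x_def R_def)
  ultimately show ?thesis by (simp only:)
qed

lemma z_deriv: "s \<in> J \<Longrightarrow> (z has_real_derivative s ^ k * c s) (at s)"
proof -
  assume s: "s \<in> J"
  let ?f = "\<lambda>s. s ^ k * U s * \<rho> s / R s"
  have "continuous_on J ?f"
    using R_nz by (intro smooth_on_imp_continuous_on[of J] smooth_on_divide smooth_on_mult smooth_on_power
        smooth_on_id smooth_on_R smooth_on_\<rho> J(1) U(1)) auto
  from DERIV_cmult[OF LBINT_has_real_derivative[OF J s this], of "e2 * m"]
  show ?thesis by (simp add: z_def bour_z_def[abs_def] c_def \<rho>_def R_def mult_ac)
qed

text \<open>The twist of the profile is \<open>- e2 h / m\<close> times this integral.\<close>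

definition "turn s = (LBINT \<zeta>=ereal 0..ereal s. \<zeta> ^ k * \<rho> \<zeta> / (U \<zeta> * R \<zeta>))"

lemma \<theta>_eq: "\<theta> p = 1 / m * (e1 * snd p - e2 * h * turn (fst p))"
  by (simp add: \<theta>_def bour_theta_def turn_def \<rho>_def R_def)

lemma turn_deriv: "s \<in> J \<Longrightarrow> (turn has_real_derivative s ^ k * \<rho> s / (U s * R s)) (at s)"
proof -
  assume s: "s \<in> J"
  have "continuous_on J (\<lambda>s. s ^ k * \<rho> s / (U s * R s))"
    using R_nz U_nz by (intro smooth_on_imp_continuous_on[of J] smooth_on_divide smooth_on_mult smooth_on_power
        smooth_on_id smooth_on_R smooth_on_\<rho> J(1) U(1)) auto
  from LBINT_has_real_derivative[OF J s this] show ?thesis by (simp add: turn_def[abs_def])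
qed

lemma smooth_on_turn: "smooth_on J turn"
proof (rule smooth_on_antiderivative[OF J(1)])
  show "(turn has_vector_derivative s ^ k * \<rho> s / (U s * R s)) (at s)" if "s \<in> J" for s
    using turn_deriv[OF that] by (simp add: has_real_derivative_iff_has_vector_derivative)
  show "smooth_on J (\<lambda>s. s ^ k * \<rho> s / (U s * R s))"
    using R_nz U_nz by (intro smooth_on_divide smooth_on_mult smooth_on_power
        smooth_on_id smooth_on_R smooth_on_\<rho> J(1) U(1)) auto
qed

lemma smooth_on_z: "smooth_on J z"
proof (rule smooth_on_antiderivative[OF J(1)])
  show "(z has_vector_derivative s ^ k * c s) (at s)" if "s \<in> J" for s
    using z_deriv[OF that] by (simp add: has_real_derivative_iff_has_vector_derivative)
  show "smooth_on J (\<lambda>s. s ^ k * c s)"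
    by (intro smooth_on_mult smooth_on_power smooth_on_id smooth_on_abc J(1))
qed

lemma smooth_on_first: "smooth_on J g \<Longrightarrow> smooth_on S (\<lambda>p. g (fst p))"
  using smooth_on_compose[OF open_S J(1) _ smooth_on_fst[OF open_S smooth_on_id[OF open_S]], of g] by auto

lemma smooth_on_\<theta>: "smooth_on S \<theta>"
  unfolding \<theta>_eq[abs_def]
  by (intro smooth_on_mult smooth_on_diff smooth_on_const smooth_on_snd smooth_on_id
      smooth_on_first smooth_on_turn open_S)

lemma \<theta>_deriv:
  assumes "p \<in> S"
  shows "(\<theta> has_derivative (\<lambda>v. fst p ^ k * b (fst p) * fst v + e1 / m * snd v)) (at p)"
proof -
  have s: "fst p \<in> J" using assms by auto
  show ?thesis
    unfolding \<theta>_eq[abs_def]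
    by (rule derivative_eq_intros has_derivative_fst_compose turn_deriv[OF s] refl)+
       (use m in \<open>auto simp: fun_eq_iff b_def field_simps\<close>)
qed

lemma F_eq: "F p = vector [x (fst p) * cos (\<theta> p), x (fst p) * sin (\<theta> p), z (fst p) + h * \<theta> p]"
  by (simp add: F_def bour_map_def x_def z_def \<theta>_def split_beta)

lemma smooth_on_F: "smooth_on S F"
  unfolding F_eq[abs_def]
  by (intro smooth_on_vector3 smooth_on_mult smooth_on_add smooth_on_cos smooth_on_sin smooth_on_const
      smooth_on_\<theta> smooth_on_first smooth_on_x smooth_on_z open_S)

lemma smooth_on_P: "smooth_on S P"
  unfolding P_def[abs_def]
  by (intro smooth_on_vector3 smooth_on_mult smooth_on_add smooth_on_diff smooth_on_cos smooth_on_sin smooth_on_const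
      smooth_on_\<theta> smooth_on_first smooth_on_x smooth_on_abc open_S)

lemma smooth_on_Q: "smooth_on S Q"
  unfolding Q_def[abs_def] using m
  by (intro smooth_on_vector3 smooth_on_mult smooth_on_divide smooth_on_minus smooth_on_cos smooth_on_sin smooth_on_const
      smooth_on_\<theta> smooth_on_first smooth_on_x open_S) auto

lemma F_deriv:
  assumes "p \<in> S"
  shows "(F has_derivative (\<lambda>v. (fst v * fst p ^ k) *\<^sub>R P p + snd v *\<^sub>R Q p)) (at p)"
proof -
  have s: "fst p \<in> J" using assms by auto
  note d = has_derivative_fst_compose[OF x_deriv[OF s]] has_derivative_fst_compose[OF z_deriv[OF s]]
    \<theta>_deriv[OF assms]
  let ?T = "\<lambda>v. fst p ^ k * b (fst p) * fst v + e1 / m * snd v"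
  have "((\<lambda>p. (x (fst p) * cos (\<theta> p)) *\<^sub>R axis 1 1 + (x (fst p) * sin (\<theta> p)) *\<^sub>R axis 2 1
      + (z (fst p) + h * \<theta> p) *\<^sub>R axis 3 1 :: real^3) has_derivative
    (\<lambda>v. (x (fst p) * (?T v * - sin (\<theta> p)) + fst p ^ k * a (fst p) * fst v * cos (\<theta> p)) *\<^sub>R axis 1 1
      + (x (fst p) * (?T v * cos (\<theta> p)) + fst p ^ k * a (fst p) * fst v * sin (\<theta> p)) *\<^sub>R axis 2 1
      + (fst p ^ k * c (fst p) * fst v + h * ?T v) *\<^sub>R axis 3 1)) (at p)"
    by (intro has_derivative_add has_derivative_scaleR_left has_derivative_mult has_derivative_mult_right
        has_derivative_sin has_derivative_cos d)
  moreover have "(x (fst p) * (?T v * - sin (\<theta> p)) + fst p ^ k * a (fst p) * fst v * cos (\<theta> p)) *\<^sub>R axis 1 1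
      + (x (fst p) * (?T v * cos (\<theta> p)) + fst p ^ k * a (fst p) * fst v * sin (\<theta> p)) *\<^sub>R axis 2 1
      + (fst p ^ k * c (fst p) * fst v + h * ?T v) *\<^sub>R axis 3 1
      = (fst v * fst p ^ k) *\<^sub>R P p + snd v *\<^sub>R Q p" for v
    unfolding vector3_eq[symmetric] vec_eq_iff forall_3 P_def Q_def by (simp add: algebra_simps)
  ultimately show ?thesis
    unfolding F_eq[abs_def] vector3_eq by (simp only:)
qed

text \<open>These identities are the reason for the integrands of \<open>z\<close> and \<open>\<theta>\<close>. Orthogonality reads
  \<open>m\<^sup>2 U\<^sup>2 b + h c = 0\<close>, and given that relation the unit length of \<open>P\<close> is equivalent to
  \<open>a\<^sup>2 + c\<^sup>2 (m\<^sup>2 U\<^sup>2 - h\<^sup>2) / (m\<^sup>2 U\<^sup>2) = 1\<close>, which is the definition of \<open>\<rho>\<close>.\<close>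

lemma PQ_inner:
  assumes "p \<in> S"
  shows "P p \<bullet> P p = 1" "P p \<bullet> Q p = 0" "Q p \<bullet> Q p = (U (fst p))\<^sup>2"
proof -
  obtain s t where p: "p = (s, t)" "s \<in> J" using assms by (cases p) auto
  note pos = R_pos[OF p(2)] x_nz[OF p(2)] U_nz[OF p(2)] m
  have sc: "(sin (\<theta> (s, t)))\<^sup>2 + (cos (\<theta> (s, t)))\<^sup>2 = 1" by simp
  have "P p \<bullet> P p = (a s)\<^sup>2 + (x s)\<^sup>2 * (b s)\<^sup>2 + (c s + h * b s)\<^sup>2"
    by (simp add: P_def inner_vec_def sum_3 p(1)) (use sc in algebra)
  also have "\<dots> = 1"
  proof -
    have R: "R s + h\<^sup>2 = m\<^sup>2 * (U s)\<^sup>2" by (simp add: R_def)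
    have A: "(a s)\<^sup>2 * R s = m ^ 4 * (U s)\<^sup>2 * (V s)\<^sup>2"
      using pos x_sq[OF p(2)] by (simp add: a_def power_divide power_mult_distrib)
    have B: "b s * (m * U s * R s) = - e2 * h * \<rho> s" using pos by (simp add: b_def)
    have C: "c s * R s = e2 * m * U s * \<rho> s" using pos by (simp add: c_def)
    have D: "(\<rho> s)\<^sup>2 = R s - m ^ 4 * (U s)\<^sup>2 * (V s)\<^sup>2" by (rule \<rho>_sq[OF p(2)])
    have "(b s)\<^sup>2 * (m * U s * R s)\<^sup>2 = (h * \<rho> s)\<^sup>2"
      using B signs(3) by algebra
    moreover have "(c s * R s)\<^sup>2 = (m * U s * \<rho> s)\<^sup>2" using C signs(3) by algebra
    moreover have "(m * U s) * ((c s * R s) * (b s * R s) * h) = (m * U s) * - (h * \<rho> s)\<^sup>2"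
      using B C signs(3) by algebra
    then have "(c s * R s) * (b s * R s) * h = - (h * \<rho> s)\<^sup>2"
      by (rule mult_left_cancel[THEN iffD1, rotated]) (use pos in simp)
    ultimately have "R s * R s * ((R s + h\<^sup>2) * (b s)\<^sup>2 + 2 * h * (b s * c s) + (c s)\<^sup>2) = (\<rho> s)\<^sup>2 * R s"
      unfolding R unfolding R_def by algebra
    then have "R s * ((R s + h\<^sup>2) * (b s)\<^sup>2 + 2 * h * (b s * c s) + (c s)\<^sup>2) = (\<rho> s)\<^sup>2"
      using pos(1) by simp
    then have "R s * ((a s)\<^sup>2 + R s * (b s)\<^sup>2 + (c s + h * b s)\<^sup>2) = R s * 1"
      using A D by algebra
    then show ?thesis using pos(1) x_sq[OF p(2)] by simp
  qed
  finally show "P p \<bullet> P p = 1" .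
  have "P p \<bullet> Q p = e1 / m * ((x s)\<^sup>2 * b s + h * (c s + h * b s))"
    using pos(4) by (simp add: P_def Q_def inner_vec_def sum_3 p(1) field_simps) (use sc in algebra)
  also have "(x s)\<^sup>2 * b s + h * (c s + h * b s) = 0"
  proof -
    have R: "R s + h\<^sup>2 = m\<^sup>2 * (U s)\<^sup>2" by (simp add: R_def)
    have "(x s)\<^sup>2 * b s + h * (c s + h * b s) = (R s + h\<^sup>2) * b s + h * c s"
      unfolding x_sq[OF p(2)] by algebra
    also have "\<dots> = 0" unfolding R using pos
      by (simp add: b_def c_def field_simps power2_eq_square)
    finally show ?thesis .
  qed
  finally show "P p \<bullet> Q p = 0" by simp
  have "Q p \<bullet> Q p = (e1 / m)\<^sup>2 * ((x s)\<^sup>2 + h\<^sup>2)"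
    using pos(4) by (simp add: Q_def inner_vec_def sum_3 p(1) field_simps) (use sc in algebra)
  also have "\<dots> = (U s)\<^sup>2"
    using pos signs(2) unfolding x_sq[OF p(2)] R_def by (simp add: power2_eq_square field_simps)
  finally show "Q p \<bullet> Q p = (U (fst p))\<^sup>2" by (simp add: p(1))
qed

lemma first_fundamental_form_F:
  assumes "p \<in> S"
  shows "first_fundamental_form F p v w = edge_metric k U p v w"
proof -
  have QP: "Q p \<bullet> P p = 0" using PQ_inner(2)[OF assms] by (simp only: inner_commute)
  have "((fst v * fst p ^ k) *\<^sub>R P p + snd v *\<^sub>R Q p) \<bullet> ((fst w * fst p ^ k) *\<^sub>R P p + snd w *\<^sub>R Q p)
      = (fst v * fst p ^ k) * (fst w * fst p ^ k) + snd v * (snd w * (U (fst p))\<^sup>2)"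
    by (simp only: inner_add_left inner_add_right inner_scaleR_left inner_scaleR_right PQ_inner[OF assms] QP
        mult_zero_right mult_1_right add_0_left add_0_right) (simp add: mult_ac)
  also have "\<dots> = edge_metric k U p v w"
    unfolding edge_metric_def mult_2 power_add by simp
  finally show ?thesis
    unfolding first_fundamental_form_def frechet_derivative_at[OF F_deriv[OF assms], symmetric] .
qed

text \<open>The metric has determinant \<open>s\<^bsup>2k\<^esup> U\<^sup>2\<close>.\<close>

lemma singular_points_F: "singular_points (top_of_set S) (plane_atlas S) F = {0} \<times> UNIV"
proof -
  have "\<not> inj (frechet_derivative F (at p)) \<longleftrightarrow> fst p = 0" if p: "p \<in> S" for p
  proof
    assume "fst p = 0"
    then have "frechet_derivative F (at p) (1, 0) = frechet_derivative F (at p) (0, 0)"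
      using k by (simp add: frechet_derivative_at[OF F_deriv[OF p], symmetric])
    then show "\<not> inj (frechet_derivative F (at p))" by (metis injD prod.inject zero_neq_one)
  next
    assume *: "\<not> inj (frechet_derivative F (at p))"
    have lin: "linear (frechet_derivative F (at p))"
      using linear_frechet_derivative F_deriv[OF p] differentiableI by blast
    obtain v where v: "frechet_derivative F (at p) v = 0" "v \<noteq> 0"
      using * linear_injective_0[OF lin] by blast
    have "first_fundamental_form F p v v = 0" by (simp add: first_fundamental_form_def v)
    moreover have "fst p ^ (2 * k) = (fst p ^ k)\<^sup>2" by (metis mult.commute power_mult)
    ultimately have "(fst p ^ k * fst v)\<^sup>2 + (U (fst p) * snd v)\<^sup>2 = 0"
      unfolding first_fundamental_form_F[OF p] edge_metric_def
      by (simp add: power_mult_distrib) (simp add: power2_eq_square)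
    then have "fst p ^ k * fst v = 0" "U (fst p) * snd v = 0"
      by (simp_all add: sum_power2_eq_zero_iff)
    then show "fst p = 0" using v(2) U_nz[of "fst p"] p by (auto simp: prod_eq_iff)
  qed
  then have "{p \<in> S. \<not> inj (frechet_derivative F (at p))} = {p \<in> S. fst p = 0}" by blast
  also have "\<dots> = {0} \<times> UNIV" using J(3) by auto
  finally show ?thesis unfolding singular_points_plane[OF open_S] .
qed

text \<open>Since \<open>P\<close> and \<open>Q\<close> remain orthogonal of lengths \<open>1\<close> and \<open>U\<close> on the singular set, this is a smooth unit
  normal across it.\<close>

definition "\<nu> p = (1 / U (fst p)) *\<^sub>R cross3 (P p) (Q p)"

lemma unit_normal_field_F: "unit_normal_field (top_of_set S) (plane_atlas S) F S \<nu>"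
proof -
  have "smooth_on S (\<lambda>p. cross3 (P p) (Q p))"
    by (rule smooth_on_bilinear[OF open_S bilinear_conv_bounded_bilinear[THEN iffD1, OF bilinear_cross]
        smooth_on_P smooth_on_Q])
  then have "smooth_on S \<nu>"
    unfolding \<nu>_def[abs_def] using U_nz
    by (intro smooth_on_scaleR smooth_on_divide smooth_on_const smooth_on_first U(1) open_S) auto
  moreover have "norm (\<nu> p) = 1" if p: "p \<in> S" for p
  proof -
    have "(norm (cross3 (P p) (Q p)))\<^sup>2 = (U (fst p))\<^sup>2"
      using norm_cross_dot[of "P p" "Q p"] PQ_inner[OF p] by (simp add: power_mult_distrib power2_norm_eq_inner)
    then have "norm (cross3 (P p) (Q p)) = U (fst p)"
      by (rule power2_eq_imp_eq) (use U(2)[of "fst p"] p in auto)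
    then show ?thesis using U(2)[of "fst p"] p by (auto simp: \<nu>_def)
  qed
  moreover have "frechet_derivative F (at p) v \<bullet> \<nu> p = 0" if p: "p \<in> S" for p v
    by (simp add: frechet_derivative_at[OF F_deriv[OF p], symmetric] \<nu>_def inner_add_left dot_cross_self)
  ultimately show ?thesis
    using open_S frechet_derivative_plane_chart[OF open_S, of _ F] smooth_vector_map_plane[OF open_S open_S order.refl]
    by (auto simp: unit_normal_field_def plane_atlas_def)
qed

lemma frontal_F: "frontal (top_of_set S) (plane_atlas S) F"
proof -
  have "S \<subseteq> closure (S - {0} \<times> UNIV)"
  proof
    fix p assume p: "p \<in> S"
    show "p \<in> closure (S - {0} \<times> UNIV)"
      unfolding closure_approachable
    proof (intro allI impI)
      fix e :: real assume e: "e > 0"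
      obtain d where d: "d > 0" "ball (fst p) d \<subseteq> J" using J(1) p open_contains_ball by (metis mem_Times_iff)
      define s where "s = (if fst p = 0 then min d e / 2 else fst p)"
      have "s \<noteq> 0" "dist s (fst p) < d" "dist s (fst p) < e" using d(1) e by (auto simp: s_def)
      then have "(s, snd p) \<in> S - {0} \<times> UNIV" "dist (s, snd p) p < e"
        using d(2) by (auto simp: dist_commute dist_prod_def)
      then show "\<exists>y\<in>S - {0} \<times> UNIV. dist y p < e" by blast
    qed
  qed
  then have "top_of_set S closure_of (S - {0} \<times> UNIV) = S"
    by (simp add: closure_of_subtopology Int_absorb1 Int_absorb2 Diff_subset)
  then have "surface (top_of_set S) (plane_atlas S) F"
    using oriented_surface_manifold_plane[OF open_S] singular_points_F
      smooth_vector_map_plane[OF open_S open_S order.refl smooth_on_F]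
    by (simp add: surface_def)
  moreover have "\<exists>D \<nu>. p \<in> D \<and> unit_normal_field (top_of_set S) (plane_atlas S) F D \<nu>"
    if "p \<in> S" for p
    using unit_normal_field_F that by (intro exI[of _ S] exI[of _ \<nu>] conjI)
  ultimately show ?thesis unfolding frontal_def topspace_subtopology topspace_euclidean Int_UNIV_left by blast
qed

text \<open>Moving \<open>t\<close> by \<open>e1 m \<tau>\<close> increases \<open>\<theta>\<close> by \<open>\<tau>\<close>, the factor \<open>e1\<close> being its own inverse.\<close>

lemma invariant_F: "invariant_under (top_of_set S) (plane_atlas S) F (screw h)"
proof -
  define \<phi> where "\<phi> \<tau> p = (fst p, snd p + e1 * m * \<tau>)" for \<tau> and p :: "real \<times> real"
  have "\<theta> (\<phi> \<tau> p) = \<theta> p + \<tau>" for \<tau> p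
    using m signs(2) by (simp add: \<phi>_def \<theta>_eq field_simps)
  then have "F (\<phi> \<tau> p) = screw h \<tau> (F p)" for \<tau> p
    by (simp add: F_eq screw_def cos_add sin_add vec_eq_iff forall_3 algebra_simps) (simp add: \<phi>_def)
  moreover have "one_parameter_group (top_of_set S) (plane_atlas S) \<phi>"
  proof -
    have "continuous_on (UNIV \<times> S) (\<lambda>(\<tau>, q). \<phi> \<tau> q)"
      unfolding \<phi>_def split_beta by (intro continuous_intros)
    then have "continuous_map (prod_topology euclideanreal (top_of_set S)) (top_of_set S) (\<lambda>(\<tau>, q). \<phi> \<tau> q)"
      using prod_topology_subtopology(2)[of euclideanreal euclidean S]
      by (auto simp: \<phi>_def)
    moreover have "smooth_on {(\<tau>, x). x \<in> S \<and> \<phi> \<tau> (inv_into S id x) \<in> S} (\<lambda>(\<tau>, x). id (\<phi> \<tau> (inv_into S id x)))"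
    proof -
      have eq: "{(\<tau>, x). x \<in> S \<and> \<phi> \<tau> (inv_into S id x) \<in> S} = UNIV \<times> S"
        by (auto simp: inv_into_id \<phi>_def)
      have op: "open ((UNIV :: real set) \<times> S)" by (intro open_Times open_UNIV open_S)
      have "smooth_on (UNIV \<times> S) (\<lambda>y. (fst (snd y), snd (snd y) + e1 * m * fst y))"
        by (intro smooth_on_intros op)
      then show ?thesis unfolding eq
        by (rule smooth_on_cong[OF op, THEN iffD2, rotated]) (auto simp: inv_into_id \<phi>_def)
    qed
    ultimately show ?thesis
      by (simp add: one_parameter_group_def plane_atlas_def) (simp add: \<phi>_def algebra_simps)
  qed
  ultimately show ?thesis unfolding invariant_under_def by blast
qed

end

section \<open>Cylindrical coordinates and the edge normal form\<close>

text \<open>The arctangent covers the directions of a half-plane only; the sign \<open>e\<close> allows negative radii, as the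
  helicoidal family does.\<close>

lemma polar_half_plane:
  fixes X Y e :: real
  assumes "e \<in> {1, -1}" "e * X > 0"
  shows "e * sqrt (X\<^sup>2 + Y\<^sup>2) * cos (arctan (Y / X)) = X"
    "e * sqrt (X\<^sup>2 + Y\<^sup>2) * sin (arctan (Y / X)) = Y"
    "e * (e * sqrt (X\<^sup>2 + Y\<^sup>2)) > 0"
proof -
  have X: "X \<noteq> 0" "\<bar>X\<bar> = e * X" and ee: "e * e = 1" using assms by auto
  have "X\<^sup>2 + Y\<^sup>2 = X\<^sup>2 * (1 + (Y / X)\<^sup>2)"
    using X(1) by (simp add: power_divide distrib_left)
  then have q: "sqrt (X\<^sup>2 + Y\<^sup>2) = \<bar>X\<bar> * sqrt (1 + (Y / X)\<^sup>2)"
    by (simp add: real_sqrt_mult)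
  have nz: "sqrt (1 + (Y / X)\<^sup>2) \<noteq> 0"
    by (simp add: add_nonneg_eq_0_iff)
  show "e * sqrt (X\<^sup>2 + Y\<^sup>2) * cos (arctan (Y / X)) = X"
    unfolding q X(2) cos_arctan using nz ee by (simp add: mult.assoc[symmetric])
  then have "X * (Y / X) = e * sqrt (X\<^sup>2 + Y\<^sup>2) * cos (arctan (Y / X)) * tan (arctan (Y / X))"
    by (simp add: tan_arctan)
  then show "e * sqrt (X\<^sup>2 + Y\<^sup>2) * sin (arctan (Y / X)) = Y"
    using X(1) by (simp add: tan_def cos_arctan_not_zero)
  have "X\<^sup>2 + Y\<^sup>2 > 0" using X(1) by (simp add: sum_power2_gt_zero_iff)
  then show "e * (e * sqrt (X\<^sup>2 + Y\<^sup>2)) > 0" using ee by (simp add: mult.assoc[symmetric])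
qed

lemma polar_half_plane_inverse:
  fixes r w e :: real
  assumes "e \<in> {1, -1}" "e * r > 0" "\<bar>w\<bar> < pi / 2"
  shows "e * (r * cos w) > 0" "e * sqrt ((r * cos w)\<^sup>2 + (r * sin w)\<^sup>2) = r"
    "arctan ((r * sin w) / (r * cos w)) = w"
proof -
  have c: "cos w > 0" using assms(3) by (intro cos_gt_zero_pi) auto
  then show "e * (r * cos w) > 0" using assms(2) by (simp add: mult.assoc[symmetric])
  have "(r * cos w)\<^sup>2 + (r * sin w)\<^sup>2 = r\<^sup>2"
    using sin_cos_squared_add[of w] by algebra
  then show "e * sqrt ((r * cos w)\<^sup>2 + (r * sin w)\<^sup>2) = r" using assms(1,2) by auto
  have "(r * sin w) / (r * cos w) = tan w" using assms(2) by (auto simp: tan_def)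
  then show "arctan ((r * sin w) / (r * cos w)) = w" using assms(3) by (simp add: arctan_tan)
qed

text \<open>Signed radius, height corrected by \<open>h\<close> times the angle, and angle measured from the direction \<open>\<theta>\<close>.
  With this correction a helicoidal surface of pitch \<open>h\<close> becomes a cylinder over its profile, since
  the last coordinate separates.\<close>

definition cyl_chart :: "real \<Rightarrow> real \<Rightarrow> real \<Rightarrow> real^3 \<Rightarrow> real^3" where
  "cyl_chart h e \<theta> y =
    (let X = y $ 1 * cos \<theta> + y $ 2 * sin \<theta>; Y = y $ 2 * cos \<theta> - y $ 1 * sin \<theta>; w = arctan (Y / X)
     in vector [e * sqrt (X\<^sup>2 + Y\<^sup>2), y $ 3 - h * (w + \<theta>), w])"

definition cyl_param :: "real \<Rightarrow> real \<Rightarrow> real^3 \<Rightarrow> real^3" where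
  "cyl_param h \<theta> q = vector [q $ 1 * cos (q $ 3 + \<theta>), q $ 1 * sin (q $ 3 + \<theta>), q $ 2 + h * (q $ 3 + \<theta>)]"

lemma cyl_param_chart:
  assumes "e \<in> {1, -1}" "e * (y $ 1 * cos \<theta> + y $ 2 * sin \<theta>) > 0"
  shows "cyl_param h \<theta> (cyl_chart h e \<theta> y) = y"
    "e * cyl_chart h e \<theta> y $ 1 > 0" "\<bar>cyl_chart h e \<theta> y $ 3\<bar> < pi / 2"
proof -
  define X where "X = y $ 1 * cos \<theta> + y $ 2 * sin \<theta>"
  define Y where "Y = y $ 2 * cos \<theta> - y $ 1 * sin \<theta>"
  have c: "cyl_chart h e \<theta> y = vector [e * sqrt (X\<^sup>2 + Y\<^sup>2), y $ 3 - h * (arctan (Y / X) + \<theta>), arctan (Y / X)]"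
    by (simp add: cyl_chart_def X_def Y_def Let_def)
  note p = polar_half_plane[OF assms(1) assms(2)[folded X_def], of Y]
  show "e * cyl_chart h e \<theta> y $ 1 > 0" using p(3) by (simp add: c)
  show "\<bar>cyl_chart h e \<theta> y $ 3\<bar> < pi / 2"
    using arctan_lbound[of "Y / X"] arctan_ubound[of "Y / X"] by (simp add: c abs_less_iff)
  have "X * cos \<theta> - Y * sin \<theta> = y $ 1" "X * sin \<theta> + Y * cos \<theta> = y $ 2"
    using sin_cos_squared_add[of \<theta>] unfolding X_def Y_def by algebra+
  moreover have "r * cos (w + \<theta>) = (r * cos w) * cos \<theta> - (r * sin w) * sin \<theta>"
    "r * sin (w + \<theta>) = (r * cos w) * sin \<theta> + (r * sin w) * cos \<theta>" for r w :: real
    by (simp_all add: cos_add sin_add algebra_simps)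
  ultimately show "cyl_param h \<theta> (cyl_chart h e \<theta> y) = y"
    by (simp add: cyl_param_def c vec_eq_iff forall_3 p(1,2))
qed

lemma cyl_chart_param:
  assumes "e \<in> {1, -1}" "e * q $ 1 > 0" "\<bar>q $ 3\<bar> < pi / 2"
  shows "cyl_chart h e \<theta> (cyl_param h \<theta> q) = q"
    "e * (cyl_param h \<theta> q $ 1 * cos \<theta> + cyl_param h \<theta> q $ 2 * sin \<theta>) > 0"
proof -
  have XY: "cyl_param h \<theta> q $ 1 * cos \<theta> + cyl_param h \<theta> q $ 2 * sin \<theta> = q $ 1 * cos (q $ 3)"
    "cyl_param h \<theta> q $ 2 * cos \<theta> - cyl_param h \<theta> q $ 1 * sin \<theta> = q $ 1 * sin (q $ 3)"
  proof -
    have cd: "cos (q $ 3) = cos (q $ 3 + \<theta>) * cos \<theta> + sin (q $ 3 + \<theta>) * sin \<theta>"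
      "sin (q $ 3) = sin (q $ 3 + \<theta>) * cos \<theta> - cos (q $ 3 + \<theta>) * sin \<theta>"
      using cos_diff[of "q $ 3 + \<theta>" \<theta>] sin_diff[of "q $ 3 + \<theta>" \<theta>] by simp_all
    show "cyl_param h \<theta> q $ 1 * cos \<theta> + cyl_param h \<theta> q $ 2 * sin \<theta> = q $ 1 * cos (q $ 3)"
      "cyl_param h \<theta> q $ 2 * cos \<theta> - cyl_param h \<theta> q $ 1 * sin \<theta> = q $ 1 * sin (q $ 3)"
      unfolding cyl_param_def vector_3 cd by (simp_all only: distrib_left right_diff_distrib mult.assoc)
  qed
  note p = polar_half_plane_inverse[OF assms]
  show "e * (cyl_param h \<theta> q $ 1 * cos \<theta> + cyl_param h \<theta> q $ 2 * sin \<theta>) > 0"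
    unfolding XY by (rule p(1))
  show "cyl_chart h e \<theta> (cyl_param h \<theta> q) = q"
    unfolding cyl_chart_def XY p(2,3) Let_def by (simp add: vec_eq_iff forall_3) (simp add: cyl_param_def)
qed

text \<open>The shear by \<open>l\<close>, which subtracts a multiple of the height from the radius, will cancel the leading
  term of the radius along the profile.\<close>

lemma diffeo_open_cylinder_shear:
  fixes e \<sigma> l x0 z0 h \<theta> :: real
  assumes "e \<in> {1, -1}" "\<sigma> \<in> {1, -1}"
  defines "\<Phi> y \<equiv> let q = cyl_chart h e \<theta> y in
      vector [\<sigma> * (q $ 2 - z0), q $ 1 - x0 - l * (q $ 2 - z0), q $ 3] :: real^3"
  shows "diffeo_open {y. e * (y $ 1 * cos \<theta> + y $ 2 * sin \<theta>) > 0}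
    {q. e * (q $ 2 + x0 + l * \<sigma> * q $ 1) > 0 \<and> \<bar>q $ 3\<bar> < pi / 2} \<Phi>"
proof (rule diffeo_openI)
  let ?g = "\<lambda>q::real^3. vector [q $ 2 + x0 + l * \<sigma> * q $ 1, z0 + \<sigma> * q $ 1, q $ 3] :: real^3"
  let ?W1 = "{y :: real^3. e * (y $ 1 * cos \<theta> + y $ 2 * sin \<theta>) > 0}"
  let ?W2 = "{q :: real^3. e * (q $ 2 + x0 + l * \<sigma> * q $ 1) > 0 \<and> \<bar>q $ 3\<bar> < pi / 2}"
  have ss: "\<sigma> * \<sigma> = 1" using assms(2) by auto
  show o1: "open ?W1" by (intro open_Collect_less continuous_intros)
  show o2: "open ?W2" by (intro open_Collect_conj open_Collect_less continuous_intros)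
  show "smooth_on ?W1 \<Phi>"
    unfolding \<Phi>_def cyl_chart_def Let_def vector_3
  proof (intro smooth_on_vector3 smooth_on_mult smooth_on_add smooth_on_diff smooth_on_const smooth_on_sqrt
        smooth_on_power smooth_on_arctan smooth_on_divide smooth_on_vec_nth smooth_on_id o1)
    fix y :: "real^3" assume y: "y \<in> ?W1"
    then show "y $ 1 * cos \<theta> + y $ 2 * sin \<theta> \<noteq> 0" by auto
    then show "(y $ 1 * cos \<theta> + y $ 2 * sin \<theta>)\<^sup>2 + (y $ 2 * cos \<theta> - y $ 1 * sin \<theta>)\<^sup>2 > 0"
      by (simp add: sum_power2_gt_zero_iff)
  qed (auto)
  show "smooth_on ?W2 (\<lambda>q. cyl_param h \<theta> (?g q))"
    unfolding cyl_param_def vector_3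
    by (intro smooth_on_vector3 smooth_on_mult smooth_on_add smooth_on_const smooth_on_sin smooth_on_cos
        smooth_on_vec_nth smooth_on_id o2)
  show "\<Phi> y \<in> ?W2 \<and> cyl_param h \<theta> (?g (\<Phi> y)) = y" if "y \<in> ?W1" for y
  proof -
    note c = cyl_param_chart[OF assms(1), of y \<theta> h] 
    have "?g (\<Phi> y) = cyl_chart h e \<theta> y"
      using ss by (simp add: \<Phi>_def Let_def vec_eq_iff forall_3) (simp add: mult.assoc[symmetric] mult.assoc[of l] )
    moreover from this have "\<Phi> y $ 2 + x0 + l * \<sigma> * \<Phi> y $ 1 = cyl_chart h e \<theta> y $ 1"
      by (metis vector_3(1))
    moreover have "\<Phi> y $ 3 = cyl_chart h e \<theta> y $ 3" by (simp add: \<Phi>_def Let_def)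
    ultimately show ?thesis using c that by simp
  qed
  show "cyl_param h \<theta> (?g q) \<in> ?W1 \<and> \<Phi> (cyl_param h \<theta> (?g q)) = q" if "q \<in> ?W2" for q
  proof -
    have c: "cyl_chart h e \<theta> (cyl_param h \<theta> (?g q)) = ?g q"
      "cyl_param h \<theta> (?g q) \<in> ?W1"
      using cyl_chart_param[OF assms(1), of "?g q" h \<theta>] that by auto
    have "\<Phi> (cyl_param h \<theta> (?g q)) = q"
      unfolding \<Phi>_def c(1) using ss by (simp add: Let_def vec_eq_iff forall_3)
    with c(2) show ?thesis by blast
  qed
qed

context helicoidal_family
begin

lemma \<rho>0: "\<rho> 0 \<noteq> 0"
  using star by (simp add: star_condition_def \<rho>_def)

lemma c_nz: "s \<in> J \<Longrightarrow> \<rho> s \<noteq> 0 \<Longrightarrow> c s \<noteq> 0"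
  using R_nz[of s] U_nz[of s] m signs(6) by (simp add: c_def)

lemma e0_x: "s \<in> J \<Longrightarrow> e0 * x s > 0"
  using R_pos[of s] signs(1) by (simp add: x_def bour_x_def R_def mult.assoc[symmetric])

text \<open>Since \<open>\<rho>(0) \<noteq> 0\<close>, the derivative \<open>s\<^sup>k c\<close> of \<open>z\<close> vanishes to order exactly \<open>k\<close>, so that \<open>z - z(0)\<close> is
  \<open>s\<^bsup>k+1\<^esup>\<close> times a unit, whose \<open>(k+1)\<close>-st root is absorbed into the parameter \<open>u\<close>. The radius has the
  derivative \<open>s\<^sup>k a\<close>; subtracting \<open>a(0) / c(0)\<close> times the height raises the order of vanishing by one.\<close>

lemma profile_normal_form:
  obtains I \<sigma> l u w A where "open I" "0 \<in> I" "I \<subseteq> J" "\<sigma> \<in> {1, -1}"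
    "smooth_on I u" "u 0 = 0" "open (u ` I)" "smooth_on (u ` I) w" "\<And>s. s \<in> I \<Longrightarrow> w (u s) = s"
    "smooth_on (u ` I) A" "\<And>s. s \<in> I \<Longrightarrow> \<sigma> * (z s - z 0) = u s ^ (k + 1)"
    "\<And>s. s \<in> I \<Longrightarrow> x s - x 0 - l * (z s - z 0) = u s ^ (k + 2) * A (u s)"
proof -
  have c0: "c 0 \<noteq> 0" by (rule c_nz[OF J(3) \<rho>0])
  obtain C where C: "smooth_on J C" "\<And>s. s \<in> J \<Longrightarrow> z s = z 0 + s ^ Suc k * C s" "C 0 = c 0 / Suc k"
    using smooth_factor_power[OF J smooth_on_abc(3) z_deriv] by blast
  define l where "l = a 0 / c 0"
  define f where "f s = a s - l * c s" for s
  have sf: "smooth_on J f"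
    unfolding f_def[abs_def] by (intro smooth_on_diff smooth_on_mult smooth_on_const smooth_on_abc J(1))
  have f0: "f 0 = 0" using c0 by (simp add: f_def l_def)
  obtain f' where f': "smooth_on J f'" "\<And>s. s \<in> J \<Longrightarrow> (f has_real_derivative f' s) (at s)"
    using smooth_on_real_derivativeE[OF sf] by blast
  have "(f has_real_derivative s ^ 0 * f' s) (at s)" if "s \<in> J" for s
    using f'(2)[OF that] by simp
  from smooth_factor_power[OF J f'(1) this] obtain g where g: "smooth_on J g" "\<And>s. s \<in> J \<Longrightarrow> f s = s * g s"
    using f0 by (metis One_nat_def add_0 power_one_right)
  have "((\<lambda>s. x s - x 0 - l * (z s - z 0)) has_real_derivative s ^ Suc k * g s) (at s)" if s: "s \<in> J" for s
  proof -
    have "((\<lambda>s. x s - x 0 - l * (z s - z 0)) has_real_derivative s ^ k * a s - 0 - l * (s ^ k * c s - 0)) (at s)"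
      by (intro DERIV_diff DERIV_cmult x_deriv z_deriv s DERIV_const)
    moreover have "s ^ k * a s - 0 - l * (s ^ k * c s - 0) = s ^ Suc k * g s"
      using g(2)[OF s] unfolding f_def by (simp add: algebra_simps)
    ultimately show ?thesis by (simp only:)
  qed
  from smooth_factor_power[OF J g(1) this] obtain E where E: "smooth_on J E"
    "\<And>s. s \<in> J \<Longrightarrow> x s - x 0 - l * (z s - z 0) = s ^ Suc (Suc k) * E s" by auto
  \<comment> \<open>A real root of even degree is available only after the sign of \<open>C\<close> is split off.\<close>
  define \<sigma> where "\<sigma> = sgn (C 0)"
  have C0: "C 0 \<noteq> 0" using c0 C(3) by simp
  have \<sigma>: "\<sigma> \<in> {1, -1}" "\<sigma> * C 0 > 0" "\<sigma> * \<sigma> = 1" using C0 by (auto simp: \<sigma>_def sgn_if)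
  define S0 where "S0 = {s \<in> J. \<sigma> * C s > 0}"
  have "S0 = J \<inter> (\<lambda>s. \<sigma> * C s) -` {0<..}" by (auto simp: S0_def)
  then have S0: "open S0" "0 \<in> S0" "S0 \<subseteq> J"
    using smooth_on_imp_continuous_on[OF C(1)] \<sigma>(2) J
    by (auto simp: S0_def intro!: continuous_open_preimage continuous_intros)
  define r where "r s = (\<sigma> * C s) powr (1 / Suc k)" for s
  have sr: "smooth_on S0 r"
    unfolding r_def[abs_def]
    by (intro smooth_on_powr smooth_on_mult smooth_on_const smooth_on_subset[OF C(1) S0(3)] S0(1))
       (simp add: S0_def)
  have r: "r s > 0" "r s ^ Suc k = \<sigma> * C s" if "s \<in> S0" for s
  proof -
    have p: "\<sigma> * C s > 0" using that by (simp add: S0_def)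
    then show rpos: "r s > 0" by (auto simp: r_def)
    have pp: "(y powr (1 / real (Suc k))) powr real (Suc k) = y" if "y > 0" for y :: real
      using that by (simp add: powr_powr del: of_nat_Suc)
    have "r s ^ Suc k = r s powr (Suc k)" using rpos by (simp only: powr_realpow)
    also have "\<dots> = \<sigma> * C s" unfolding r_def by (rule pp[OF p])
    finally show "r s ^ Suc k = \<sigma> * C s" .
  qed
  define u where "u s = s * r s" for s
  have su: "smooth_on S0 u"
    unfolding u_def[abs_def] by (intro smooth_on_mult smooth_on_id sr S0(1))
  obtain r' where "(r has_real_derivative r') (at 0)"
    using smooth_on_real_derivativeE[OF sr] S0(2) by blast
  from DERIV_mult[OF DERIV_ident this] have du: "(u has_real_derivative r 0) (at 0)"
    by (simp add: u_def[abs_def])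
  obtain d where d: "d > 0" "{0 - d<..<0 + d} \<subseteq> S0" "inj_on u {0 - d<..<0 + d}"
    "open (u ` {0 - d<..<0 + d})" "smooth_on (u ` {0 - d<..<0 + d}) (inv_into {0 - d<..<0 + d} u)"
    using smooth_local_inverse[OF S0(1,2) su du r(1)[OF S0(2)]] by blast
  define I where "I = {0 - d<..<0 + d}"
  define w where "w = inv_into I u"
  define A where "A y = E (w y) / r (w y) ^ Suc (Suc k)" for y
  note d = d[folded I_def, folded w_def]
  have I: "open I" "0 \<in> I" "I \<subseteq> J" using d(1,2) S0(3) by (auto simp: I_def)
  have w: "w (u s) = s" if "s \<in> I" for s using d(3) that by (simp add: w_def)
  have "smooth_on I (\<lambda>s. E s / r s ^ Suc (Suc k))"
    using r(1) d(2) by (intro smooth_on_divide smooth_on_power smooth_on_subset[OF E(1) I(3)]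
        smooth_on_subset[OF sr d(2)] I(1)) fastforce
  then have "smooth_on (u ` I) A"
    unfolding A_def[abs_def] using w
    by (intro smooth_on_compose[OF d(4) I(1) _ d(5), of "\<lambda>s. E s / r s ^ Suc (Suc k)"]) auto
  moreover have "\<sigma> * (z s - z 0) = u s ^ (k + 1)" if s: "s \<in> I" for s
  proof -
    have s': "s \<in> J" "s \<in> S0" using s I(3) d(2) by auto
    have "\<sigma> * (z s - z 0) = s ^ Suc k * (\<sigma> * C s)" using C(2)[OF s'(1)] by simp
    then show ?thesis unfolding r(2)[OF s'(2), symmetric] u_def power_mult_distrib by simp
  qed
  moreover have "x s - x 0 - l * (z s - z 0) = u s ^ (k + 2) * A (u s)" if s: "s \<in> I" for s
  proof -
    have s': "s \<in> J" "s \<in> S0" using s I(3) d(2) by auto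
    show ?thesis
      unfolding E(2)[OF s'(1)] A_def w[OF s] unfolding u_def power_mult_distrib
      using r(1)[OF s'(2)] by simp
  qed
  ultimately show ?thesis
    using I w \<sigma>(1) d(4,5) smooth_on_subset[OF su d(2)]
    by (intro that[of I \<sigma> u w A l]) (auto simp: u_def)
qed

text \<open>The source is changed by \<open>(s, t) \<mapsto> (u(s), \<theta>(s, t) - \<theta>(0, t0))\<close> and space by sheared cylindrical
  coordinates around the image point, which lies off the axis as \<open>x(0) \<noteq> 0\<close>. The source domain is cut
  down to angles less than \<open>\<pi> / 2\<close>, the reach of the arctangent.\<close>

lemma edge_singular_point_F:
  "edge_singular_point (k + 1) (top_of_set S) (plane_atlas S) F (0, t0)"
proof -
  obtain I \<sigma> l u w A where I: "open I" "0 \<in> I" "I \<subseteq> J" and \<sigma>: "\<sigma> \<in> {1, -1}"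
    and u: "smooth_on I u" "u 0 = 0" "open (u ` I)"
    and w: "smooth_on (u ` I) w" "\<And>s. s \<in> I \<Longrightarrow> w (u s) = s"
    and A: "smooth_on (u ` I) A"
    and nf: "\<And>s. s \<in> I \<Longrightarrow> \<sigma> * (z s - z 0) = u s ^ (k + 1)"
    "\<And>s. s \<in> I \<Longrightarrow> x s - x 0 - l * (z s - z 0) = u s ^ (k + 2) * A (u s)"
    by (rule profile_normal_form) (rule that)
  define \<theta>0 where "\<theta>0 = \<theta> (0, t0)"
  define \<phi> where "\<phi> p = (u (fst p), \<theta> p - \<theta>0)" for p
  define \<psi> where "\<psi> q = (w (fst q), e1 * (m * (snd q + \<theta>0) + e2 * h * turn (w (fst q))))" for q
  define D1 where "D1 = (I \<times> UNIV) \<inter> (\<lambda>p. \<theta> p - \<theta>0) -` {- (pi / 2)<..<pi / 2}"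
  define D2 where "D2 = u ` I \<times> {- (pi / 2)<..<pi / 2}"
  define \<Phi> :: "real^3 \<Rightarrow> real^3" where "\<Phi> y = (let q = cyl_chart h e0 \<theta>0 y in
      vector [\<sigma> * (q $ 2 - z 0), q $ 1 - x 0 - l * (q $ 2 - z 0), q $ 3])" for y
  let ?W1 = "{y :: real^3. e0 * (y $ 1 * cos \<theta>0 + y $ 2 * sin \<theta>0) > 0}"
  let ?W2 = "{q :: real^3. e0 * (q $ 2 + x 0 + l * \<sigma> * q $ 1) > 0 \<and> \<bar>q $ 3\<bar> < pi / 2}"
  have IS: "I \<times> UNIV \<subseteq> S" using I(3) by auto
  have oI: "open (I \<times> (UNIV :: real set))" using I(1) by (intro open_Times open_UNIV)
  have D1: "open D1" "D1 \<subseteq> S" "D1 \<subseteq> I \<times> UNIV"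
    unfolding D1_def using oI IS continuous_on_subset[OF smooth_on_imp_continuous_on[OF smooth_on_\<theta>] IS]
    by (auto intro!: continuous_open_preimage continuous_intros)
  have D2: "open D2" using u(3) by (auto simp: D2_def intro: open_Times)
  have first: "smooth_on T (\<lambda>p. g (fst p))" if "open T" "open K" "T \<subseteq> K \<times> UNIV" "smooth_on K g"
    for T :: "(real \<times> real) set" and K :: "real set" and g :: "real \<Rightarrow> real"
    by (rule smooth_on_compose[OF that(1,2) _ smooth_on_fst[OF that(1) smooth_on_id[OF that(1)]] that(4)])
       (use that(3) in auto)
  have dm: "diffeo_manifold (top_of_set S) (plane_atlas S) D1 (top_of_set UNIV) (plane_atlas UNIV) D2 \<phi>"
  proof (rule diffeo_manifold_planeI[OF open_S open_UNIV D1(1) D2 D1(2) subset_UNIV])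
    show "smooth_on D1 \<phi>"
      unfolding \<phi>_def[abs_def] using first[OF D1(1) I(1) D1(3) u(1)]
      by (intro smooth_on_Pair smooth_on_diff smooth_on_const smooth_on_subset[OF smooth_on_\<theta> D1(2)] D1(1))
    have sw: "smooth_on D2 (\<lambda>q. w (fst q))"
      by (rule first[OF D2 u(3) _ w(1)]) (auto simp: D2_def)
    have wJ: "(\<lambda>q. w (fst q)) ` D2 \<subseteq> J" using w(2) I(3) by (auto simp: D2_def)
    show "smooth_on D2 \<psi>"
      unfolding \<psi>_def[abs_def] using sw smooth_on_compose[OF D2 J(1) wJ sw smooth_on_turn]
      by (intro smooth_on_Pair smooth_on_mult smooth_on_add smooth_on_const smooth_on_snd smooth_on_id D2)
    show "\<phi> p \<in> D2 \<and> \<psi> (\<phi> p) = p" if "p \<in> D1" for p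
    proof -
      have p: "fst p \<in> I" using that D1(3) by auto
      have "e1 * (m * \<theta> p + e2 * h * turn (fst p)) = snd p"
        unfolding \<theta>_eq using m signs(2) by (simp add: mult.assoc[symmetric])
      then show ?thesis using that p w(2)[OF p] by (auto simp: \<phi>_def \<psi>_def D1_def D2_def prod_eq_iff)
    qed
    show "\<psi> q \<in> D1 \<and> \<phi> (\<psi> q) = q" if "q \<in> D2" for q
    proof -
      have "fst q \<in> u ` I" using that by (simp add: D2_def mem_Times_iff)
      then obtain s where s: "s \<in> I" "fst q = u s" by blast
      have "\<theta> (\<psi> q) = snd q + \<theta>0"
        unfolding \<theta>_eq \<psi>_def using m signs(2) by (simp add: mult.assoc[symmetric])
      then show ?thesis using that s w(2)[OF s(1)] by (auto simp: \<phi>_def \<psi>_def D1_def D2_def prod_eq_iff)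
    qed
  qed
  have cyl: "F p \<in> ?W1" "\<Phi> (F p) = edge_normal_form (k + 1) (\<lambda>q. A (fst q)) (\<phi> p)" if p: "p \<in> D1" for p
  proof -
    have s: "fst p \<in> I" "fst p \<in> J" using p I(3) by (auto simp: D1_def)
    have "\<theta> p - \<theta>0 \<in> {- (pi / 2)<..<pi / 2}" using p by (simp add: D1_def)
    then have abs: "\<bar>\<theta> p - \<theta>0\<bar> < pi / 2" unfolding greaterThanLessThan_iff by linarith
    define q :: "real^3" where "q = vector [x (fst p), z (fst p) + h * \<theta>0 - h * \<theta>0, \<theta> p - \<theta>0]"
    have Fq: "F p = cyl_param h \<theta>0 q"
      by (simp add: q_def cyl_param_def F_eq)
    have q: "e0 * q $ 1 > 0" "\<bar>q $ 3\<bar> < pi / 2" using e0_x[OF s(2)] abs by (auto simp: q_def)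
    note c = cyl_chart_param[OF e0 q, of h \<theta>0, folded Fq]
    show "F p \<in> ?W1" using c(2) by simp
    show "\<Phi> (F p) = edge_normal_form (k + 1) (\<lambda>q. A (fst q)) (\<phi> p)"
      unfolding \<Phi>_def c(1) Let_def using nf[OF s(1)] by (simp add: q_def edge_normal_form_def \<phi>_def)
  qed
  have "A_equivalent (top_of_set S) (plane_atlas S) (0, t0) F (top_of_set UNIV) (plane_atlas UNIV) (0, 0)
      (edge_normal_form (k + 1) (\<lambda>q. A (fst q)))"
    unfolding A_equivalent_def
  proof (intro exI conjI ballI)
    show "diffeo_manifold (top_of_set S) (plane_atlas S) D1 (top_of_set UNIV) (plane_atlas UNIV) D2 \<phi>" by (rule dm)
    show "(0, t0) \<in> D1" using I(2) by (simp add: D1_def \<theta>0_def)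
    show "\<phi> (0, t0) = (0, 0)" by (simp add: \<phi>_def \<theta>0_def u(2))
    show "diffeo_open ?W1 ?W2 \<Phi>"
      using diffeo_open_cylinder_shear[OF e0 \<sigma>] unfolding \<Phi>_def[abs_def] .
    show "F ` D1 \<subseteq> ?W1" using cyl(1) by blast
    show "edge_normal_form (k + 1) (\<lambda>q. A (fst q)) y = \<Phi> (F (inv_into D1 \<phi> y))" if "y \<in> D2" for y
    proof -
      have "y \<in> \<phi> ` D1" using dm that by (auto simp: diffeo_manifold_def bij_betw_def)
      then show ?thesis using cyl(2)[OF inv_into_into] f_inv_into_f by metis
    qed
  qed
  moreover have o: "open (u ` I \<times> (UNIV :: real set))" using u(3) by (intro open_Times open_UNIV)
  moreover have "smooth_on (u ` I \<times> (UNIV :: real set)) (\<lambda>q. A (fst q))"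
    using first[OF o u(3) _ A] by blast
  moreover have "(0, 0) \<in> u ` I \<times> UNIV" using I(2) u(2) by force
  ultimately show ?thesis unfolding edge_singular_point_def by blast
qed

lemma partial_v_Q:
  assumes "p \<in> S"
  shows "partial_v Q p = vector [- x (fst p) * cos (\<theta> p) / m\<^sup>2, - x (fst p) * sin (\<theta> p) / m\<^sup>2, 0]"
proof -
  obtain s t where p: "p = (s, t)" by (cases p)
  have dt: "((\<lambda>t. \<theta> (s, t)) has_real_derivative e1 / m) (at t)"
    unfolding \<theta>_eq using m by (auto intro!: derivative_eq_intros)
  have "((\<lambda>t. sin (\<theta> (s, t)) *\<^sub>R ((- x s * e1 / m) *\<^sub>R axis 1 1)
      + cos (\<theta> (s, t)) *\<^sub>R ((x s * e1 / m) *\<^sub>R axis 2 1) + (h * e1 / m) *\<^sub>R axis 3 1 :: real^3) has_vector_derivative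
      ((cos (\<theta> (s, t)) * (e1 / m)) *\<^sub>R ((- x s * e1 / m) *\<^sub>R axis 1 1)
      + (- sin (\<theta> (s, t)) * (e1 / m)) *\<^sub>R ((x s * e1 / m) *\<^sub>R axis 2 1) + 0)) (at t)"
    using DERIV_chain2[OF DERIV_sin dt] DERIV_chain2[OF DERIV_cos dt]
    unfolding has_real_derivative_iff_has_vector_derivative
    by (intro has_vector_derivative_add has_vector_derivative_const
        bounded_linear.has_vector_derivative[OF bounded_linear_scaleR_left])
  moreover have "(\<lambda>t. Q (s, t)) = (\<lambda>t. sin (\<theta> (s, t)) *\<^sub>R ((- x s * e1 / m) *\<^sub>R axis 1 1)
      + cos (\<theta> (s, t)) *\<^sub>R ((x s * e1 / m) *\<^sub>R axis 2 1) + (h * e1 / m) *\<^sub>R axis 3 1)"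
    by (simp add: fun_eq_iff Q_def vector3_eq mult_ac)
  ultimately have "((\<lambda>t. Q (s, t)) has_vector_derivative
      ((cos (\<theta> (s, t)) * (e1 / m)) *\<^sub>R ((- x s * e1 / m) *\<^sub>R axis 1 1)
      + (- sin (\<theta> (s, t)) * (e1 / m)) *\<^sub>R ((x s * e1 / m) *\<^sub>R axis 2 1) + 0)) (at t)"
    by (simp only:)
  moreover have "((\<lambda>t. Q (s, t)) has_vector_derivative partial_v Q (s, t)) (at t)"
    using partial_has_vector_derivative(2)[OF smooth_on_differentiable[OF smooth_on_Q]] assms p by blast
  ultimately have "partial_v Q (s, t) = ((cos (\<theta> (s, t)) * (e1 / m)) *\<^sub>R ((- x s * e1 / m) *\<^sub>R axis 1 1)
      + (- sin (\<theta> (s, t)) * (e1 / m)) *\<^sub>R ((x s * e1 / m) *\<^sub>R axis 2 1) + 0)"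
    by (rule vector_derivative_unique_at[rotated])
  then show ?thesis
    using e1 unfolding p by (auto simp: vector3_eq power2_eq_square mult.commute)
qed

text \<open>At a singular point the normal curvature is a nonzero multiple of \<open>c(0)\<close>, hence of \<open>\<rho>(0)\<close>: the
  acceleration of a helix points to its axis, and the radial component of \<open>P \<times> Q\<close> is a multiple of \<open>c x\<close>.\<close>

lemma generic_singular_point_F:
  "generic_singular_point (top_of_set S) (plane_atlas S) F (0, t0)"
proof -
  let ?p = "(0, t0) :: real \<times> real"
  let ?G = "F \<circ> inv_into S id"
  have p: "?p \<in> S" using J(3) by simp
  have sing: "?p \<in> singular_points (top_of_set S) (plane_atlas S) F" unfolding singular_points_F by simp
  have F': "frechet_derivative F (at y) = (\<lambda>v. (fst v * fst y ^ k) *\<^sub>R P y + snd v *\<^sub>R Q y)" if "y \<in> S" for y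
    using frechet_derivative_at[OF F_deriv[OF that]] by simp
  have G': "frechet_derivative ?G (at y) = (\<lambda>v. (fst v * fst y ^ k) *\<^sub>R P y + snd v *\<^sub>R Q y)" if "y \<in> S" for y
    using frechet_derivative_plane_chart[OF open_S that, of F] F'[OF that] by simp
  have Q0: "Q ?p \<noteq> 0" using PQ_inner(3)[OF p] U_nz[OF J(3)] by auto
  have "range (frechet_derivative F (at ?p)) = span {Q ?p}"
    unfolding F'[OF p] span_singleton using k image_image[of "\<lambda>r. r *\<^sub>R Q ?p" snd "UNIV :: (real \<times> real) set"]
    by (simp add: zero_power)
  then have "dim (range (frechet_derivative ?G (at ?p))) = 1"
    using Q0 frechet_derivative_plane_chart[OF open_S p, of F] by (simp add: dim_singleton)
  then have rank: "rank_one_at (plane_atlas S) F ?p"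
    using p by (simp add: rank_one_at_def plane_atlas_def)
  have "partial_u ?G ?p = 0" using k by (simp add: partial_u_def G'[OF p])
  moreover have "limiting_normal_curvature S id F \<nu> ?p \<noteq> 0"
  proof -
    have v: "partial_v ?G y = Q y" if "y \<in> S" for y by (simp add: partial_v_def G'[OF that])
    have "partial_v (partial_v ?G) ?p = partial_v Q ?p"
      unfolding partial_v_def[of _ ?p] using frechet_derivative_cong_open[OF open_S p v] by simp
    also have "\<dots> = vector [- x 0 * cos (\<theta> ?p) / m\<^sup>2, - x 0 * sin (\<theta> ?p) / m\<^sup>2, 0]"
      using partial_v_Q[OF p] by simp
    finally have vv: "partial_v (partial_v ?G) ?p = vector [- x 0 * cos (\<theta> ?p) / m\<^sup>2, - x 0 * sin (\<theta> ?p) / m\<^sup>2, 0]" .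
    have sc: "sin (\<theta> ?p) * sin (\<theta> ?p) + cos (\<theta> ?p) * cos (\<theta> ?p) = 1"
      using sin_cos_squared_add[of "\<theta> ?p"] by (simp add: power2_eq_square)
    have "cross3 (P ?p) (Q ?p) \<bullet> vector [- x 0 * cos (\<theta> ?p) / m\<^sup>2, - x 0 * sin (\<theta> ?p) / m\<^sup>2, 0]
        = c 0 * (x 0)\<^sup>2 * e1 / m ^ 3 * (sin (\<theta> ?p) * sin (\<theta> ?p) + cos (\<theta> ?p) * cos (\<theta> ?p))"
      using m by (simp add: cross3_def inner_vec_def sum_3 P_def Q_def field_simps power2_eq_square power3_eq_cube)
        (use sc in algebra)
    also have "\<dots> \<noteq> 0" using c_nz[OF J(3) \<rho>0] x_nz[OF J(3)] m signs(5) unfolding sc by simp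
    finally have "\<nu> ?p \<bullet> vector [- x 0 * cos (\<theta> ?p) / m\<^sup>2, - x 0 * sin (\<theta> ?p) / m\<^sup>2, 0] \<noteq> 0"
      using U_nz[OF J(3)] by (simp add: \<nu>_def)
    then show ?thesis
      unfolding limiting_normal_curvature_def Let_def id_apply vv v[OF p]
      using Q0 by (simp add: inner_commute)
  qed
  ultimately show ?thesis
    unfolding generic_singular_point_def
    using sing rank p unit_normal_field_F oriented_coordinates_plane[OF open_S]
    by (intro conjI exI[of _ S] exI[of _ \<nu>] exI[of _ id]) auto
qed

theorem generic_helicoidal_edge_F:
  "generic_helicoidal_edge (k + 1) (top_of_set S) (plane_atlas S) F"
  unfolding generic_helicoidal_edge_def
  using k frontal_F helicoidal_motion_screw invariant_F edge_singular_point_F generic_singular_point_F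
  by (auto simp: singular_points_F)

end

section \<open>Vector calculus in space\<close>

lemma cross_triple_left: "cross3 (cross3 a b) c = (a \<bullet> c) *\<^sub>R b - (b \<bullet> c) *\<^sub>R a"
  by (simp add: cross3_simps forall_3)

text \<open>The difference of the two sides is orthogonal to \<open>e\<close>, \<open>P\<close> and \<open>e \<times> P\<close>.\<close>

lemma cross_frame_expand:
  assumes "e \<bullet> e = 1" "P \<bullet> e = 0" "P \<bullet> P > 0"
  shows "v = (v \<bullet> e) *\<^sub>R e + (v \<bullet> P / (P \<bullet> P)) *\<^sub>R P + (v \<bullet> cross3 e P / (P \<bullet> P)) *\<^sub>R cross3 e P"
proof -
  have eP: "e \<bullet> P = 0" using assms(2) by (simp only: inner_commute)
  have n: "cross3 e P \<bullet> cross3 e P = P \<bullet> P"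
    using norm_cross_dot[of e P] assms(1) eP by (simp add: power_mult_distrib power2_norm_eq_inner)
  define d where "d = v - ((v \<bullet> e) *\<^sub>R e + (v \<bullet> P / (P \<bullet> P)) *\<^sub>R P + (v \<bullet> cross3 e P / (P \<bullet> P)) *\<^sub>R cross3 e P)"
  have "d \<bullet> e = 0" "d \<bullet> P = 0" "d \<bullet> cross3 e P = 0"
    using assms eP n unfolding d_def inner_diff_left inner_add_left inner_scaleR_left
    by (simp_all add: dot_cross_self)
  then have "cross3 (cross3 e P) d = 0" "cross3 e P \<bullet> d = 0"
    by (simp_all add: cross_triple_left inner_commute)
  then have "cross3 e P = 0 \<or> d = 0" by (meson norm_and_cross_eq_0)
  then have "d = 0" using n assms(3) by auto
  then show ?thesis by (simp add: d_def)
qed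

lemma has_vector_derivative_inner:
  fixes f g :: "real \<Rightarrow> 'b::real_inner"
  assumes "(f has_vector_derivative f') (at t)" "(g has_vector_derivative g') (at t)"
  shows "((\<lambda>t. f t \<bullet> g t) has_real_derivative f t \<bullet> g' + f' \<bullet> g t) (at t)"
  using bounded_bilinear.has_vector_derivative[OF bounded_bilinear_inner assms]
  by (simp add: has_real_derivative_iff_has_vector_derivative)

lemma has_vector_derivative_cross:
  assumes "(f has_vector_derivative f') (at t)"
  shows "((\<lambda>t. cross3 e (f t)) has_vector_derivative cross3 e f') (at t)"
proof -
  have "bounded_linear (cross3 e)"
    using bounded_bilinear.bounded_linear_right[OF bilinear_conv_bounded_bilinear[THEN iffD1, OF bilinear_cross]] .
  from bounded_linear.has_vector_derivative[OF this assms] show ?thesis .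
qed

lemma has_vector_derivative_scaleR_real:
  fixes f :: "real \<Rightarrow> real"
  assumes "(f has_real_derivative f') (at t)" "(g has_vector_derivative g') (at t)"
  shows "((\<lambda>t. f t *\<^sub>R g t) has_vector_derivative f t *\<^sub>R g' + f' *\<^sub>R g t) (at t)"
  using has_vector_derivative_scaleR[OF assms] .

lemma continuous_zero_extend:
  fixes d :: "real \<Rightarrow> 'b::real_normed_vector"
  assumes "open I" "a \<in> I" "continuous_on I d" "\<And>s. s \<in> I \<Longrightarrow> s \<noteq> a \<Longrightarrow> d s = 0"
  shows "d a = 0"
proof -
  have "d \<midarrow>a\<rightarrow> d a"
    using assms(1-3) by (simp add: continuous_on_eq_continuous_at isCont_def)
  moreover have "eventually (\<lambda>s. d s = 0) (at a)"
    using eventually_at_in_open[OF assms(1,2)] by eventually_elim (use assms(4) in auto)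
  then have "d \<midarrow>a\<rightarrow> 0" by (rule tendsto_eventually)
  ultimately show ?thesis using tendsto_unique[of "at a"] by auto
qed

text \<open>One factor \<open>s\<close> is split off at a time: the equation forces \<open>f(0) = 0\<close>, and after division by \<open>s\<^sup>2\<close> it
  persists at \<open>s = 0\<close> by continuity. Smoothness of \<open>f\<close> is essential: \<open>\<bar>s\<bar>\<close> has the right square for
  \<open>k = 1\<close>. For the ascent \<open>\<eta>\<close> of a profile this rules out a
  jump in the sign of \<open>\<eta> / s\<^sup>k\<close> at the edge.\<close>

lemma smooth_square_divide:
  fixes f u r :: "real \<Rightarrow> real"
  assumes I: "open I" "is_interval I" "0 \<in> I" and "smooth_on I f"
    and u: "continuous_on I u" "\<And>s. s \<in> I \<Longrightarrow> u s > 0" and r: "continuous_on I r"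
    and "\<And>s. s \<in> I \<Longrightarrow> (f s)\<^sup>2 * u s = s ^ (2 * k) * r s"
  obtains c where "smooth_on I c" "\<And>s. s \<in> I \<Longrightarrow> f s = s ^ k * c s" "\<And>s. s \<in> I \<Longrightarrow> (c s)\<^sup>2 * u s = r s"
proof -
  have "\<exists>c. smooth_on I c \<and> (\<forall>s\<in>I. f s = s ^ k * c s) \<and> (\<forall>s\<in>I. (c s)\<^sup>2 * u s = r s)"
    using assms(4,8)
  proof (induction k arbitrary: f)
    case 0
    then show ?case by (intro exI[of _ f]) auto
  next
    case (Suc k)
    have "(f 0)\<^sup>2 * u 0 = 0" using Suc.prems(2)[OF I(3)] by simp
    then have f0: "f 0 = 0" using u(2)[OF I(3)] by simp
    obtain f' where f': "smooth_on I f'" "\<And>x. x \<in> I \<Longrightarrow> (f has_real_derivative f' x) (at x)"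
      using smooth_on_real_derivativeE[OF Suc.prems(1)] by blast
    have "(f has_real_derivative s ^ 0 * f' s) (at s)" if "s \<in> I" for s
      using f'(2)[OF that] by simp
    from smooth_factor_power[OF I f'(1) this] obtain g where g: "smooth_on I g" "\<And>s. s \<in> I \<Longrightarrow> f s = s * g s"
      using f0 by (metis One_nat_def add_0 power_one_right)
    have 1: "(g s)\<^sup>2 * u s - s ^ (2 * k) * r s = 0" if "s \<in> I" "s \<noteq> 0" for s
    proof -
      have "s\<^sup>2 * ((g s)\<^sup>2 * u s) = s\<^sup>2 * (s ^ (2 * k) * r s)"
        using Suc.prems(2)[OF that(1)] g(2)[OF that(1)]
        by (simp add: power_mult_distrib mult.assoc power2_eq_square)
      then show ?thesis using that(2) by simp
    qed
    have "continuous_on I (\<lambda>s. (g s)\<^sup>2 * u s - s ^ (2 * k) * r s)"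
      using smooth_on_imp_continuous_on[OF g(1)] u(1) r by (intro continuous_intros)
    from continuous_zero_extend[OF I(1,3) this 1] have "(g 0)\<^sup>2 * u 0 - 0 ^ (2 * k) * r 0 = 0" by blast
    then have "(g s)\<^sup>2 * u s = s ^ (2 * k) * r s" if "s \<in> I" for s
      using 1[OF that] by (cases "s = 0") auto
    from Suc.IH[OF g(1) this] obtain c where
      "smooth_on I c" "\<forall>s\<in>I. g s = s ^ k * c s" "\<forall>s\<in>I. (c s)\<^sup>2 * u s = r s" by blast
    then show ?case using g(2) by (intro exI[of _ c]) (simp add: mult.assoc)
  qed
  then show ?thesis using that by blast
qed

lemma open_pos_interval:
  fixes I :: "real set"
  assumes "open I" "0 \<in> I" "continuous_on I f" "f 0 > (0 :: real)" "continuous_on I g" "g 0 > (0 :: real)"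
  obtains d where "d > 0" "{-d<..<d} \<subseteq> I" "\<And>s. s \<in> {-d<..<d} \<Longrightarrow> f s > 0" "\<And>s. s \<in> {-d<..<d} \<Longrightarrow> g s > 0"
proof -
  have "open (I \<inter> f -` {0<..})" "open (I \<inter> g -` {0<..})"
    using assms by (auto intro: continuous_open_preimage)
  then have "open ((I \<inter> f -` {0<..}) \<inter> (I \<inter> g -` {0<..}))" by blast
  moreover have "0 \<in> (I \<inter> f -` {0<..}) \<inter> (I \<inter> g -` {0<..})" using assms by auto
  ultimately obtain d where "d > 0" "ball 0 d \<subseteq> (I \<inter> f -` {0<..}) \<inter> (I \<inter> g -` {0<..})"
    using open_contains_ball by blast
  then show ?thesis by (intro that[of d]) (auto simp: ball_def subset_iff)
qed

section \<open>The profile curve of a helicoidal surface\<close>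

text \<open>The curve \<open>y\<close> is a line \<open>t = const\<close> of the surface, and the helices through its points have velocity
  proportional to \<open>e \<times> y + h e\<close>. Let \<open>P\<close> be the part of \<open>y\<close> orthogonal to the axis direction \<open>e\<close>, and
  \<open>\<eta> = y' \<bullet> e\<close>. The length of the helix velocity gives \<open>\<bar>P\<bar>\<^sup>2 = m\<^sup>2 U\<^sup>2 - h\<^sup>2\<close>, orthogonality gives the rotational
  speed \<open>- h \<eta> / \<bar>P\<bar>\<^sup>2\<close>, and the length of \<open>y'\<close> then gives \<open>m\<^sup>2 U\<^sup>2 \<eta>\<^sup>2 = s\<^bsup>2k\<^esup> \<rho>\<^sup>2\<close>. So \<open>\<eta> = s\<^sup>k c\<close> with
  smooth \<open>c\<close>. A zero of \<open>c\<close> at \<open>0\<close> is excluded by the hypothesis on the normal \<open>\<nu>\<close>; hence \<open>c\<close> has a constant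
  sign near \<open>0\<close>, and \<open>y\<close> and the profile of the family have the same radius, rotation and ascent.\<close>

lemma helicoidal_profile:
  fixes y y' \<nu> :: "real \<Rightarrow> real^3" and e :: "real^3" and t0 :: real
  assumes k: "k > 0" and I: "open I" "is_interval I" "0 \<in> I"
    and U: "smooth_on I U" "\<And>s. s \<in> I \<Longrightarrow> U s > 0"
    and V: "smooth_on I V" "\<And>s. s \<in> I \<Longrightarrow> (U has_real_derivative s ^ k * V s) (at s)"
    and m: "m > 0" and e: "e \<bullet> e = 1"
    and y: "smooth_on I y'" "\<And>s. s \<in> I \<Longrightarrow> (y has_vector_derivative y' s) (at s)"
    and g1: "\<And>s. s \<in> I \<Longrightarrow> y' s \<bullet> y' s = s ^ (2 * k)"
    and g2: "\<And>s. s \<in> I \<Longrightarrow> y' s \<bullet> (cross3 e (y s) + h *\<^sub>R e) = 0"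
    and g3: "\<And>s. s \<in> I \<Longrightarrow> (norm (cross3 e (y s) + h *\<^sub>R e))\<^sup>2 = m\<^sup>2 * (U s)\<^sup>2"
    and nu: "continuous_on I \<nu>" "\<And>s. s \<in> I \<Longrightarrow> \<nu> s \<bullet> y' s = 0"
    and generic: "\<nu> 0 \<bullet> cross3 e (cross3 e (y 0)) \<noteq> 0"
  obtains d e2 E z0 where "d > 0" "{-d<..<d} \<subseteq> I" "helicoidal_family k {-d<..<d} U V m h 1 1 e2"
    "E \<bullet> E = 1" "E \<bullet> e = 0"
    "\<And>s. s \<in> {-d<..<d} \<Longrightarrow> y s = (bour_x m h U 1 s * cos (bour_theta k m h U V 1 e2 s t0)) *\<^sub>R E
      + (bour_x m h U 1 s * sin (bour_theta k m h U V 1 e2 s t0)) *\<^sub>R cross3 e E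
      + (bour_z k m h U V e2 s + h * bour_theta k m h U V 1 e2 s t0 + z0) *\<^sub>R e"
proof -
  define P where "P s = y s - (y s \<bullet> e) *\<^sub>R e" for s
  define R where "R s = m\<^sup>2 * (U s)\<^sup>2 - h\<^sup>2" for s
  define \<eta> where "\<eta> s = y' s \<bullet> e" for s
  define g where "g s = m\<^sup>2 * U s * V s" for s
  define rad where "rad s = R s - m ^ 4 * (U s)\<^sup>2 * (V s)\<^sup>2" for s
  have Pe: "P s \<bullet> e = 0" for s by (simp add: P_def inner_diff_left e)
  have cP: "cross3 e (P s) = cross3 e (y s)" for s
    by (simp add: P_def Cross3.right_diff_distrib cross_mult_right)
  have ccP: "cross3 e (cross3 e (P s)) = - P s" for s
    using Pe[of s] e by (simp add: Lagrange inner_commute)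
  have PP: "P s \<bullet> P s = R s" if "s \<in> I" for s
  proof -
    have "cross3 e (y s) \<bullet> cross3 e (y s) = P s \<bullet> P s"
      using norm_cross_dot[of e "P s"] Pe[of s] e
      by (simp add: power_mult_distrib power2_norm_eq_inner cP inner_commute)
    moreover have "(norm (cross3 e (y s) + h *\<^sub>R e))\<^sup>2 = cross3 e (y s) \<bullet> cross3 e (y s) + h\<^sup>2"
      unfolding power2_norm_eq_inner inner_add_left inner_add_right inner_scaleR_left inner_scaleR_right
      using e by (simp add: dot_cross_self power2_eq_square)
    ultimately show ?thesis using g3[OF that] by (simp add: R_def)
  qed
  have dP: "(P has_vector_derivative y' s - \<eta> s *\<^sub>R e) (at s)" if "s \<in> I" for s
  proof -
    have "((\<lambda>s. y s \<bullet> e) has_real_derivative y s \<bullet> 0 + y' s \<bullet> e) (at s)"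
      by (intro has_vector_derivative_inner y(2) that has_vector_derivative_const)
    from has_vector_derivative_diff[OF y(2)[OF that]
      has_vector_derivative_scaleR_real[OF this has_vector_derivative_const[of e]]]
    show ?thesis by (simp add: P_def[abs_def] \<eta>_def)
  qed
  \<comment> \<open>Half the derivative of \<open>\<bar>P\<bar>\<^sup>2\<close>.\<close>
  have yP: "y' s \<bullet> P s = s ^ k * g s" if s: "s \<in> I" for s
  proof -
    have "((\<lambda>s. P s \<bullet> P s) has_real_derivative P s \<bullet> (y' s - \<eta> s *\<^sub>R e) + (y' s - \<eta> s *\<^sub>R e) \<bullet> P s) (at s)"
      by (intro has_vector_derivative_inner dP s)
    then have "(R has_real_derivative P s \<bullet> (y' s - \<eta> s *\<^sub>R e) + (y' s - \<eta> s *\<^sub>R e) \<bullet> P s) (at s)"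
      by (rule has_field_derivative_transform_within_open[OF _ I(1) s]) (simp add: PP)
    moreover have "(R has_real_derivative m\<^sup>2 * (2 * U s * (s ^ k * V s))) (at s)"
      unfolding R_def[abs_def] using V(2)[OF s] by (auto intro!: derivative_eq_intros)
    ultimately have "P s \<bullet> (y' s - \<eta> s *\<^sub>R e) + (y' s - \<eta> s *\<^sub>R e) \<bullet> P s = m\<^sup>2 * (2 * U s * (s ^ k * V s))"
      by (rule DERIV_unique)
    then show ?thesis
      using Pe[of s] by (simp add: inner_diff_left inner_diff_right inner_commute g_def)
  qed
  have yQ: "y' s \<bullet> cross3 e (P s) = - h * \<eta> s" if "s \<in> I" for s
    using g2[OF that] by (simp add: inner_add_right cP \<eta>_def)
  have contU: "continuous_on I U" "continuous_on I V" "continuous_on I y'" "continuous_on I y"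
    using smooth_on_imp_continuous_on U(1) V(1) y(1) has_vector_derivative_continuous[OF y(2)]
    by (auto intro: continuous_at_imp_continuous_on)
  have contP: "continuous_on I P" "continuous_on I R" "continuous_on I g" "continuous_on I rad"
    unfolding P_def[abs_def] rad_def[abs_def] R_def[abs_def] g_def[abs_def]
    by (intro continuous_intros contU)+
  have expand: "R s *\<^sub>R y' s = (R s * \<eta> s) *\<^sub>R e + (s ^ k * g s) *\<^sub>R P s + (- h * \<eta> s) *\<^sub>R cross3 e (P s)"
    if s: "s \<in> I" "R s > 0" for s
  proof -
    have pos: "P s \<bullet> P s > 0" using PP[OF s(1)] s(2) by simp
    note x = cross_frame_expand[OF e Pe[of s] pos, of "y' s",
        unfolded PP[OF s(1)] yP[OF s(1)] yQ[OF s(1)] \<eta>_def[symmetric]]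
    show ?thesis
      by (rule trans[OF arg_cong[OF x, of "(*\<^sub>R) (R s)"]]) (use s(2) in \<open>simp add: scaleR_add_right scaleR_right_diff_distrib\<close>)
  qed
  \<comment> \<open>The length of \<open>y'\<close> computed in the orthogonal frame. Where \<open>P\<close> vanishes there is no frame, but then
    \<open>R\<close>, \<open>s\<^sup>k g\<close> and \<open>h \<eta>\<close> vanish as well.\<close>
  have sq: "(\<eta> s)\<^sup>2 * (m\<^sup>2 * (U s)\<^sup>2) = s ^ (2 * k) * rad s" if s: "s \<in> I" for s
  proof (cases "R s > 0")
    case True
    have "R s *\<^sub>R y' s \<bullet> y' s = R s * (\<eta> s)\<^sup>2 + (s ^ k * g s)\<^sup>2 + (h * \<eta> s)\<^sup>2"
      unfolding expand[OF s True] inner_add_left inner_scaleR_left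
      using yP[OF s] yQ[OF s] by (simp add: inner_commute \<eta>_def power2_eq_square)
    then have "R s * s ^ (2 * k) = (R s + h\<^sup>2) * (\<eta> s)\<^sup>2 + s ^ (2 * k) * (g s)\<^sup>2"
      using g1[OF s] by (simp add: power_mult_distrib algebra_simps power_mult[symmetric])
    moreover have "(\<eta> s)\<^sup>2 * (m\<^sup>2 * (U s)\<^sup>2) = q * rad s"
      if "R s * q = (R s + h\<^sup>2) * (\<eta> s)\<^sup>2 + q * (g s)\<^sup>2" for q
      using that unfolding rad_def R_def g_def by algebra
    ultimately show ?thesis by blast
  next
    case False
    have "P s = 0" using False PP[OF s] inner_gt_zero_iff[of "P s"] by auto
    then have "R s = 0" "s ^ k * g s = 0" "h * \<eta> s = 0"
      using PP[OF s] yP[OF s] yQ[OF s] by auto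
    moreover have "(\<eta> s)\<^sup>2 * (m\<^sup>2 * (U s)\<^sup>2) = q\<^sup>2 * rad s" if "R s = 0" "q * g s = 0" "h * \<eta> s = 0" for q
      using that unfolding rad_def R_def g_def by algebra
    moreover have "s ^ (2 * k) = (s ^ k)\<^sup>2" by (metis mult.commute power_mult)
    ultimately show ?thesis by metis
  qed
  have s\<eta>: "smooth_on I \<eta>"
    unfolding \<eta>_def[abs_def] by (intro smooth_on_inner y(1) smooth_on_const I(1))
  have u: "continuous_on I (\<lambda>s. m\<^sup>2 * (U s)\<^sup>2)" by (intro continuous_intros contU)
  have up: "m\<^sup>2 * (U s)\<^sup>2 > 0" if "s \<in> I" for s using U(2)[OF that] m by simp
  obtain c where c: "smooth_on I c" "\<And>s. s \<in> I \<Longrightarrow> \<eta> s = s ^ k * c s"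
    "\<And>s. s \<in> I \<Longrightarrow> (c s)\<^sup>2 * (m\<^sup>2 * (U s)\<^sup>2) = rad s"
    by (rule smooth_square_divide[OF I s\<eta> u up contP(4) sq]) (assumption | rule that)+
  have contc: "continuous_on I c" by (rule smooth_on_imp_continuous_on[OF c(1)])
  have nP: "\<nu> 0 \<bullet> P 0 \<noteq> 0"
    using generic unfolding cP[symmetric] ccP by simp
  then have "P 0 \<noteq> 0" by auto
  then have R0: "R 0 > 0" using PP[OF I(3)] inner_gt_zero_iff[of "P 0"] by auto
  \<comment> \<open>If \<open>c(0) = 0\<close>, then \<open>R y' / s\<^sup>k\<close> tends to \<open>g(0) P(0)\<close>. It is orthogonal to \<open>\<nu>\<close> while \<open>P(0)\<close> is not, so
    \<open>V(0) = 0\<close>; but then \<open>0 = m\<^sup>2 U\<^sup>2 c\<^sup>2 = R\<close> at \<open>0\<close>, where \<open>R\<close> is positive.\<close>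
  have c0: "c 0 \<noteq> 0"
  proof
    assume c0: "c 0 = 0"
    obtain d where d: "d > 0" "{-d<..<d} \<subseteq> I" "\<And>s. s \<in> {-d<..<d} \<Longrightarrow> R s > 0"
      by (rule open_pos_interval[OF I(1,3) contP(2) R0 contP(2) R0]) (rule that)
    let ?b = "\<lambda>s. R s * c s * (\<nu> s \<bullet> e) + g s * (\<nu> s \<bullet> P s) - h * c s * (\<nu> s \<bullet> cross3 e (P s))"
    have b0: "?b s = 0" if s: "s \<in> {-d<..<d}" "s \<noteq> 0" for s
    proof -
      have s': "s \<in> I" using s d(2) by auto
      have "0 = \<nu> s \<bullet> R s *\<^sub>R y' s" using nu(2)[OF s'] by simp
      also have "\<dots> = s ^ k * ?b s"
        unfolding expand[OF s' d(3)[OF s(1)]] c(2)[OF s'] inner_add_right inner_scaleR_right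
        by (simp add: algebra_simps)
      finally show ?thesis using s(2) by simp
    qed
    have "continuous_on {-d<..<d} ?b"
      using nu(1) contc contP d(2)
      by (intro continuous_intros continuous_on_cross) (auto intro: continuous_on_subset)
    from continuous_zero_extend[OF _ _ this b0] d(1) have "?b 0 = 0" by auto
    then have "g 0 = 0" using c0 nP by simp
    then have "V 0 = 0" using U(2)[OF I(3)] m by (auto simp: g_def)
    then have "rad 0 = R 0" by (simp add: rad_def)
    then show False using c(3)[OF I(3)] c0 R0 by simp
  qed
  define e2 where "e2 = sgn (c 0)"
  have e2: "e2 \<in> {1, -1}" "e2 * c 0 > 0" "e2 * e2 = 1" using c0 by (auto simp: e2_def sgn_if)
  obtain d where d: "d > 0" "{-d<..<d} \<subseteq> I" "\<And>s. s \<in> {-d<..<d} \<Longrightarrow> R s > 0"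
    "\<And>s. s \<in> {-d<..<d} \<Longrightarrow> e2 * c s > 0"
    by (rule open_pos_interval[OF I(1,3) contP(2) R0 continuous_on_mult_left[OF contc] e2(2)]) (rule that)
  define J where "J = {-d<..<d}"
  have J: "open J" "is_interval J" "0 \<in> J" "J \<subseteq> I" using d by (auto simp: J_def is_interval_1)
  note d = d[folded J_def]
  have \<rho>: "bour_rho m h U V s = m * U s * (e2 * c s)" if s: "s \<in> J" for s
  proof -
    have s': "s \<in> I" using s J(4) by auto
    have "m\<^sup>2 * (U s)\<^sup>2 - h\<^sup>2 - m ^ 4 * (U s)\<^sup>2 * (V s)\<^sup>2 = (m * U s * (e2 * c s))\<^sup>2"
      using c(3)[OF s'] e2(3) unfolding rad_def R_def by algebra
    moreover have "m * U s * (e2 * c s) \<ge> 0" using m U(2)[OF s'] d(4)[OF s] by simp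
    ultimately show ?thesis by (simp add: bour_rho_def)
  qed
  have "star_condition J U V h m"
    unfolding star_condition_def
  proof (intro conjI ballI)
    show "m\<^sup>2 * (U s)\<^sup>2 - h\<^sup>2 - m ^ 4 * (U s)\<^sup>2 * (V s)\<^sup>2 \<ge> 0" if "s \<in> J" for s
    proof -
      have "rad s \<ge> 0" using c(3)[of s] that J(4) by (metis subsetD zero_le_mult_iff zero_le_power2)
      then show ?thesis by (simp add: rad_def R_def)
    qed
    have "smooth_on J (\<lambda>s. m * U s * (e2 * c s))"
      by (intro smooth_on_mult smooth_on_const smooth_on_subset[OF c(1) J(4)] smooth_on_subset[OF U(1) J(4)] J(1))
    then show "smooth_on J (bour_rho m h U V)"
      by (rule smooth_on_cong[OF J(1), THEN iffD2, rotated]) (rule \<rho>)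
    show "bour_rho m h U V 0 \<noteq> 0" using \<rho>[OF J(3)] m U(2)[OF I(3)] e2(2) by auto
  qed
  moreover have "bour_defined J U h m" using d(3) by (force simp: bour_defined_def R_def)
  ultimately have fam: "helicoidal_family k J U V m h 1 1 e2"
    using k J m e2(1) smooth_on_subset[OF U(1) J(4)] smooth_on_subset[OF V(1) J(4)] U(2) V(2)
    by unfold_locales auto
  interpret B: helicoidal_family k J U V m h 1 1 e2 by (rule fam)
  define th where "th s = B.\<theta> (s, t0)" for s
  have BR: "B.R s = R s" for s by (simp add: B.R_def R_def)
  have xR: "(B.x s)\<^sup>2 = R s" "B.x s > 0" if "s \<in> J" for s
    using B.x_sq[OF that] d(3)[OF that] by (auto simp: BR B.x_def bour_x_def R_def)
  have dth: "(th has_real_derivative s ^ k * B.b s) (at s)" if "s \<in> J" for s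
  proof -
    have "(th has_real_derivative 1 / m * (0 - e2 * h * (s ^ k * B.\<rho> s / (U s * B.R s)))) (at s)"
      unfolding th_def[abs_def] B.\<theta>_eq fst_conv snd_conv
      by (intro DERIV_cmult DERIV_diff DERIV_const B.turn_deriv that)
    moreover have "1 / m * (0 - e2 * h * (s ^ k * B.\<rho> s / (U s * B.R s))) = s ^ k * B.b s"
      by (simp add: B.b_def mult_ac)
    ultimately show ?thesis by (simp only:)
  qed
  have \<rho>': "B.\<rho> s = m * U s * (e2 * c s)" if "s \<in> J" for s using \<rho>[OF that] by (simp add: B.\<rho>_def)
  have b: "B.b s = - h * c s / R s" if "s \<in> J" for s
  proof -
    have "- e2 * h * (m * U s * (e2 * c s)) = (- h * c s) * (m * U s)" using e2(3) by algebra
    then show ?thesis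
      using B.U_nz[OF that] m unfolding B.b_def \<rho>'[OF that] BR by simp
  qed
  have cc: "B.c s + h * B.b s = c s" if "s \<in> J" for s
  proof -
    have "e2 * m * U s * (m * U s * (e2 * c s)) = m\<^sup>2 * (U s)\<^sup>2 * c s" using e2(3) by algebra
    then have "B.c s = m\<^sup>2 * (U s)\<^sup>2 * c s / R s" unfolding B.c_def \<rho>'[OF that] BR by simp
    then have "B.c s + h * B.b s = (m\<^sup>2 * (U s)\<^sup>2 * c s - h\<^sup>2 * c s) / R s"
      unfolding b[OF that] by (simp add: diff_divide_distrib power2_eq_square)
    also have "m\<^sup>2 * (U s)\<^sup>2 * c s - h\<^sup>2 * c s = c s * R s" by (simp add: R_def algebra_simps)
    finally show ?thesis using d(3)[OF that] by simp
  qed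
  have dPJ: "(P has_vector_derivative (s ^ k * B.a s / B.x s) *\<^sub>R P s + (s ^ k * B.b s) *\<^sub>R cross3 e (P s)) (at s)"
    if s: "s \<in> J" for s
  proof -
    have s': "s \<in> I" using s J(4) by auto
    have "y' s - \<eta> s *\<^sub>R e = (y' s \<bullet> P s / R s) *\<^sub>R P s + (y' s \<bullet> cross3 e (P s) / R s) *\<^sub>R cross3 e (P s)"
      using cross_frame_expand[OF e Pe[of s], of "y' s"] d(3)[OF s] unfolding PP[OF s'] \<eta>_def
      by (simp add: algebra_simps)
    moreover have "y' s \<bullet> P s / R s = s ^ k * B.a s / B.x s"
      unfolding yP[OF s'] B.a_def g_def xR(1)[OF s, symmetric] by (simp add: power2_eq_square)
    moreover have "y' s \<bullet> cross3 e (P s) / R s = s ^ k * B.b s"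
      unfolding yQ[OF s'] c(2)[OF s'] b[OF s] by simp
    ultimately show ?thesis using dP[OF s'] by simp
  qed
  \<comment> \<open>\<open>P\<close> rotated back by the angle \<open>th\<close>, and then normalised, is the constant vector \<open>E\<close>.\<close>
  define N where "N s = cos (th s) *\<^sub>R P s + (- sin (th s)) *\<^sub>R cross3 e (P s)" for s
  have dN: "(N has_vector_derivative (s ^ k * B.a s / B.x s) *\<^sub>R N s) (at s)" if s: "s \<in> J" for s
  proof -
    let ?al = "s ^ k * B.a s / B.x s" and ?be = "s ^ k * B.b s"
    have "(N has_vector_derivative
       (cos (th s) *\<^sub>R (?al *\<^sub>R P s + ?be *\<^sub>R cross3 e (P s)) + (- sin (th s) * ?be) *\<^sub>R P s)
       + ((- sin (th s)) *\<^sub>R cross3 e (?al *\<^sub>R P s + ?be *\<^sub>R cross3 e (P s))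
           + (- (cos (th s) * ?be)) *\<^sub>R cross3 e (P s))) (at s)"
      unfolding N_def[abs_def]
      by (intro has_vector_derivative_add has_vector_derivative_scaleR_real has_vector_derivative_cross
          dPJ s DERIV_minus DERIV_chain2[OF DERIV_sin] DERIV_chain2[OF DERIV_cos] dth)
    moreover have "(cos (th s) *\<^sub>R (?al *\<^sub>R P s + ?be *\<^sub>R cross3 e (P s)) + (- sin (th s) * ?be) *\<^sub>R P s)
       + ((- sin (th s)) *\<^sub>R cross3 e (?al *\<^sub>R P s + ?be *\<^sub>R cross3 e (P s))
           + (- (cos (th s) * ?be)) *\<^sub>R cross3 e (P s)) = ?al *\<^sub>R N s"
      unfolding cross_add_right cross_mult_right ccP N_def by (simp add: algebra_simps)
    ultimately show ?thesis by (simp only:)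
  qed
  define E where "E s = inverse (B.x s) *\<^sub>R N s" for s
  have dE: "(E has_vector_derivative 0) (at s)" if s: "s \<in> J" for s
  proof -
    have "((\<lambda>s. inverse (B.x s)) has_real_derivative - (inverse (B.x s) * (s ^ k * B.a s) * inverse (B.x s))) (at s)"
      by (rule DERIV_inverse'[OF B.x_deriv[OF s] B.x_nz[OF s]])
    from has_vector_derivative_scaleR_real[OF this dN[OF s]]
    show ?thesis by (simp add: E_def[abs_def] divide_inverse mult_ac)
  qed
  have convJ: "convex J" using J(2) is_interval_convex by blast
  have E: "E s = E 0" if "s \<in> J" for s
  proof -
    obtain C where "\<And>s. s \<in> J \<Longrightarrow> E s = C"
      using has_vector_derivative_zero_constant[OF convJ has_vector_derivative_at_within[OF dE]] by blast
    then show ?thesis using that J(3) by simp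
  qed
  define H where "H s = y s \<bullet> e - (B.z s + h * th s)" for s
  have H: "H s = H 0" if "s \<in> J" for s
  proof -
    have dH: "(H has_vector_derivative 0) (at s)" if s: "s \<in> J" for s
    proof -
      have s': "s \<in> I" using s J(4) by auto
      have "((\<lambda>s. y s \<bullet> e) has_real_derivative y s \<bullet> 0 + y' s \<bullet> e) (at s)"
        by (intro has_vector_derivative_inner y(2) s' has_vector_derivative_const)
      from DERIV_diff[OF this DERIV_add[OF B.z_deriv[OF s] DERIV_cmult[OF dth[OF s], of h]]]
      have "(H has_real_derivative y s \<bullet> 0 + y' s \<bullet> e - (s ^ k * B.c s + h * (s ^ k * B.b s))) (at s)"
        by (simp add: H_def[abs_def])
      moreover have "y s \<bullet> 0 + y' s \<bullet> e - (s ^ k * B.c s + h * (s ^ k * B.b s)) = 0"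
        using c(2)[OF s'] unfolding \<eta>_def cc[OF s, symmetric] by (simp add: algebra_simps)
      ultimately show ?thesis by (simp only: has_real_derivative_iff_has_vector_derivative)
    qed
    obtain C where "\<And>s. s \<in> J \<Longrightarrow> H s = C"
      using has_vector_derivative_zero_constant[OF convJ has_vector_derivative_at_within[OF dH]] by blast
    then show ?thesis using that J(3) by simp
  qed
  have Ne: "N s \<bullet> e = 0" for s
    by (simp add: N_def inner_add_left inner_diff_left Pe dot_cross_self)
  have NN: "N s \<bullet> N s = R s" if s: "s \<in> J" for s
  proof -
    have s': "s \<in> I" using s J(4) by auto
    have n: "cross3 e (P s) \<bullet> cross3 e (P s) = R s"
      using norm_cross_dot[of e "P s"] Pe[of s] e PP[OF s']
      by (simp add: power_mult_distrib power2_norm_eq_inner inner_commute)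
    have "N s \<bullet> N s = (cos (th s))\<^sup>2 * R s + (sin (th s))\<^sup>2 * R s"
      unfolding N_def inner_add_left inner_add_right inner_scaleR_left inner_scaleR_right n PP[OF s']
      by (simp add: dot_cross_self inner_commute power2_eq_square)
    then show ?thesis by (simp flip: distrib_right)
  qed
  have P: "P s = (B.x s * cos (th s)) *\<^sub>R E 0 + (B.x s * sin (th s)) *\<^sub>R cross3 e (E 0)" if s: "s \<in> J" for s
  proof -
    have "B.x s *\<^sub>R E s = N s" using B.x_nz[OF s] by (simp add: E_def)
    then have xE: "B.x s *\<^sub>R E 0 = N s" by (simp only: E[OF s])
    have "(B.x s * cos (th s)) *\<^sub>R E 0 + (B.x s * sin (th s)) *\<^sub>R cross3 e (E 0)
        = cos (th s) *\<^sub>R (B.x s *\<^sub>R E 0) + sin (th s) *\<^sub>R cross3 e (B.x s *\<^sub>R E 0)"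
      by (simp add: cross_mult_right mult_ac)
    also have "\<dots> = (cos (th s))\<^sup>2 *\<^sub>R P s + (sin (th s))\<^sup>2 *\<^sub>R P s"
      unfolding xE N_def cross_add_right cross_mult_right ccP by (simp add: algebra_simps power2_eq_square)
    also have "\<dots> = P s" by (simp flip: scaleR_add_left)
    finally show ?thesis by simp
  qed
  show ?thesis
  proof (rule that[of d e2 "E 0" "H 0"], goal_cases)
    case 1 then show ?case by (rule d(1))
  next
    case 2 then show ?case using d(2) by (simp only: J_def)
  next
    case 3 then show ?case using fam by (simp only: J_def)
  next
    case 4 then show ?case
      using NN[OF J(3)] xR[OF J(3)] d(3)[OF J(3)] by (simp add: E_def power2_eq_square divide_simps)
  next
    case 5 then show ?case by (simp add: E_def Ne)
  next
    case (6 s)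
    then have s: "s \<in> J" by (simp only: J_def)
    have "y s = P s + (y s \<bullet> e) *\<^sub>R e" by (simp add: P_def)
    also have "y s \<bullet> e = B.z s + h * th s + H 0" using H[OF s] by (simp add: H_def)
    finally show ?case unfolding P[OF s] B.x_def B.z_def th_def B.\<theta>_def by simp
  qed
qed

section \<open>Killing fields of the edge metric\<close>

text \<open>Euler's equation makes \<open>A\<close> homogeneous of degree \<open>k\<close>: scaling by \<open>r\<close> towards the origin multiplies \<open>A\<close> by
  \<open>r\<^sup>k\<close>, but its bound by \<open>r\<^bsup>2k\<^esup>\<close>.\<close>

lemma homogeneous_flat_zero:
  fixes A A' :: "real \<Rightarrow> real"
  assumes k: "k > 0" and A: "\<And>s. \<bar>s\<bar> < d \<Longrightarrow> (A has_real_derivative A' s) (at s)"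
    "\<And>s. \<bar>s\<bar> < d \<Longrightarrow> s * A' s = real k * A s"
    and B: "\<And>s. \<bar>s\<bar> < d \<Longrightarrow> \<bar>A s\<bar> \<le> B * s ^ (2 * k)" and s: "\<bar>s\<bar> < d"
  shows "A s = 0"
proof -
  have rs: "\<bar>r * s\<bar> < d" if "0 < r" "r \<le> 1" for r
    using that s mult_left_le_one_le[of "\<bar>s\<bar>" r] by (auto simp: abs_mult)
  have eq: "A (r * s) = r ^ k * A s" if r: "0 < r" "r \<le> 1" for r
  proof -
    have "((\<lambda>r. A (r * s) / r ^ k) has_real_derivative 0) (at q)" if q: "r \<le> q" "q \<le> 1" for q
    proof -
      have q0: "q > 0" using q r by simp
      obtain j where j: "k = Suc j" using k gr0_implies_Suc by blast
      have "((\<lambda>r. r * s) has_real_derivative s) (at q)" by (auto intro!: derivative_eq_intros)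
      from DERIV_chain2[where f = A and g = "\<lambda>r. r * s", OF A(1)[OF rs[OF q0 q(2)]] this]
      have "((\<lambda>r. A (r * s)) has_real_derivative A' (q * s) * s) (at q)" .
      from DERIV_divide[OF this DERIV_pow[of k q UNIV]] q0
      have "((\<lambda>r. A (r * s) / r ^ k) has_real_derivative
          (A' (q * s) * s * q ^ k - A (q * s) * (real k * q ^ (k - 1))) / (q ^ k * q ^ k)) (at q)"
        by simp
      moreover have "A' (q * s) * s * q ^ k - A (q * s) * (real k * q ^ (k - 1))
          = q ^ j * ((q * s) * A' (q * s) - real k * A (q * s))"
        unfolding j by (simp add: algebra_simps)
      ultimately show ?thesis using A(2)[OF rs[OF q0 q(2)]] by simp
    qed
    then have "\<exists>C. \<forall>q\<in>{r..1}. A (q * s) / q ^ k = C"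
      by (intro has_field_derivative_zero_constant) (auto intro: has_field_derivative_at_within)
    then obtain C where C: "\<And>q. q \<in> {r..1} \<Longrightarrow> A (q * s) / q ^ k = C" by blast
    show ?thesis using C[of 1] C[of r] r by (simp add: field_simps)
  qed
  have "\<bar>A s\<bar> \<le> r ^ k * (B * s ^ (2 * k))" if r: "0 < r" "r \<le> 1" for r
  proof -
    have "r ^ k * \<bar>A s\<bar> = \<bar>A (r * s)\<bar>" using eq[OF r] r by (simp add: abs_mult)
    also have "\<dots> \<le> B * (r * s) ^ (2 * k)" by (rule B[OF rs[OF r]])
    also have "\<dots> = r ^ k * (r ^ k * (B * s ^ (2 * k)))"
      by (simp add: power_mult_distrib mult_2 power_add)
    finally show ?thesis using r by simp
  qed
  moreover have "r ^ k * (B * s ^ (2 * k)) \<le> r * (B * s ^ (2 * k))" if r: "0 < r" "r \<le> 1" for r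
  proof (rule mult_right_mono)
    show "r ^ k \<le> r" using power_le_imp_le_exp power_decreasing[of 1 k r] k r by simp
    show "0 \<le> B * s ^ (2 * k)" using B[OF s] by linarith
  qed
  ultimately have le: "\<bar>A s\<bar> \<le> r * (B * s ^ (2 * k))" if "0 < r" "r \<le> 1" for r
    using that order_trans by blast
  have "\<bar>A s\<bar> \<le> 0"
  proof (rule field_le_epsilon)
    fix \<epsilon> :: real assume \<epsilon>: "\<epsilon> > 0"
    define C where "C = B * s ^ (2 * k)"
    have C: "C \<ge> 0" using B[OF s] by (simp add: C_def)
    define r where "r = min 1 (\<epsilon> / (C + 1))"
    have r: "0 < r" "r \<le> 1" using \<epsilon> C by (auto simp: r_def)
    have "r * C \<le> \<epsilon> / (C + 1) * C" using C by (intro mult_right_mono) (auto simp: r_def)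
    also have "\<dots> \<le> \<epsilon>" using C \<epsilon> by (simp add: field_simps)
    finally show "\<bar>A s\<bar> \<le> 0 + \<epsilon>" using le[OF r] by (simp add: C_def)
  qed
  then show ?thesis by simp
qed

text \<open>A velocity field of isometries. The map \<open>L = K - K(0)\<close> satisfies \<open>L a \<bullet> b = - L b \<bullet> a\<close>, so its components at
  \<open>b\<close> are inner products of \<open>b\<close> with its values on the basis; linearity is a consequence.\<close>

lemma skew_field_is_cross:
  fixes K :: "real^3 \<Rightarrow> real^3"
  assumes "\<And>a b. (K a - K b) \<bullet> (a - b) = 0"
  obtains w where "\<And>a. K a = cross3 w a + K 0"
proof -
  define L where "L a = K a - K 0" for a
  have self: "L a \<bullet> a = 0" for a using assms[of a 0] by (simp add: L_def)
  have skew: "L a \<bullet> b = - (L b \<bullet> a)" for a b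
  proof -
    have "(L a - L b) \<bullet> (a - b) = 0" using assms[of a b] by (simp add: L_def)
    then show ?thesis using self[of a] self[of b] by (simp add: inner_diff_left inner_diff_right)
  qed
  define a where "a i = L (axis i 1)" for i
  have comp: "L b $ i = - (a i \<bullet> b)" for b i
    using skew[of b "axis i 1"] by (simp add: inner_axis a_def)
  have sk: "a i $ j = - (a j $ i)" for i j
    using skew[of "axis i 1" "axis j 1"] by (simp add: inner_axis a_def)
  have d: "a i $ i = 0" for i using sk[of i i] by simp
  have Lw: "L b = cross3 (vector [a 2 $ 3, a 3 $ 1, a 1 $ 2]) b" for b
    unfolding vec_eq_iff forall_3 comp inner_vec_def sum_3 cross3_def vector_3
    using sk[of 2 1] sk[of 3 2] sk[of 1 3] d by (simp add: algebra_simps)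
  show ?thesis
    by (rule that) (rule Lw[unfolded L_def diff_eq_eq])
qed

text \<open>Write \<open>\<alpha> F\<^sub>s + \<beta> F\<^sub>t\<close> for the field. The \<open>ss\<close>-component of Killing's equation says that \<open>A = s\<^bsup>2k\<^esup> \<alpha>\<close> is
  homogeneous of degree \<open>k\<close> in \<open>s\<close>, which with a bound on \<open>\<alpha>\<close> is possible only for \<open>\<alpha> = 0\<close>. The remaining
  components then say that \<open>\<beta>\<close> is constant. Only a pointwise bound on \<open>\<alpha>\<close> enters, because \<open>A\<close> and \<open>\<beta> U\<^sup>2\<close>
  are inner products of smooth fields.\<close>

lemma killing_field_is_translation:
  fixes F :: "real \<times> real \<Rightarrow> real^3" and U U' :: "real \<Rightarrow> real" and w w0 :: "real^3"
  assumes k: "k > 0" and d: "d > 0"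
    and \<Omega>: "open \<Omega>" "{-d<..<d} \<times> {t0 - d<..<t0 + d} \<subseteq> \<Omega>" and F: "smooth_on \<Omega> F"
    and U: "\<And>s. \<bar>s\<bar> < d \<Longrightarrow> U s > 0" "\<And>s. \<bar>s\<bar> < d \<Longrightarrow> (U has_real_derivative U' s) (at s)"
    and g11: "\<And>x. x \<in> \<Omega> \<Longrightarrow> partial_u F x \<bullet> partial_u F x = fst x ^ (2 * k)"
    and g12: "\<And>x. x \<in> \<Omega> \<Longrightarrow> partial_u F x \<bullet> partial_v F x = 0"
    and g22: "\<And>x. x \<in> \<Omega> \<Longrightarrow> partial_v F x \<bullet> partial_v F x = (U (fst x))\<^sup>2"
    and K: "\<And>x. x \<in> {-d<..<d} \<times> {t0 - d<..<t0 + d} \<Longrightarrow>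
      \<exists>\<alpha> \<beta>. cross3 w (F x) + w0 = \<alpha> *\<^sub>R partial_u F x + \<beta> *\<^sub>R partial_v F x \<and> \<bar>\<alpha>\<bar> \<le> B"
  obtains \<beta> where "\<And>s t. \<bar>s\<bar> < d \<Longrightarrow> \<bar>t - t0\<bar> < d \<Longrightarrow> cross3 w (F (s, t)) + w0 = \<beta> *\<^sub>R partial_v F (s, t)"
proof -
  define KF where "KF x = cross3 w (F x) + w0" for x
  let ?s = "partial_u F" and ?t = "partial_v F"
  have in\<Omega>: "(s, t) \<in> \<Omega>" if "\<bar>s\<bar> < d" "\<bar>t - t0\<bar> < d" for s t
    using \<Omega>(2) that by (auto simp: abs_less_iff subset_iff)
  note smu = smooth_on_partial(1)[OF F] and smv = smooth_on_partial(2)[OF F]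
  note D = partial_has_vector_derivative[OF smooth_on_differentiable[OF F]]
    and Du = partial_has_vector_derivative[OF smooth_on_differentiable[OF smu]]
    and Dv = partial_has_vector_derivative[OF smooth_on_differentiable[OF smv]]
  have comm: "partial_u ?t x = partial_v ?s x" if "x \<in> \<Omega>" for x
    by (rule mixed_partials_commute[OF \<Omega>(1) F that])
  have near_s: "eventually (\<lambda>s. (s, t) \<in> \<Omega>) (nhds s)" and near_t: "eventually (\<lambda>t. (s, t) \<in> \<Omega>) (nhds t)"
    if "(s, t) \<in> \<Omega>" for s t
  proof -
    have "open ((\<lambda>s. (s, t)) -` \<Omega>)" "open ((\<lambda>t. (s, t)) -` \<Omega>)"
      by (intro open_vimage \<Omega>(1) continuous_intros)+
    then show "eventually (\<lambda>s. (s, t) \<in> \<Omega>) (nhds s)" "eventually (\<lambda>t. (s, t) \<in> \<Omega>) (nhds t)"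
      using eventually_nhds_in_open[of "(\<lambda>s. (s, t)) -` \<Omega>" s]
        eventually_nhds_in_open[of "(\<lambda>t. (s, t)) -` \<Omega>" t] that by simp_all
  qed
  \<comment> \<open>The Christoffel symbols, by differentiating the three coefficients of the metric.\<close>
  have uu_u: "partial_u ?s (s, t) \<bullet> ?s (s, t) = real k * s ^ (2 * k - 1)"
    and vu_u: "partial_v ?s (s, t) \<bullet> ?s (s, t) = 0"
    and uu_v: "partial_u ?s (s, t) \<bullet> ?t (s, t) = 0"
    and uv_v: "partial_v ?s (s, t) \<bullet> ?t (s, t) = U s * U' s"
    and vv_v: "partial_v ?t (s, t) \<bullet> ?t (s, t) = 0" if x: "(s, t) \<in> \<Omega>" "\<bar>s\<bar> < d" for s t
  proof -
    have "((\<lambda>s. s ^ (2 * k)) has_real_derivative ?s (s, t) \<bullet> partial_u ?s (s, t) + partial_u ?s (s, t) \<bullet> ?s (s, t)) (at s)"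
      by (rule DERIV_cong_ev[THEN iffD1, OF refl _ refl has_vector_derivative_inner[OF Du(1)[OF x(1)] Du(1)[OF x(1)]]])
         (use near_s[OF x(1)] in eventually_elim, simp add: g11)
    from DERIV_unique[OF this DERIV_pow] show "partial_u ?s (s, t) \<bullet> ?s (s, t) = real k * s ^ (2 * k - 1)"
      by (simp add: inner_commute)
    have "((\<lambda>t. s ^ (2 * k)) has_real_derivative ?s (s, t) \<bullet> partial_v ?s (s, t) + partial_v ?s (s, t) \<bullet> ?s (s, t)) (at t)"
      by (rule DERIV_cong_ev[THEN iffD1, OF refl _ refl has_vector_derivative_inner[OF Du(2)[OF x(1)] Du(2)[OF x(1)]]])
         (use near_t[OF x(1)] in eventually_elim, simp add: g11)
    from DERIV_unique[OF this DERIV_const] show vu: "partial_v ?s (s, t) \<bullet> ?s (s, t) = 0"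
      by (simp add: inner_commute)
    have "((\<lambda>s. 0) has_real_derivative ?s (s, t) \<bullet> partial_u ?t (s, t) + partial_u ?s (s, t) \<bullet> ?t (s, t)) (at s)"
      by (rule DERIV_cong_ev[THEN iffD1, OF refl _ refl has_vector_derivative_inner[OF Du(1)[OF x(1)] Dv(1)[OF x(1)]]])
         (use near_s[OF x(1)] in eventually_elim, simp add: g12)
    from DERIV_unique[OF this DERIV_const] show "partial_u ?s (s, t) \<bullet> ?t (s, t) = 0"
      using vu comm[OF x(1)] by (simp add: inner_commute)
    have "((\<lambda>s. (U s)\<^sup>2) has_real_derivative ?t (s, t) \<bullet> partial_u ?t (s, t) + partial_u ?t (s, t) \<bullet> ?t (s, t)) (at s)"
      by (rule DERIV_cong_ev[THEN iffD1, OF refl _ refl has_vector_derivative_inner[OF Dv(1)[OF x(1)] Dv(1)[OF x(1)]]])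
         (use near_s[OF x(1)] in eventually_elim, simp add: g22)
    moreover have "((\<lambda>s. (U s)\<^sup>2) has_real_derivative 2 * (U s * U' s)) (at s)"
      using U(2)[OF x(2)] by (auto intro!: derivative_eq_intros)
    ultimately have "?t (s, t) \<bullet> partial_u ?t (s, t) + partial_u ?t (s, t) \<bullet> ?t (s, t) = 2 * (U s * U' s)"
      by (rule DERIV_unique)
    then show "partial_v ?s (s, t) \<bullet> ?t (s, t) = U s * U' s"
      using comm[OF x(1)] by (simp add: inner_commute)
    have "((\<lambda>t. (U s)\<^sup>2) has_real_derivative ?t (s, t) \<bullet> partial_v ?t (s, t) + partial_v ?t (s, t) \<bullet> ?t (s, t)) (at t)"
      by (rule DERIV_cong_ev[THEN iffD1, OF refl _ refl has_vector_derivative_inner[OF Dv(2)[OF x(1)] Dv(2)[OF x(1)]]])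
         (use near_t[OF x(1)] in eventually_elim, simp add: g22)
    from DERIV_unique[OF this DERIV_const] show "partial_v ?t (s, t) \<bullet> ?t (s, t) = 0"
      by (simp add: inner_commute)
  qed
  have dKs: "((\<lambda>s. KF (s, t)) has_vector_derivative cross3 w (?s (s, t))) (at s)"
    and dKt: "((\<lambda>t. KF (s, t)) has_vector_derivative cross3 w (?t (s, t))) (at t)" if "(s, t) \<in> \<Omega>" for s t
    unfolding KF_def
    using has_vector_derivative_add[OF has_vector_derivative_cross[OF D(1)[OF that], of w] has_vector_derivative_const[of w0]]
      has_vector_derivative_add[OF has_vector_derivative_cross[OF D(2)[OF that], of w] has_vector_derivative_const[of w0]]
    by simp_all
  have self: "a \<bullet> cross3 w a = 0" for a by (simp add: dot_cross_self)
  have A0: "?s (s, t) \<bullet> KF (s, t) = 0" if st: "\<bar>s\<bar> < d" "\<bar>t - t0\<bar> < d" for s t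
  proof -
    have co: "\<exists>\<alpha> \<beta>. KF (r, t) = \<alpha> *\<^sub>R ?s (r, t) + \<beta> *\<^sub>R ?t (r, t) \<and> \<bar>\<alpha>\<bar> \<le> B" if "\<bar>r\<bar> < d" for r
      using K[of "(r, t)"] that st(2) by (auto simp: KF_def abs_less_iff)
    have A: "?s (r, t) \<bullet> KF (r, t) = \<alpha> * r ^ (2 * k)"
      if "\<bar>r\<bar> < d" "KF (r, t) = \<alpha> *\<^sub>R ?s (r, t) + \<beta> *\<^sub>R ?t (r, t)" for r \<alpha> \<beta>
      using g11[OF in\<Omega>[OF that(1) st(2)]] g12[OF in\<Omega>[OF that(1) st(2)]] unfolding that(2)
      by (simp add: inner_add_right)
    \<comment> \<open>The inner product of \<open>F\<^sub>s\<close> with the derivative \<open>w \<times> F\<^sub>s\<close> of the field is zero, so the derivative of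
      \<open>A\<close> involves second derivatives of \<open>F\<close> only.\<close>
    show ?thesis
    proof (rule homogeneous_flat_zero[OF k, where A = "\<lambda>s. ?s (s, t) \<bullet> KF (s, t)" and d = d and B = B
        and A' = "\<lambda>s. partial_u ?s (s, t) \<bullet> KF (s, t)"])
      fix r assume r: "\<bar>r\<bar> < d"
      have x: "(r, t) \<in> \<Omega>" by (rule in\<Omega>[OF r st(2)])
      show "((\<lambda>s. ?s (s, t) \<bullet> KF (s, t)) has_real_derivative partial_u ?s (r, t) \<bullet> KF (r, t)) (at r)"
        using has_vector_derivative_inner[OF Du(1)[OF x] dKs[OF x]] self by simp
      obtain \<alpha> \<beta> where ab: "KF (r, t) = \<alpha> *\<^sub>R ?s (r, t) + \<beta> *\<^sub>R ?t (r, t)" "\<bar>\<alpha>\<bar> \<le> B" using co[OF r] by blast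
      have "partial_u ?s (r, t) \<bullet> KF (r, t) = \<alpha> * (real k * r ^ (2 * k - 1))"
        using uu_u[OF x r] uu_v[OF x r] unfolding ab(1) by (simp add: inner_add_right)
      moreover have "r * r ^ (2 * k - 1) = r ^ (2 * k)"
        using k by (metis power_Suc Suc_pred' nat_0_less_mult_iff zero_less_numeral)
      ultimately show "r * (partial_u ?s (r, t) \<bullet> KF (r, t)) = real k * (?s (r, t) \<bullet> KF (r, t))"
        unfolding A[OF r ab(1)] by (simp add: mult_ac)
      show "\<bar>?s (r, t) \<bullet> KF (r, t)\<bar> \<le> B * r ^ (2 * k)"
        unfolding A[OF r ab(1)] abs_mult using ab(2) by (simp add: mult_right_mono power_mult)
    qed (rule st(1))
  qed
  have tang: "KF (s, t) = ((KF (s, t) \<bullet> ?t (s, t)) / (U s)\<^sup>2) *\<^sub>R ?t (s, t)" if st: "\<bar>s\<bar> < d" "\<bar>t - t0\<bar> < d" for s t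
  proof -
    have x: "(s, t) \<in> \<Omega>" by (rule in\<Omega>[OF st])
    obtain \<alpha> \<beta> where ab: "KF (s, t) = \<alpha> *\<^sub>R ?s (s, t) + \<beta> *\<^sub>R ?t (s, t)"
      using K[of "(s, t)"] st by (auto simp: KF_def abs_less_iff)
    have "\<alpha> * s ^ (2 * k) = 0"
      using A0[OF st] g11[OF x] g12[OF x] unfolding ab by (simp add: inner_add_right)
    moreover have "?s (s, t) = 0" if "s = 0"
    proof -
      have "?s (s, t) \<bullet> ?s (s, t) = 0" using g11[OF x] k that by (simp add: power_0_left)
      then show ?thesis by simp
    qed
    ultimately have "\<alpha> *\<^sub>R ?s (s, t) = 0" by (cases "s = 0") auto
    then have *: "KF (s, t) = \<beta> *\<^sub>R ?t (s, t)" using ab by simp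
    then have "KF (s, t) \<bullet> ?t (s, t) = \<beta> * (U s)\<^sup>2" using g22[OF x] by simp
    then have "\<beta> = (KF (s, t) \<bullet> ?t (s, t)) / (U s)\<^sup>2" using U(1)[OF st(1)] by simp
    with * show ?thesis by simp
  qed
  define \<beta> where "\<beta> s t = (KF (s, t) \<bullet> ?t (s, t)) / (U s)\<^sup>2" for s t
  have ds: "((\<lambda>s. \<beta> s t) has_real_derivative 0) (at s)" if st: "\<bar>s\<bar> < d" "\<bar>t - t0\<bar> < d" for s t
  proof -
    have x: "(s, t) \<in> \<Omega>" by (rule in\<Omega>[OF st])
    have Un: "U s \<noteq> 0" using U(1)[OF st(1)] by simp
    have KFt: "KF (s, t) = \<beta> s t *\<^sub>R ?t (s, t)" using tang[OF st] by (simp add: \<beta>_def)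
    have "((\<lambda>t. ?s (s, t) \<bullet> KF (s, t)) has_real_derivative ?s (s, t) \<bullet> cross3 w (?t (s, t)) + partial_v ?s (s, t) \<bullet> KF (s, t)) (at t)"
      by (rule has_vector_derivative_inner[OF Du(2)[OF x] dKt[OF x]])
    moreover have "((\<lambda>t. ?s (s, t) \<bullet> KF (s, t)) has_real_derivative 0) (at t)"
      by (rule has_field_derivative_transform_within_open[OF DERIV_const, of "{t0 - d<..<t0 + d}"])
         (use st in \<open>auto simp: A0 abs_less_iff\<close>)
    ultimately have "?s (s, t) \<bullet> cross3 w (?t (s, t)) + partial_v ?s (s, t) \<bullet> KF (s, t) = 0"
      by (rule DERIV_unique)
    then have 1: "cross3 w (?s (s, t)) \<bullet> ?t (s, t) = \<beta> s t * (U s * U' s)"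
      using uv_v[OF x st(1)] cross_triple[of "?s (s, t)" w "?t (s, t)"] unfolding KFt
      by (simp add: cross_skew[of "?s (s, t)" w] inner_commute)
    have "((\<lambda>s. KF (s, t) \<bullet> ?t (s, t)) has_real_derivative KF (s, t) \<bullet> partial_u ?t (s, t) + cross3 w (?s (s, t)) \<bullet> ?t (s, t)) (at s)"
      by (rule has_vector_derivative_inner[OF dKs[OF x] Dv(1)[OF x]])
    moreover have "KF (s, t) \<bullet> partial_u ?t (s, t) = \<beta> s t * (U s * U' s)"
      unfolding KFt comm[OF x] using uv_v[OF x st(1)] by (simp add: inner_commute)
    then have "KF (s, t) \<bullet> partial_u ?t (s, t) + cross3 w (?s (s, t)) \<bullet> ?t (s, t) = 2 * (\<beta> s t * (U s * U' s))"
      using 1 by simp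
    ultimately have "((\<lambda>s. KF (s, t) \<bullet> ?t (s, t)) has_real_derivative 2 * (\<beta> s t * (U s * U' s))) (at s)"
      by (simp only:)
    moreover have "((\<lambda>s. (U s)\<^sup>2) has_real_derivative 2 * (U s * U' s)) (at s)"
      using U(2)[OF st(1)] by (auto intro!: derivative_eq_intros)
    ultimately have "((\<lambda>s. \<beta> s t) has_real_derivative
        (2 * (\<beta> s t * (U s * U' s)) * (U s)\<^sup>2 - KF (s, t) \<bullet> ?t (s, t) * (2 * (U s * U' s))) / ((U s)\<^sup>2 * (U s)\<^sup>2)) (at s)"
      unfolding \<beta>_def using Un by (intro DERIV_divide) auto
    moreover have "KF (s, t) \<bullet> ?t (s, t) = \<beta> s t * (U s)\<^sup>2" using Un by (simp add: \<beta>_def)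
    ultimately show ?thesis by simp
  qed
  have dt: "((\<lambda>t. \<beta> s t) has_real_derivative 0) (at t)" if st: "\<bar>s\<bar> < d" "\<bar>t - t0\<bar> < d" for s t
  proof -
    have x: "(s, t) \<in> \<Omega>" by (rule in\<Omega>[OF st])
    have KFt: "KF (s, t) = \<beta> s t *\<^sub>R ?t (s, t)" using tang[OF st] by (simp add: \<beta>_def)
    have "((\<lambda>t. KF (s, t) \<bullet> ?t (s, t)) has_real_derivative KF (s, t) \<bullet> partial_v ?t (s, t) + cross3 w (?t (s, t)) \<bullet> ?t (s, t)) (at t)"
      by (rule has_vector_derivative_inner[OF dKt[OF x] Dv(2)[OF x]])
    moreover have "KF (s, t) \<bullet> partial_v ?t (s, t) + cross3 w (?t (s, t)) \<bullet> ?t (s, t) = 0"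
      unfolding KFt using vv_v[OF x st(1)] by (simp add: inner_commute dot_cross_self)
    ultimately have "((\<lambda>t. KF (s, t) \<bullet> ?t (s, t)) has_real_derivative 0) (at t)" by (simp only:)
    from DERIV_cdivide[OF this, of "(U s)\<^sup>2"] show ?thesis by (simp add: \<beta>_def)
  qed
  have const: "f a = f b" if "\<And>s. \<bar>s - c\<bar> < d \<Longrightarrow> (f has_real_derivative 0) (at s)" "\<bar>a - c\<bar> < d" "\<bar>b - c\<bar> < d"
    for f :: "real \<Rightarrow> real" and a b c
  proof -
    have "\<exists>C. \<forall>s\<in>ball c d. f s = C"
    proof (rule has_field_derivative_zero_constant)
      show "(f has_real_derivative 0) (at s within ball c d)" if "s \<in> ball c d" for s
        using that \<open>\<And>s. \<bar>s - c\<bar> < d \<Longrightarrow> (f has_real_derivative 0) (at s)\<close>[of s]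
        by (auto simp: dist_real_def abs_minus_commute intro: has_field_derivative_at_within)
    qed simp
    then show ?thesis using that(2,3) by (auto simp: dist_real_def abs_minus_commute)
  qed
  have \<beta>0: "\<beta> s t = \<beta> 0 t0" if st: "\<bar>s\<bar> < d" "\<bar>t - t0\<bar> < d" for s t
  proof -
    have "\<beta> s t = \<beta> 0 t" by (rule const[of 0]) (use ds st d in auto)
    also have "\<beta> 0 t = \<beta> 0 t0" by (rule const[of t0]) (use dt st d in auto)
    finally show ?thesis .
  qed
  show ?thesis
  proof (rule that[of "\<beta> 0 t0"])
    fix s t assume st: "\<bar>s\<bar> < d" "\<bar>t - t0\<bar> < d"
    have "KF (s, t) = \<beta> s t *\<^sub>R ?t (s, t)" using tang[OF st] by (simp only: \<beta>_def)
    then show "cross3 w (F (s, t)) + w0 = \<beta> 0 t0 *\<^sub>R ?t (s, t)" by (simp only: \<beta>0[OF st] KF_def)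
  qed
qed

section \<open>Reconstruction of the surface near a singular point\<close>

text \<open>The vector \<open>w\<close> is parallel to two orthogonal nonzero vectors.\<close>

lemma cross_zero_both:
  fixes w a b :: "real^3"
  assumes "cross3 w a = 0" "cross3 w b = 0" "a \<bullet> b = 0" "a \<noteq> 0" "b \<noteq> 0"
  shows "w = 0"
proof -
  have a: "(a \<bullet> a) *\<^sub>R w = (a \<bullet> w) *\<^sub>R a" using Lagrange[of a w a] assms(1) by simp
  have b: "(b \<bullet> b) *\<^sub>R w = (b \<bullet> w) *\<^sub>R b" using Lagrange[of b w b] assms(2) by simp
  have "((a \<bullet> a) *\<^sub>R w) \<bullet> b = 0" unfolding a using assms(3) by simp
  then have "w \<bullet> b = 0" using assms(4) by simp
  then show ?thesis using b assms(5) by (simp add: inner_commute)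
qed

lemma frame_rotation:
  fixes E e :: "real^3"
  assumes "E \<bullet> E = 1" "e \<bullet> e = 1" "E \<bullet> e = 0"
  obtains A :: "real^3^3" where "rotation_matrix A"
    "\<And>a b c. A *v vector [a, b, c] = a *\<^sub>R E + b *\<^sub>R cross3 e E + c *\<^sub>R e"
proof
  define M :: "real^3^3" where "M = vector [E, cross3 e E, e]"
  have n: "cross3 e E \<bullet> cross3 e E = 1"
    using norm_cross_dot[of e E] assms by (simp add: power_mult_distrib power2_norm_eq_inner inner_commute)
  have row: "row i B = B $ i" for i and B :: "real^3^3" by (simp add: row_def)
  have "orthogonal_matrix M"
    unfolding orthogonal_matrix_orthonormal_rows row orthogonal_def forall_3 M_def vector_3
    using assms n by (simp add: norm_eq_1 dot_cross_self inner_commute)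
  moreover have "det M = 1"
    using assms by (simp add: M_def dot_cross_det[symmetric] cross_triple_left)
  ultimately show "rotation_matrix (transpose M)"
    by (simp add: rotation_matrix_def orthogonal_matrix_transpose det_transpose)
  show "transpose M *v vector [a, b, c] = a *\<^sub>R E + b *\<^sub>R cross3 e E + c *\<^sub>R e" for a b c
    by (simp add: vec_eq_iff matrix_vector_mult_def sum_3 transpose_def M_def mult.commute)
qed

text \<open>The axis passes through \<open>b = e \<times> w2 / l\<close>, since the velocity there is parallel to \<open>e\<close>.\<close>

lemma screw_axis:
  fixes w1 w2 :: "real^3"
  assumes "w1 \<noteq> 0"
  obtains l e b h where "l > 0" "e \<bullet> e = 1" "\<And>y. cross3 w1 y + w2 = l *\<^sub>R (cross3 e (y - b) + h *\<^sub>R e)"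
proof -
  define l where "l = norm w1"
  define e where "e = (1 / l) *\<^sub>R w1"
  define b where "b = (1 / l) *\<^sub>R cross3 e w2"
  have l: "l > 0" using assms by (simp add: l_def)
  have "w1 \<bullet> w1 = l * l" by (simp add: l_def dot_square_norm power2_eq_square)
  then have e: "e \<bullet> e = 1" using l by (simp add: e_def)
  have w1: "w1 = l *\<^sub>R e" using l by (simp add: e_def)
  have "l *\<^sub>R (cross3 e (y - b) + ((e \<bullet> w2) / l) *\<^sub>R e) = cross3 w1 y + w2" for y
  proof -
    have "l *\<^sub>R (cross3 e (y - b) + ((e \<bullet> w2) / l) *\<^sub>R e)
        = l *\<^sub>R cross3 e y - cross3 e (cross3 e w2) + (e \<bullet> w2) *\<^sub>R e"
      using l unfolding Cross3.right_diff_distrib b_def cross_mult_right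
      by (simp add: scaleR_add_right scaleR_right_diff_distrib)
    also have "\<dots> = l *\<^sub>R cross3 e y + w2" unfolding Lagrange e by simp
    finally show ?thesis by (simp add: w1 cross_mult_left)
  qed
  then show ?thesis using that[OF l e] by metis
qed

text \<open>The derivative of \<open>D\<close> is orthogonal to \<open>D\<close>, so the norm is constant.\<close>

lemma screw_ode_unique:
  fixes D :: "real \<Rightarrow> real^3"
  assumes "\<And>t. \<bar>t - t0\<bar> < d \<Longrightarrow> (D has_vector_derivative l *\<^sub>R cross3 e (D t)) (at t)"
    and "D t0 = 0" "\<bar>t - t0\<bar> < d"
  shows "D t = 0"
proof -
  have der: "((\<lambda>t. D t \<bullet> D t) has_real_derivative 0) (at t within ball t0 d)" if "t \<in> ball t0 d" for t
  proof -
    have t: "\<bar>t - t0\<bar> < d" using that by (simp add: dist_real_def abs_minus_commute)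
    have "((\<lambda>t. D t \<bullet> D t) has_real_derivative D t \<bullet> (l *\<^sub>R cross3 e (D t)) + (l *\<^sub>R cross3 e (D t)) \<bullet> D t) (at t)"
      by (rule has_vector_derivative_inner[OF assms(1)[OF t] assms(1)[OF t]])
    then show ?thesis by (simp add: dot_cross_self has_field_derivative_at_within)
  qed
  obtain C where C: "\<forall>t\<in>ball t0 d. D t \<bullet> D t = C"
    using has_field_derivative_zero_constant[OF convex_ball der] by blast
  have "t \<in> ball t0 d" "t0 \<in> ball t0 d" using assms(3) by (auto simp: dist_real_def abs_minus_commute)
  then have "D t \<bullet> D t = D t0 \<bullet> D t0" using C by simp
  then show ?thesis using assms(2) by simp
qed

lemma open_box_around:
  fixes \<Omega> :: "(real \<times> real) set"
  assumes "open \<Omega>" "(0, t0) \<in> \<Omega>"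
  obtains d where "d > 0" "{-d<..<d} \<times> {t0 - d<..<t0 + d} \<subseteq> \<Omega>"
proof -
  obtain r where r: "r > 0" "ball (0, t0) r \<subseteq> \<Omega>" using assms open_contains_ball by blast
  have "{-(r/2)<..<r/2} \<times> {t0 - r/2<..<t0 + r/2} \<subseteq> ball (0, t0) r"
  proof clarify
    fix s t assume st: "s \<in> {-(r/2)<..<r/2}" "t \<in> {t0 - r/2<..<t0 + r/2}"
    have "dist (0, t0) (s, t) \<le> \<bar>s\<bar> + \<bar>t0 - t\<bar>"
      using sqrt_sum_squares_le_sum_abs[of s "t0 - t"] by (simp add: dist_Pair_Pair dist_real_def)
    also have "\<dots> < r" using st by (auto simp: abs_if)
    finally show "(s, t) \<in> ball (0, t0) r" by simp
  qed
  then show ?thesis using r by (intro that[of "r / 2"]) auto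
qed

text \<open>The field \<open>K\<close> is the velocity of the motion and \<open>N\<close> the unit normal. By the preceding section
  \<open>F\<^sub>t\<close> is a constant multiple of \<open>K(F)\<close>, so every line \<open>s = const\<close> is a helix about one axis, and the
  surface is determined by the line \<open>t = t0\<close>, which is a profile as classified above. The genericity
  condition is used three times: it excludes a pure translation, since then \<open>F\<^sub>t\<^sub>t = 0\<close>; it keeps the edge
  off the axis; and it gives \<open>\<rho>(0) \<noteq> 0\<close>.\<close>

lemma helicoidal_patch:
  fixes F :: "real \<times> real \<Rightarrow> real^3" and K :: "real^3 \<Rightarrow> real^3" and N :: "real \<times> real \<Rightarrow> real^3"
  assumes k: "k > 0" and U: "smooth_on J U" "\<And>s. s \<in> J \<Longrightarrow> U s > 0"
    and V: "smooth_on J V" "\<And>s. s \<in> J \<Longrightarrow> (U has_real_derivative s ^ k * V s) (at s)"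
    and \<Omega>: "open \<Omega>" "(0, t0) \<in> \<Omega>" "\<Omega> \<subseteq> J \<times> UNIV" and F: "smooth_on \<Omega> F"
    and metric: "\<And>x v w. x \<in> \<Omega> \<Longrightarrow> first_fundamental_form F x v w = edge_metric k U x v w"
    and K: "\<And>a b. (K a - K b) \<bullet> (a - b) = 0" "\<exists>a. K a \<noteq> 0"
    and tang: "\<And>x. x \<in> \<Omega> \<Longrightarrow> \<exists>\<alpha> \<beta>. K (F x) = \<alpha> *\<^sub>R partial_u F x + \<beta> *\<^sub>R partial_v F x \<and> \<bar>\<alpha>\<bar> \<le> B"
    and N: "continuous_on \<Omega> N" "\<And>x. x \<in> \<Omega> \<Longrightarrow> N x \<bullet> partial_u F x = 0"
    and generic: "N (0, t0) \<bullet> partial_v (partial_v F) (0, t0) \<noteq> 0"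
  obtains m h e2 d q T where "m > 0" "e2 \<in> {1, -1}" "d > 0" "{-d<..<d} \<subseteq> J" "q > 0"
    "star_condition {-d<..<d} U V h m" "bour_defined {-d<..<d} U h m" "rigid_motion T"
    "\<And>s t. \<bar>s\<bar> < d \<Longrightarrow> \<bar>t - t0\<bar> < q \<Longrightarrow> F (s, t) = T (bour_map k m h U V 1 1 e2 (s, t))"
proof -
  let ?s = "partial_u F" and ?t = "partial_v F"
  have g: "?s x \<bullet> ?s x = fst x ^ (2 * k)" "?s x \<bullet> ?t x = 0" "?t x \<bullet> ?t x = (U (fst x))\<^sup>2" if "x \<in> \<Omega>" for x
    using metric[OF that, of "(1, 0)" "(1, 0)"] metric[OF that, of "(1, 0)" "(0, 1)"] metric[OF that, of "(0, 1)" "(0, 1)"]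
    by (simp_all add: first_fundamental_form_def edge_metric_def partial_u_def partial_v_def)
  obtain d where d: "d > 0" and box: "{-d<..<d} \<times> {t0 - d<..<t0 + d} \<subseteq> \<Omega>"
    using open_box_around[OF \<Omega>(1,2)] by blast
  have in\<Omega>: "(s, t) \<in> \<Omega>" if "\<bar>s\<bar> < d" "\<bar>t - t0\<bar> < d" for s t
    using box that by (auto simp: abs_less_iff subset_iff)
  have inJ: "s \<in> J" if "\<bar>s\<bar> < d" for s using in\<Omega>[OF that, of t0] d \<Omega>(3) by auto
  note D = partial_has_vector_derivative[OF smooth_on_differentiable[OF F]]
  note Dv = partial_has_vector_derivative[OF smooth_on_differentiable[OF smooth_on_partial(2)[OF F]]]
  obtain w where w: "\<And>a. K a = cross3 w a + K 0" using skew_field_is_cross[OF K(1)] by blast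
  obtain \<beta> where \<beta>: "\<And>s t. \<bar>s\<bar> < d \<Longrightarrow> \<bar>t - t0\<bar> < d \<Longrightarrow> cross3 w (F (s, t)) + K 0 = \<beta> *\<^sub>R ?t (s, t)"
  proof (rule killing_field_is_translation[OF k d \<Omega>(1) box F, of U "\<lambda>s. s ^ k * V s" w "K 0" B])
    show "\<exists>\<alpha> \<beta>. cross3 w (F x) + K 0 = \<alpha> *\<^sub>R ?s x + \<beta> *\<^sub>R ?t x \<and> \<bar>\<alpha>\<bar> \<le> B"
      if "x \<in> {-d<..<d} \<times> {t0 - d<..<t0 + d}" for x
      using tang[of x] box that unfolding w[of "F x", symmetric] by blast
  qed (use U V inJ g that in auto)
  have t0: "\<bar>t0 - t0\<bar> < d" "t0 \<in> {t0 - d<..<t0 + d}" and s0: "\<bar>0\<bar> < d" using d by auto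
  \<comment> \<open>Otherwise \<open>K\<close> vanishes on the surface. At a regular point its linear part then kills two independent
    directions, so it is zero, and \<open>K\<close> vanishes everywhere.\<close>
  have "\<beta> \<noteq> 0"
  proof
    assume b0: "\<beta> = 0"
    let ?r = "d / 2"
    have r: "\<bar>?r\<bar> < d" "?r \<in> {-d<..<d}" "?r \<noteq> 0" using d by auto
    have x: "(?r, t0) \<in> \<Omega>" by (rule in\<Omega>[OF r(1) t0(1)])
    have "((\<lambda>s. cross3 w (F (s, t0)) + K 0) has_vector_derivative cross3 w (?s (?r, t0)) + 0) (at ?r)"
      by (intro has_vector_derivative_add has_vector_derivative_cross has_vector_derivative_const D x)
    moreover have "((\<lambda>s. cross3 w (F (s, t0)) + K 0) has_vector_derivative 0) (at ?r)"
      by (rule has_vector_derivative_transform_within_open[where S = "{-d<..<d}", OF has_vector_derivative_const])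
         (use r \<beta>[OF _ t0(1)] b0 in \<open>auto simp: abs_less_iff\<close>)
    ultimately have ws: "cross3 w (?s (?r, t0)) = 0" using vector_derivative_unique_at by fastforce
    have "((\<lambda>t. cross3 w (F (?r, t)) + K 0) has_vector_derivative cross3 w (?t (?r, t0)) + 0) (at t0)"
      by (intro has_vector_derivative_add has_vector_derivative_cross has_vector_derivative_const D x)
    moreover have "((\<lambda>t. cross3 w (F (?r, t)) + K 0) has_vector_derivative 0) (at t0)"
      by (rule has_vector_derivative_transform_within_open[where S = "{t0 - d<..<t0 + d}", OF has_vector_derivative_const])
         (use t0 \<beta>[OF r(1)] b0 in \<open>auto simp: abs_less_iff\<close>)
    ultimately have wt: "cross3 w (?t (?r, t0)) = 0" using vector_derivative_unique_at by fastforce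
    have "?s (?r, t0) \<noteq> 0" "?t (?r, t0) \<noteq> 0"
      using g(1,3)[OF x] r(3) U(2)[OF inJ[OF r(1)]] by auto
    from cross_zero_both[OF ws wt g(2)[OF x] this] have "w = 0" .
    with \<beta>[OF s0 t0(1)] b0 have "K 0 = 0" by simp
    with w \<open>w = 0\<close> K(2) show False by simp
  qed
  define w1 where "w1 = (1 / \<beta>) *\<^sub>R w"
  define w2 where "w2 = (1 / \<beta>) *\<^sub>R K 0"
  have Ft: "?t (s, t) = cross3 w1 (F (s, t)) + w2" if "\<bar>s\<bar> < d" "\<bar>t - t0\<bar> < d" for s t
  proof -
    have "cross3 w1 (F (s, t)) + w2 = (1 / \<beta>) *\<^sub>R (cross3 w (F (s, t)) + K 0)"
      by (simp add: w1_def w2_def cross_mult_left scaleR_add_right)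
    then show ?thesis using \<beta>[OF that] \<open>\<beta> \<noteq> 0\<close> by simp
  qed
  have x0: "(0, t0) \<in> \<Omega>" by (rule \<Omega>(2))
  have "((\<lambda>t. cross3 w1 (F (0, t)) + w2) has_vector_derivative cross3 w1 (?t (0, t0)) + 0) (at t0)"
    by (intro has_vector_derivative_add has_vector_derivative_cross has_vector_derivative_const D x0)
  then have "((\<lambda>t. ?t (0, t)) has_vector_derivative cross3 w1 (?t (0, t0)) + 0) (at t0)"
    by (rule has_vector_derivative_transform_within_open[where S = "{t0 - d<..<t0 + d}"])
       (use t0 s0 in \<open>auto simp: Ft abs_less_iff\<close>)
  from vector_derivative_unique_at[OF Dv(2)[OF x0] this]
  have Ftt: "partial_v ?t (0, t0) = cross3 w1 (?t (0, t0))" by simp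
  then have "w1 \<noteq> 0" using generic by auto
  from screw_axis[OF this, of w2] obtain l e b h where l: "l > 0" and e: "e \<bullet> e = 1"
    and ax: "\<And>y. cross3 w1 y + w2 = l *\<^sub>R (cross3 e (y - b) + h *\<^sub>R e)" by blast
  define m where "m = 1 / l"
  have m: "m > 0" using l by (simp add: m_def)
  have Ft': "?t (s, t) = l *\<^sub>R (cross3 e (F (s, t) - b) + h *\<^sub>R e)" if "\<bar>s\<bar> < d" "\<bar>t - t0\<bar> < d" for s t
    using Ft[OF that] by (simp only: ax)
  have w1e: "cross3 w1 y = l *\<^sub>R cross3 e y" for y
  proof -
    have "cross3 w1 y = (cross3 w1 y + w2) - (cross3 w1 0 + w2)" by simp
    also have "\<dots> = l *\<^sub>R cross3 e y"
      unfolding ax by (simp add: Cross3.right_diff_distrib scaleR_add_right scaleR_right_diff_distrib)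
    finally show ?thesis .
  qed
  define I where "I = {-d<..<d}"
  define y where "y s = F (s, t0) - b" for s
  have I: "open I" "is_interval I" "0 \<in> I" "I \<subseteq> J" using d inJ by (auto simp: I_def is_interval_1 abs_less_iff)
  have Id: "\<bar>s\<bar> < d" "(s, t0) \<in> \<Omega>" if "s \<in> I" for s
    using that in\<Omega>[of s t0] d by (auto simp: I_def abs_less_iff)
  have cl: "cross3 e (y s) + h *\<^sub>R e = m *\<^sub>R ?t (s, t0)" if "s \<in> I" for s
    using Ft'[OF Id(1)[OF that] t0(1)] l by (simp add: y_def m_def)
  have img: "(\<lambda>s. (s, t0)) ` I \<subseteq> \<Omega>" using Id(2) by blast
  obtain d' e2 E z0 where d': "d' > 0" "{-d'<..<d'} \<subseteq> I" and fam: "helicoidal_family k {-d'<..<d'} U V m h 1 1 e2"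
    and E: "E \<bullet> E = 1" "E \<bullet> e = 0"
    and prof: "\<And>s. s \<in> {-d'<..<d'} \<Longrightarrow> y s = (bour_x m h U 1 s * cos (bour_theta k m h U V 1 e2 s t0)) *\<^sub>R E
      + (bour_x m h U 1 s * sin (bour_theta k m h U V 1 e2 s t0)) *\<^sub>R cross3 e E
      + (bour_z k m h U V e2 s + h * bour_theta k m h U V 1 e2 s t0 + z0) *\<^sub>R e"
  proof (rule helicoidal_profile[OF k I(1-3), of U V m e "\<lambda>s. ?s (s, t0)" y h "\<lambda>s. N (s, t0)" t0])
    show "smooth_on I (\<lambda>s. ?s (s, t0))"
      by (rule smooth_on_compose[OF I(1) \<Omega>(1) img _ smooth_on_partial(1)[OF F]])
         (intro smooth_on_Pair smooth_on_id smooth_on_const I(1))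
    show "(y has_vector_derivative ?s (s, t0)) (at s)" if "s \<in> I" for s
      unfolding y_def[abs_def] using has_vector_derivative_diff[OF D(1)[OF Id(2)[OF that]] has_vector_derivative_const[of b]]
      by simp
    show "?s (s, t0) \<bullet> (cross3 e (y s) + h *\<^sub>R e) = 0" if "s \<in> I" for s
      using g(2)[OF Id(2)[OF that]] by (simp add: cl[OF that])
    show "(norm (cross3 e (y s) + h *\<^sub>R e))\<^sup>2 = m\<^sup>2 * (U s)\<^sup>2" if "s \<in> I" for s
      using g(3)[OF Id(2)[OF that]] unfolding cl[OF that] power2_norm_eq_inner by (simp add: power2_eq_square)
    show "continuous_on I (\<lambda>s. N (s, t0))"
      by (rule continuous_on_compose2[OF N(1) _ img]) (intro continuous_intros)
    have "partial_v ?t (0, t0) = l *\<^sub>R (l *\<^sub>R cross3 e (cross3 e (y 0)))"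
      unfolding Ftt w1e Ft'[OF s0 t0(1)] cross_mult_right cross_add_right by (simp add: y_def)
    then show "N (0, t0) \<bullet> cross3 e (cross3 e (y 0)) \<noteq> 0" using generic by auto
  qed (use m e U V I(4) Id g N that smooth_on_subset in \<open>auto\<close>)
  interpret Bo: helicoidal_family k "{-d'<..<d'}" U V m h 1 1 e2 by (rule fam)
  obtain A where A: "rotation_matrix A" "\<And>a b c. A *v vector [a, b, c] = a *\<^sub>R E + b *\<^sub>R cross3 e E + c *\<^sub>R e"
    using frame_rotation[OF E(1) e E(2)] by blast
  define T where "T y = A *v y + (b + z0 *\<^sub>R e)" for y
  have eq: "F (s, t) = T (bour_map k m h U V 1 1 e2 (s, t))" if s: "\<bar>s\<bar> < d'" and t: "\<bar>t - t0\<bar> < d" for s t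
  proof -
    have s': "s \<in> {-d'<..<d'}" using s by (simp add: abs_less_iff)
    have sd: "\<bar>s\<bar> < d" using d'(2) s' Id(1) by blast
    define X where "X = bour_x m h U 1 s"
    define th where "th t = bour_theta k m h U V 1 e2 s t" for t
    define Z where "Z = bour_z k m h U V e2 s"
    define f where "f t = cos (th t) *\<^sub>R (X *\<^sub>R E) + sin (th t) *\<^sub>R (X *\<^sub>R cross3 e E) + ((Z + z0) *\<^sub>R e + th t *\<^sub>R (h *\<^sub>R e))" for t
    have Tf: "T (bour_map k m h U V 1 1 e2 (s, t)) = f t + b" for t
      by (simp add: T_def bour_map_def A(2) f_def X_def th_def Z_def algebra_simps)
    have dth: "(th has_real_derivative l) (at t)" for t
      unfolding th_def[abs_def] bour_theta_def using m by (auto intro!: derivative_eq_intros simp: m_def)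
    have eE: "cross3 e (cross3 e E) = - E" using E e by (simp add: Lagrange inner_commute)
    have df: "(f has_vector_derivative l *\<^sub>R (cross3 e (f t) + h *\<^sub>R e)) (at t)" for t
    proof -
      have sl: "((\<lambda>t. g t *\<^sub>R v) has_vector_derivative g' *\<^sub>R v) (at t)"
        if "(g has_real_derivative g') (at t)" for g g' and v :: "real^3"
        using bounded_linear.has_vector_derivative[OF bounded_linear_scaleR_left that[unfolded has_real_derivative_iff_has_vector_derivative]] .
      have "(f has_vector_derivative (- sin (th t) * l) *\<^sub>R (X *\<^sub>R E) + (cos (th t) * l) *\<^sub>R (X *\<^sub>R cross3 e E) + (0 + l *\<^sub>R (h *\<^sub>R e))) (at t)"
        unfolding f_def[abs_def]
        by (intro has_vector_derivative_add has_vector_derivative_const sl DERIV_chain2[OF DERIV_cos dth]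
            DERIV_chain2[OF DERIV_sin dth] dth)
      moreover have "(- sin (th t) * l) *\<^sub>R (X *\<^sub>R E) + (cos (th t) * l) *\<^sub>R (X *\<^sub>R cross3 e E) + (0 + l *\<^sub>R (h *\<^sub>R e))
          = l *\<^sub>R (cross3 e (f t) + h *\<^sub>R e)"
        unfolding f_def cross_add_right cross_mult_right eE cross_refl by (simp add: algebra_simps)
      ultimately show ?thesis by (simp only:)
    qed
    \<comment> \<open>Both sides are solutions of the same linear equation in \<open>t\<close> that agree at \<open>t0\<close>.\<close>
    have "F (s, t) - b - f t = 0"
    proof (rule screw_ode_unique[where D = "\<lambda>t. F (s, t) - b - f t" and d = d and l = l and e = e])
      fix t assume t: "\<bar>t - t0\<bar> < d"
      have "((\<lambda>t. F (s, t) - b - f t) has_vector_derivative ?t (s, t) - 0 - l *\<^sub>R (cross3 e (f t) + h *\<^sub>R e)) (at t)"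
        by (intro has_vector_derivative_diff has_vector_derivative_const df D(2) in\<Omega> sd t)
      moreover have "?t (s, t) - 0 - l *\<^sub>R (cross3 e (f t) + h *\<^sub>R e) = l *\<^sub>R cross3 e (F (s, t) - b - f t)"
        unfolding Ft'[OF sd t] by (simp add: Cross3.right_diff_distrib scaleR_add_right scaleR_right_diff_distrib)
      ultimately show "((\<lambda>t. F (s, t) - b - f t) has_vector_derivative l *\<^sub>R cross3 e (F (s, t) - b - f t)) (at t)"
        by (simp only:)
    next
      have "y s = f t0" unfolding prof[OF s'] f_def X_def Z_def th_def by (simp add: algebra_simps)
      then show "F (s, t0) - b - f t0 = 0" by (simp add: y_def)
    qed (rule t)
    then show ?thesis by (simp add: Tf algebra_simps)
  qed
  show ?thesis
  proof (rule that[of m e2 d' d h T])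
    show "rigid_motion T" using A(1) unfolding rigid_motion_def T_def[abs_def] by blast
  qed (use m Bo.e2 d' d I(4) Bo.star Bo.defined eq in auto)
qed

section \<open>Passing to coordinates\<close>

lemma coordinates_inj_on: "coordinates X A D c \<Longrightarrow> inj_on c D"
  by (auto simp: coordinates_def diffeo_manifold_def bij_betw_def)

lemma coordinates_openin: "coordinates X A D c \<Longrightarrow> openin X D"
  by (auto simp: coordinates_def diffeo_manifold_def)

text \<open>Coordinates \<open>c\<close> are compatible with the atlas without belonging to it, whereas smoothness,
  singularity and normality are defined through charts \<open>e\<close> of the atlas. All comparisons take place on
  an open set \<open>M\<close> on which both are defined.\<close>

locale overlapping_coordinates =
  fixes X :: "'a topology" and A :: "'a chart set" and D E M :: "'a set" and c e :: "'a \<Rightarrow> real \<times> real"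
  assumes manifold: "oriented_surface_manifold X A" and coords: "coordinates X A D c"
    and chart: "(E, e) \<in> A" and M: "openin X M" "M \<subseteq> D" "M \<subseteq> E"
begin

lemma inj_c: "inj_on c D" by (rule coordinates_inj_on[OF coords])

lemma chart_facts: "openin X E" "open (e ` E)" "homeomorphic_map (subtopology X E) (top_of_set (e ` E)) e"
  using manifold chart by (auto simp: oriented_surface_manifold_def)

lemma inj_e: "inj_on e E"
  using homeomorphic_imp_injective_map[OF chart_facts(3)] openin_subset[OF chart_facts(1)]
  by (simp add: Int_absorb1)

lemma inv_c: "q \<in> M \<Longrightarrow> inv_into D c (c q) = q" and inv_e: "q \<in> M \<Longrightarrow> inv_into E e (e q) = q"
  using inj_c inj_e M by auto

lemma open_e_image: "open (e ` M)"
proof -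
  have "openin (subtopology X E) M" using M chart_facts(1) by (simp add: openin_open_subtopology)
  then have "openin (top_of_set (e ` E)) (e ` M)"
    using homeomorphic_imp_open_map[OF chart_facts(3)] by (simp add: open_map_def)
  then show ?thesis using chart_facts(2) openin_open_trans by blast
qed

lemma open_c_image: "open (c ` M)"
proof -
  have o: "openin (top_of_set UNIV) (c ` D)"
    and cm: "continuous_map (subtopology (top_of_set UNIV) (c ` D)) X (inv_into D c)"
    using coords by (auto simp: coordinates_def diffeo_manifold_def smooth_manifold_map_def)
  have "openin (subtopology (top_of_set UNIV) (c ` D)) {y \<in> topspace (subtopology (top_of_set UNIV) (c ` D)). inv_into D c y \<in> M}"
    by (rule openin_continuous_map_preimage[OF cm M(1)])
  moreover have "{y \<in> topspace (subtopology (top_of_set UNIV) (c ` D)). inv_into D c y \<in> M} = c ` M"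
    using M(2) inv_c by (auto simp: inv_into_f_f[OF inj_c])
  ultimately show ?thesis using o by (auto simp: openin_open)
qed

lemma smooth_to_c: "smooth_on (e ` M) (\<lambda>y. c (inv_into E e y))"
proof -
  have "smooth_on (e ` {q \<in> D \<inter> E. c q \<in> UNIV}) (id \<circ> c \<circ> inv_into E e)"
    using coords chart unfolding coordinates_def diffeo_manifold_def smooth_manifold_map_def plane_atlas_def by fast
  then have "smooth_on (e ` {q \<in> D \<inter> E. c q \<in> UNIV}) (\<lambda>y. c (inv_into E e y))" by (simp add: comp_def)
  then show ?thesis by (rule smooth_on_subset) (use M in auto)
qed

lemma smooth_to_e: "smooth_on (c ` M) (\<lambda>x. e (inv_into D c x))"
proof -
  have sm: "smooth_on (id ` {q \<in> c ` D \<inter> UNIV. inv_into D c q \<in> E}) (e \<circ> inv_into D c \<circ> inv_into UNIV id)"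
    using coords chart unfolding coordinates_def diffeo_manifold_def smooth_manifold_map_def plane_atlas_def by fast
  have sub: "c ` M \<subseteq> id ` {q \<in> c ` D \<inter> UNIV. inv_into D c q \<in> E}"
    using M by (auto simp: inv_into_f_f[OF inj_c] subset_iff)
  have eq: "e \<circ> inv_into D c \<circ> inv_into UNIV id = (\<lambda>x. e (inv_into D c x))"
    by (simp add: fun_eq_iff inv_into_id)
  show ?thesis by (rule smooth_on_subset[OF sm[unfolded eq] sub])
qed

lemma smooth_in_c:
  fixes g :: "'a \<Rightarrow> 'b::euclidean_space"
  assumes "smooth_on (e ` M) (g \<circ> inv_into E e)"
  shows "smooth_on (c ` M) (g \<circ> inv_into D c)"
proof -
  have "smooth_on (c ` M) (\<lambda>x. (g \<circ> inv_into E e) (e (inv_into D c x)))"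
    by (rule smooth_on_compose[OF open_c_image open_e_image _ smooth_to_e assms]) (auto simp: inv_c)
  then show ?thesis
    by (rule smooth_on_cong[OF open_c_image, THEN iffD1, rotated]) (auto simp: inv_c inv_e)
qed

text \<open>This transports singularity and normality from the chart \<open>e\<close> to the coordinates \<open>c\<close>.\<close>

lemma derivative_in_c:
  fixes g :: "'a \<Rightarrow> 'b::euclidean_space"
  assumes "smooth_on (e ` M) (g \<circ> inv_into E e)" "q \<in> M"
  shows "frechet_derivative (g \<circ> inv_into E e) (at (e q)) v
    = frechet_derivative (g \<circ> inv_into D c) (at (c q)) (frechet_derivative (\<lambda>y. c (inv_into E e y)) (at (e q)) v)"
proof -
  have d1: "((\<lambda>y. c (inv_into E e y)) has_derivative frechet_derivative (\<lambda>y. c (inv_into E e y)) (at (e q))) (at (e q))"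
    by (rule smooth_on_has_derivative[OF smooth_to_c]) (use assms(2) in auto)
  have d2: "((g \<circ> inv_into D c) has_derivative frechet_derivative (g \<circ> inv_into D c) (at (c q))) (at (c (inv_into E e (e q))))"
    using smooth_on_has_derivative[OF smooth_in_c[OF assms(1)], of "c q"] assms(2) by (simp add: inv_e)
  have "((\<lambda>y. (g \<circ> inv_into D c) (c (inv_into E e y))) has_derivative
      (\<lambda>v. frechet_derivative (g \<circ> inv_into D c) (at (c q)) (frechet_derivative (\<lambda>y. c (inv_into E e y)) (at (e q)) v))) (at (e q))"
    by (rule has_derivative_compose[OF d1 d2])
  then have "((g \<circ> inv_into E e) has_derivative
      (\<lambda>v. frechet_derivative (g \<circ> inv_into D c) (at (c q)) (frechet_derivative (\<lambda>y. c (inv_into E e y)) (at (e q)) v))) (at (e q))"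
    by (rule has_derivative_transform_within_open[OF _ open_e_image])
       (use assms(2) in \<open>auto simp: inv_c inv_e\<close>)
  from fun_cong[OF frechet_derivative_at[OF this], of v, symmetric] show ?thesis .
qed

lemma coordinate_change_inj:
  assumes "q \<in> M"
  shows "inj (frechet_derivative (\<lambda>y. c (inv_into E e y)) (at (e q)))"
proof -
  have d1: "((\<lambda>y. c (inv_into E e y)) has_derivative frechet_derivative (\<lambda>y. c (inv_into E e y)) (at (e q))) (at (e q))"
    by (rule smooth_on_has_derivative[OF smooth_to_c]) (use assms in auto)
  have d2: "((\<lambda>x. e (inv_into D c x)) has_derivative frechet_derivative (\<lambda>x. e (inv_into D c x)) (at (c q))) (at (c (inv_into E e (e q))))"
    using smooth_on_has_derivative[OF smooth_to_e, of "c q"] assms by (simp add: inv_e)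
  have "((\<lambda>y. e (inv_into D c (c (inv_into E e y)))) has_derivative
     (\<lambda>v. frechet_derivative (\<lambda>x. e (inv_into D c x)) (at (c q)) (frechet_derivative (\<lambda>y. c (inv_into E e y)) (at (e q)) v))) (at (e q))"
    by (rule has_derivative_compose[OF d1 d2])
  then have "((\<lambda>y. y) has_derivative
     (\<lambda>v. frechet_derivative (\<lambda>x. e (inv_into D c x)) (at (c q)) (frechet_derivative (\<lambda>y. c (inv_into E e y)) (at (e q)) v))) (at (e q))"
    by (rule has_derivative_transform_within_open[OF _ open_e_image]) (use assms in \<open>auto simp: inv_c inv_e\<close>)
  from fun_cong[OF has_derivative_unique[OF this has_derivative_ident]]
  have "frechet_derivative (\<lambda>x. e (inv_into D c x)) (at (c q)) (frechet_derivative (\<lambda>y. c (inv_into E e y)) (at (e q)) v) = v" for v .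
  then show ?thesis by (rule inj_on_inverseI)
qed

end

lemma edge_metric_inj:
  assumes "linear F'" "\<And>v w. F' v \<bullet> F' w = edge_metric k U x v w" "fst x \<noteq> 0" "U (fst x) \<noteq> 0"
  shows "inj F'"
  unfolding linear_injective_0[OF assms(1)]
proof (intro allI impI)
  fix v assume "F' v = 0"
  then have "edge_metric k U x v v = 0" using assms(2)[of v v] by simp
  moreover have "fst x ^ (2 * k) * (fst v * fst v) \<ge> 0" "(U (fst x))\<^sup>2 * (snd v * snd v) \<ge> 0"
    by (simp_all add: power_mult)
  ultimately have "fst x ^ (2 * k) * (fst v * fst v) = 0" "(U (fst x))\<^sup>2 * (snd v * snd v) = 0"
    unfolding edge_metric_def by linarith+
  then show "v = 0" using assms(3,4) by (simp add: prod_eq_iff)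
qed

text \<open>Differentiating \<open>H\<^sub>v \<bullet> N(\<psi>) = 0\<close> turns the left-hand side into \<open>- H\<^sub>v \<bullet> N(\<psi>)\<^sub>v\<close>, which involves only first
  derivatives of \<open>\<psi>\<close> and \<open>N\<close>. Since \<open>F\<^sub>u\<close> vanishes at the point, so does \<open>F\<^sub>v \<bullet> N\<^sub>u = - F\<^sub>u\<^sub>v \<bullet> N = F\<^sub>u \<bullet> N\<^sub>v\<close>, and only
  the square of the second component of \<open>\<psi>\<^sub>v\<close> survives.\<close>

lemma normal_curvature_change:
  fixes F N :: "real \<times> real \<Rightarrow> real^3" and \<psi> :: "real \<times> real \<Rightarrow> real \<times> real"
  assumes S: "open S" "y \<in> S" and \<Omega>: "open \<Omega>" and \<psi>: "smooth_on S \<psi>" "\<psi> ` S \<subseteq> \<Omega>"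
    and F: "smooth_on \<Omega> F" and N: "smooth_on \<Omega> N"
    and n: "\<And>x. x \<in> \<Omega> \<Longrightarrow> partial_u F x \<bullet> N x = 0" "\<And>x. x \<in> \<Omega> \<Longrightarrow> partial_v F x \<bullet> N x = 0"
    and F0: "partial_u F (\<psi> y) = 0"
    and H: "\<And>x. x \<in> S \<Longrightarrow> H x = F (\<psi> x)"
  shows "partial_v (partial_v H) y \<bullet> N (\<psi> y) = (snd (partial_v \<psi> y))\<^sup>2 * (partial_v (partial_v F) (\<psi> y) \<bullet> N (\<psi> y))"
proof -
  have dF: "partial_v (\<lambda>x. G (\<psi> x)) x = fst (partial_v \<psi> x) *\<^sub>R partial_u G (\<psi> x) + snd (partial_v \<psi> x) *\<^sub>R partial_v G (\<psi> x)"
    if "smooth_on \<Omega> G" "x \<in> S" for G :: "real \<times> real \<Rightarrow> real^3" and x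
  proof -
    have G: "G differentiable (at (\<psi> x))" using smooth_on_differentiable[OF that(1)] \<psi>(2) that(2) by blast
    from has_derivative_partials(2)[OF has_derivative_compose[OF smooth_on_has_derivative[OF \<psi>(1) that(2)]
        G[unfolded frechet_derivative_works]]]
    show ?thesis by (simp add: frechet_derivative_partials[OF G] partial_v_def[of \<psi>])
  qed
  have Hs: "smooth_on S H"
    using smooth_on_compose[OF S(1) \<Omega> \<psi>(2,1) F] by (rule smooth_on_cong[OF S(1), THEN iffD2, rotated]) (rule H)
  have Ns: "smooth_on S (\<lambda>x. N (\<psi> x))" by (rule smooth_on_compose[OF S(1) \<Omega> \<psi>(2,1) N])
  have Hv: "partial_v H x = fst (partial_v \<psi> x) *\<^sub>R partial_u F (\<psi> x) + snd (partial_v \<psi> x) *\<^sub>R partial_v F (\<psi> x)"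
    if "x \<in> S" for x
  proof -
    have "partial_v H x = partial_v (\<lambda>x. F (\<psi> x)) x"
      unfolding partial_v_def using frechet_derivative_cong_open[OF S(1) that H] by simp
    then show ?thesis using dF[OF F that] by simp
  qed
  have product: "partial_v G x \<bullet> L x = - (G x \<bullet> partial_v L x)" "partial_u G x \<bullet> L x = - (G x \<bullet> partial_u L x)"
    if "open Q" "x \<in> Q" "smooth_on Q G" "smooth_on Q L" "\<And>x. x \<in> Q \<Longrightarrow> G x \<bullet> L x = 0"
    for Q x and G L :: "real \<times> real \<Rightarrow> real^3"
  proof -
    have "((\<lambda>x. G x \<bullet> L x) has_derivative
        (\<lambda>v. G x \<bullet> frechet_derivative L (at x) v + frechet_derivative G (at x) v \<bullet> L x)) (at x)"
      by (rule has_derivative_inner[OF smooth_on_has_derivative[OF that(3,2)] smooth_on_has_derivative[OF that(4,2)]])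
    then have "((\<lambda>x. 0) has_derivative
        (\<lambda>v. G x \<bullet> frechet_derivative L (at x) v + frechet_derivative G (at x) v \<bullet> L x)) (at x)"
      by (rule has_derivative_transform_within_open[OF _ that(1,2)]) (rule that(5))
    from fun_cong[OF has_derivative_unique[OF this has_derivative_const]]
    have "G x \<bullet> frechet_derivative L (at x) v + frechet_derivative G (at x) v \<bullet> L x = 0" for v .
    from this[of "(0, 1)"] this[of "(1, 0)"]
    show "partial_v G x \<bullet> L x = - (G x \<bullet> partial_v L x)" "partial_u G x \<bullet> L x = - (G x \<bullet> partial_u L x)"
      by (simp_all add: partial_v_def partial_u_def)
  qed
  let ?a = "fst (partial_v \<psi> y)" and ?b = "snd (partial_v \<psi> y)"
  have x: "\<psi> y \<in> \<Omega>" using S(2) \<psi>(2) by blast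
  have "partial_v H x \<bullet> N (\<psi> x) = 0" if "x \<in> S" for x
    unfolding Hv[OF that] using n \<psi>(2) that by (simp add: inner_add_left image_subset_iff)
  from product(1)[OF S smooth_on_partial(2)[OF Hs] Ns this]
  have "partial_v (partial_v H) y \<bullet> N (\<psi> y) = - (partial_v H y \<bullet> partial_v (\<lambda>x. N (\<psi> x)) y)" .
  also have "\<dots> = - (?b * ?a * (partial_v F (\<psi> y) \<bullet> partial_u N (\<psi> y)) + ?b * ?b * (partial_v F (\<psi> y) \<bullet> partial_v N (\<psi> y)))"
    unfolding Hv[OF S(2)] dF[OF N S(2)] F0 by (simp add: inner_add_right algebra_simps)
  also have "partial_v F (\<psi> y) \<bullet> partial_u N (\<psi> y) = 0"
    using product(2)[OF \<Omega> x smooth_on_partial(2)[OF F] N n(2)]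
      product(1)[OF \<Omega> x smooth_on_partial(1)[OF F] N n(1)] F0 mixed_partials_commute[OF \<Omega> F x] by simp
  also have "partial_v F (\<psi> y) \<bullet> partial_v N (\<psi> y) = - (partial_v (partial_v F) (\<psi> y) \<bullet> N (\<psi> y))"
    using product(1)[OF \<Omega> x smooth_on_partial(2)[OF F] N n(2)] by simp
  finally show ?thesis by (simp add: power2_eq_square)
qed

definition velocity :: "(real \<Rightarrow> real^3 \<Rightarrow> real^3) \<Rightarrow> real^3 \<Rightarrow> real^3" where
  "velocity G a = vector_derivative (\<lambda>\<tau>. G \<tau> a) (at 0)"

lemma velocity_has_vector_derivative:
  assumes "helicoidal_motion G"
  shows "((\<lambda>\<tau>. G \<tau> a) has_vector_derivative velocity G a) (at 0)"
proof -
  have "smooth_on UNIV (\<lambda>\<tau>. G \<tau> a)" using assms by (simp add: helicoidal_motion_def)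
  from smooth_on_has_vector_derivative[OF this, of 0] show ?thesis
    unfolding velocity_def using vector_derivative_works differentiableI_vector by blast
qed

text \<open>The motion preserves distances; this is the derivative of \<open>\<bar>G\<^sub>\<tau> a - G\<^sub>\<tau> b\<bar>\<^sup>2\<close> at \<open>\<tau> = 0\<close>.\<close>

lemma velocity_skew:
  assumes "helicoidal_motion G"
  shows "(velocity G a - velocity G b) \<bullet> (a - b) = 0"
proof -
  let ?f = "\<lambda>\<tau>. G \<tau> a - G \<tau> b"
  have f: "(?f has_vector_derivative velocity G a - velocity G b) (at 0)"
    by (intro has_vector_derivative_diff velocity_has_vector_derivative assms)
  have g0: "G 0 = id" using assms by (simp add: helicoidal_motion_def)
  have "?f \<tau> \<bullet> ?f \<tau> = (a - b) \<bullet> (a - b)" for \<tau>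
  proof -
    have "dist (G \<tau> a) (G \<tau> b) = dist a b" using assms by (simp add: helicoidal_motion_def)
    then show ?thesis by (simp add: dist_norm dot_square_norm)
  qed
  then have "((\<lambda>\<tau>. ?f \<tau> \<bullet> ?f \<tau>) has_real_derivative 0) (at 0)" by simp
  from DERIV_unique[OF this has_vector_derivative_inner[OF f f]] g0 show ?thesis
    by (simp add: inner_commute)
qed

text \<open>By the group law the velocity at time \<open>\<tau>\<close> is \<open>velocity G (G \<tau> a)\<close>; if it vanished identically, the motion
  would be trivial.\<close>

lemma velocity_nonzero:
  assumes "helicoidal_motion G"
  shows "\<exists>a. velocity G a \<noteq> 0"
proof (rule ccontr)
  assume "\<not> (\<exists>a. velocity G a \<noteq> 0)"
  then have z: "velocity G a = 0" for a by blast
  have add: "G (\<sigma> + \<tau>) = G \<sigma> \<circ> G \<tau>" for \<sigma> \<tau> using assms by (simp add: helicoidal_motion_def)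
  have der: "((\<lambda>\<tau>. G \<tau> a) has_vector_derivative 0) (at \<tau>)" for a \<tau>
  proof -
    have "((\<lambda>\<sigma>. G \<sigma> (G \<tau> a)) has_vector_derivative 0) (at (\<tau> - \<tau>))"
      using velocity_has_vector_derivative[OF assms, of "G \<tau> a"] z by simp
    moreover have "((\<lambda>r. r - \<tau>) has_vector_derivative 1) (at \<tau>)"
      by (auto intro!: derivative_eq_intros simp flip: has_real_derivative_iff_has_vector_derivative)
    ultimately have "(((\<lambda>\<sigma>. G \<sigma> (G \<tau> a)) \<circ> (\<lambda>r. r - \<tau>)) has_vector_derivative 1 *\<^sub>R 0) (at \<tau>)"
      by (intro vector_diff_chain_at)
    moreover have "(\<lambda>\<sigma>. G \<sigma> (G \<tau> a)) \<circ> (\<lambda>r. r - \<tau>) = (\<lambda>r. G r a)"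
      using add[of "_ - \<tau>" \<tau>] by (simp add: fun_eq_iff)
    ultimately show ?thesis by simp
  qed
  have "G \<tau> a = G 0 a" for \<tau> a
  proof -
    obtain C where "\<And>\<tau>. \<tau> \<in> UNIV \<Longrightarrow> G \<tau> a = C"
      using has_vector_derivative_zero_constant[OF convex_UNIV, of "\<lambda>\<tau>. G \<tau> a"] der by blast
    then show ?thesis by simp
  qed
  moreover have "G 0 = id" using assms by (simp add: helicoidal_motion_def)
  ultimately have "G \<tau> = id" for \<tau> by (simp add: fun_eq_iff)
  then show False using assms by (simp add: helicoidal_motion_def)
qed

context overlapping_coordinates
begin

text \<open>Differentiating \<open>f (\<phi> \<tau> q) = G \<tau> (f q)\<close> at \<open>\<tau> = 0\<close> shows that the velocity of the motion along \<open>f\<close> is the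
  image of the velocity \<open>\<zeta>\<close> of the flow \<open>\<phi>\<close>. The latter is continuous in the chart \<open>e\<close>, hence also in the
  coordinates \<open>c\<close>, and therefore bounded near \<open>p\<close>.\<close>

lemma tangential_velocity:
  assumes group: "one_parameter_group X A \<phi>" and inv: "\<And>\<tau> q. q \<in> topspace X \<Longrightarrow> f (\<phi> \<tau> q) = G \<tau> (f q)"
    and G: "helicoidal_motion G" and f: "smooth_vector_map A (topspace X) f" and p: "p \<in> M"
  obtains \<Omega> B where "open \<Omega>" "c p \<in> \<Omega>" "\<Omega> \<subseteq> c ` M"
    "\<And>x. x \<in> \<Omega> \<Longrightarrow> \<exists>\<alpha> \<beta>. velocity G ((f \<circ> inv_into D c) x)
       = \<alpha> *\<^sub>R partial_u (f \<circ> inv_into D c) x + \<beta> *\<^sub>R partial_v (f \<circ> inv_into D c) x \<and> \<bar>\<alpha>\<bar> \<le> B"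
proof -
  have top: "q \<in> topspace X" if "q \<in> E" for q using openin_subset[OF chart_facts(1)] that by auto
  have "topspace X \<inter> E = E" using top by auto
  then have sf: "smooth_on (e ` E) (f \<circ> inv_into E e)"
    using f chart unfolding smooth_vector_map_def by force
  have eM: "e ` M \<subseteq> e ` E" using M(3) by auto
  define \<Phi> where "\<Phi> = (\<lambda>(\<tau>, y). e (\<phi> \<tau> (inv_into E e y)))"
  define Q where "Q = {(\<tau>, y). y \<in> e ` E \<and> \<phi> \<tau> (inv_into E e y) \<in> E}"
  have s\<Phi>: "smooth_on Q \<Phi>"
    using group chart unfolding one_parameter_group_def \<Phi>_def Q_def by blast
  have \<phi>0: "\<phi> 0 q = q" if "q \<in> E" for q
    using group top[OF that] by (simp add: one_parameter_group_def)
  have inE: "inv_into E e y \<in> E" "e (inv_into E e y) = y" if "y \<in> e ` E" for y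
    using that by (auto simp: inv_into_into f_inv_into_f)
  have Q0: "(0, y) \<in> Q" if "y \<in> e ` E" for y
    using inE[OF that] that \<phi>0 by (simp add: Q_def)
  define \<zeta> where "\<zeta> y = frechet_derivative \<Phi> (at (0, y)) (1, 0)" for y
  have cQ: "continuous_on Q (\<lambda>x. frechet_derivative \<Phi> (at x) (1, 0))"
    by (rule smooth_on_imp_continuous_on[OF smooth_on_frechet_derivative[OF s\<Phi>]])
  have sub: "(\<lambda>y. (0, y)) ` (e ` E) \<subseteq> Q" using Q0 by blast
  have "continuous_on (e ` E) (\<lambda>y. (0 :: real, y))" by (intro continuous_intros)
  from continuous_on_compose2[OF cQ this sub] have c\<zeta>: "continuous_on (e ` E) \<zeta>"
    by (simp only: \<zeta>_def[abs_def])
  define \<kappa> where "\<kappa> y = c (inv_into E e y)" for y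
  have s\<kappa>: "smooth_on (e ` M) \<kappa>" using smooth_to_c by (simp add: \<kappa>_def[abs_def])
  have vel: "velocity G (f q) = frechet_derivative (f \<circ> inv_into D c) (at (c q)) (frechet_derivative \<kappa> (at (e q)) (\<zeta> (e q)))"
    if q: "q \<in> M" for q
  proof -
    have qE: "q \<in> E" "e q \<in> e ` E" using q M(3) by auto
    have i: "inv_into E e (e q) = q" by (rule inv_e[OF q])
    have pc: "((\<lambda>\<tau>. (\<tau>, e q)) has_derivative (\<lambda>r. (r, 0))) (at (0::real))"
      by (intro has_derivative_Pair has_derivative_ident has_derivative_const)
    have d\<Phi>: "(\<Phi> has_derivative frechet_derivative \<Phi> (at (0, e q))) (at (0, e q))"
      by (rule smooth_on_has_derivative[OF s\<Phi> Q0[OF qE(2)]])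
    have d1: "((\<lambda>\<tau>. \<Phi> (\<tau>, e q)) has_derivative (\<lambda>r. frechet_derivative \<Phi> (at (0, e q)) (r, 0))) (at 0)"
      by (rule has_derivative_compose[OF pc d\<Phi>])
    have \<Phi>0: "\<Phi> (0, e q) = e q" using qE i by (simp add: \<Phi>_def \<phi>0)
    have d2: "((f \<circ> inv_into E e) has_derivative frechet_derivative (f \<circ> inv_into E e) (at (e q))) (at (\<Phi> (0, e q)))"
      unfolding \<Phi>0 by (rule smooth_on_has_derivative[OF sf qE(2)])
    have d3: "((\<lambda>\<tau>. (f \<circ> inv_into E e) (\<Phi> (\<tau>, e q))) has_derivative
        (\<lambda>r. frechet_derivative (f \<circ> inv_into E e) (at (e q)) (frechet_derivative \<Phi> (at (0, e q)) (r, 0)))) (at 0)"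
      by (rule has_derivative_compose[OF d1 d2])
    have cm: "continuous_map euclideanreal X (\<lambda>\<tau>. \<phi> \<tau> q)"
    proof -
      have "continuous_map euclideanreal (prod_topology euclideanreal X) (\<lambda>\<tau>. (\<tau>, q))"
        using top[OF qE(1)] by (intro continuous_map_pairedI) auto
      from continuous_map_compose[OF this] group show ?thesis
        unfolding one_parameter_group_def by (force simp: comp_def)
    qed
    have "openin euclideanreal {\<tau> \<in> topspace euclideanreal. \<phi> \<tau> q \<in> E}"
      by (rule openin_continuous_map_preimage[OF cm chart_facts(1)])
    then have o: "open {\<tau>. \<phi> \<tau> q \<in> E}" by simp
    \<comment> \<open>The orbit of \<open>q\<close> stays in the chart for small \<open>\<tau>\<close> only.\<close>
    have d4: "((\<lambda>\<tau>. G \<tau> (f q)) has_derivative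
        (\<lambda>r. frechet_derivative (f \<circ> inv_into E e) (at (e q)) (frechet_derivative \<Phi> (at (0, e q)) (r, 0)))) (at 0)"
    proof (rule has_derivative_transform_within_open[OF d3 o])
      show "0 \<in> {\<tau>. \<phi> \<tau> q \<in> E}" using \<phi>0[OF qE(1)] qE(1) by simp
      show "(f \<circ> inv_into E e) (\<Phi> (\<tau>, e q)) = G \<tau> (f q)" if "\<tau> \<in> {\<tau>. \<phi> \<tau> q \<in> E}" for \<tau>
        using that inj_e inv[OF top[OF qE(1)]] by (simp add: \<Phi>_def i)
    qed
    have "((\<lambda>\<tau>. G \<tau> (f q)) has_derivative (\<lambda>r. r *\<^sub>R velocity G (f q))) (at 0)"
      using velocity_has_vector_derivative[OF G] by (simp add: has_vector_derivative_def)
    from fun_cong[OF has_derivative_unique[OF this d4], of 1]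
    have "velocity G (f q) = frechet_derivative (f \<circ> inv_into E e) (at (e q)) (\<zeta> (e q))"
      by (simp add: \<zeta>_def)
    then show ?thesis
      unfolding \<kappa>_def[abs_def] derivative_in_c[OF smooth_on_subset[OF sf eM] q] .
  qed
  define \<alpha> where "\<alpha> x = fst (frechet_derivative \<kappa> (at (e (inv_into D c x))) (\<zeta> (e (inv_into D c x))))" for x
  have cont: "continuous_on (c ` M) \<alpha>"
  proof -
    have "continuous_on (e ` M) (\<lambda>y. fst (frechet_derivative \<kappa> (at y) (\<zeta> y)))"
    proof (rule continuous_on_eq)
      show "continuous_on (e ` M) (\<lambda>y. fst (fst (\<zeta> y) *\<^sub>R partial_u \<kappa> y + snd (\<zeta> y) *\<^sub>R partial_v \<kappa> y))"
        using continuous_on_subset[OF c\<zeta> eM] smooth_on_imp_continuous_on[OF smooth_on_partial(1)[OF s\<kappa>]]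
          smooth_on_imp_continuous_on[OF smooth_on_partial(2)[OF s\<kappa>]] by (intro continuous_intros)
      show "fst (fst (\<zeta> y) *\<^sub>R partial_u \<kappa> y + snd (\<zeta> y) *\<^sub>R partial_v \<kappa> y) = fst (frechet_derivative \<kappa> (at y) (\<zeta> y))"
        if "y \<in> e ` M" for y
        using frechet_derivative_partials[OF smooth_on_differentiable[OF s\<kappa> that]] by simp
    qed
    then show ?thesis
      unfolding \<alpha>_def[abs_def]
      by (rule continuous_on_compose2[OF _ smooth_on_imp_continuous_on[OF smooth_to_e]]) (auto simp: inv_c)
  qed
  define B where "B = \<bar>\<alpha> (c p)\<bar> + 1"
  show ?thesis
  proof (rule that[of "c ` M \<inter> \<alpha> -` {-B<..<B}" B])
    show "open (c ` M \<inter> \<alpha> -` {-B<..<B})"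
      by (rule continuous_open_preimage[OF cont open_c_image]) simp
    show "c p \<in> c ` M \<inter> \<alpha> -` {-B<..<B}" using p by (auto simp: B_def)
    fix x assume x: "x \<in> c ` M \<inter> \<alpha> -` {-B<..<B}"
    then obtain q where q: "q \<in> M" "x = c q" by auto
    let ?\<xi> = "frechet_derivative \<kappa> (at (e q)) (\<zeta> (e q))"
    have \<alpha>: "\<alpha> x = fst ?\<xi>" by (simp add: \<alpha>_def q inv_c)
    have diff: "(f \<circ> inv_into D c) differentiable (at x)"
      using smooth_on_differentiable[OF smooth_in_c[OF smooth_on_subset[OF sf eM]]] q by blast
    have "velocity G ((f \<circ> inv_into D c) x) = frechet_derivative (f \<circ> inv_into D c) (at x) ?\<xi>"
      using vel[OF q(1)] q by (simp add: inv_c)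
    also have "\<dots> = \<alpha> x *\<^sub>R partial_u (f \<circ> inv_into D c) x + snd ?\<xi> *\<^sub>R partial_v (f \<circ> inv_into D c) x"
      unfolding \<alpha> by (rule frechet_derivative_partials[OF diff])
    finally show "\<exists>\<alpha> \<beta>. velocity G ((f \<circ> inv_into D c) x)
       = \<alpha> *\<^sub>R partial_u (f \<circ> inv_into D c) x + \<beta> *\<^sub>R partial_v (f \<circ> inv_into D c) x \<and> \<bar>\<alpha>\<bar> \<le> B"
      using x by (intro exI[of _ "\<alpha> x"] exI[of _ "snd ?\<xi>"]) (auto simp: abs_le_iff)
  qed auto
qed

end

section \<open>The classification\<close>

text \<open>On the intersection of the domains of \<open>c\<close>, of an atlas chart that exhibits \<open>p\<close> as singular, of the unit
  normal and of the coordinates that exhibit \<open>p\<close> as generic, everything can be expressed in \<open>c\<close>: the first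
  coordinate of \<open>p\<close> is zero because the metric is nondegenerate elsewhere, the normal curvature keeps its
  nonvanishing, and the velocity of the motion is tangential with bounded coefficients.\<close>

theorem helicoidal_edge_local_form:
  fixes X :: "'a topology"
  assumes k: "k > 0" and U: "smooth_on J U" "\<And>s. s \<in> J \<Longrightarrow> U s > 0"
    and V: "smooth_on J V" "\<And>s. s \<in> J \<Longrightarrow> (U has_real_derivative s ^ k * V s) (at s)"
    and edge: "generic_helicoidal_edge (k + 1) X A f" and p: "p \<in> singular_points X A f" "p \<in> D"
    and coords: "coordinates X A D c" "c ` D \<subseteq> J \<times> UNIV"
    and metric: "\<And>x v w. x \<in> c ` D \<Longrightarrow> first_fundamental_form (f \<circ> inv_into D c) x v w = edge_metric k U x v w"
  obtains m h e2 d T W where "m > 0" "e2 \<in> {1, -1}" "d > 0" "{-d<..<d} \<subseteq> J"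
    "star_condition {-d<..<d} U V h m" "bour_defined {-d<..<d} U h m" "rigid_motion T"
    "openin X W" "p \<in> W" "W \<subseteq> D" "c ` W \<subseteq> {-d<..<d} \<times> UNIV"
    "\<And>q. q \<in> W \<Longrightarrow> f q = T (bour_map k m h U V 1 1 e2 (c q))"
proof -
  have "surface X A f" using edge by (simp add: generic_helicoidal_edge_def frontal_def)
  then have mf: "oriented_surface_manifold X A" and f: "smooth_vector_map A (topspace X) f"
    by (auto simp: surface_def)
  obtain G \<phi> where G: "helicoidal_motion G" and \<phi>: "one_parameter_group X A \<phi>"
    and inv: "\<And>\<tau> q. q \<in> topspace X \<Longrightarrow> f (\<phi> \<tau> q) = G \<tau> (f q)"
    using edge unfolding generic_helicoidal_edge_def invariant_under_def by blast
  obtain E e where E: "(E, e) \<in> A" "p \<in> E" and ninj: "\<not> inj (frechet_derivative (f \<circ> inv_into E e) (at (e p)))"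
    using p(1) by (auto simp: singular_points_def)
  have "generic_singular_point X A f p" using edge p(1) by (simp add: generic_helicoidal_edge_def)
  then obtain W0 \<nu> D2 c2 where W0: "p \<in> W0" "unit_normal_field X A f W0 \<nu>" and D2: "p \<in> D2" "oriented_coordinates X A D2 c2"
    and curv: "limiting_normal_curvature D2 c2 f \<nu> p \<noteq> 0"
    unfolding generic_singular_point_def by blast
  have c2: "coordinates X A D2 c2" using D2(2) by (simp add: oriented_coordinates_def)
  define M where "M = D \<inter> E \<inter> (W0 \<inter> D2)"
  have oE: "openin X E" using mf E(1) by (auto simp: oriented_surface_manifold_def)
  have "openin X W0" using W0(2) by (simp add: unit_normal_field_def)
  then have M: "openin X M" "M \<subseteq> D" "M \<subseteq> E" "M \<subseteq> W0" "M \<subseteq> D2" "p \<in> M"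
    using coordinates_openin[OF coords(1)] coordinates_openin[OF c2] oE p(2) E(2) W0(1) D2(1)
    by (auto simp: M_def)
  interpret O1: overlapping_coordinates X A D E M c e
    by unfold_locales (use mf coords(1) E(1) M in auto)
  interpret O2: overlapping_coordinates X A D2 E M c2 e
    by unfold_locales (use mf c2 E(1) M in auto)
  have sf: "smooth_on (e ` M) (f \<circ> inv_into E e)"
  proof (rule smooth_on_subset)
    show "smooth_on (e ` (topspace X \<inter> E)) (f \<circ> inv_into E e)"
      using f E(1) unfolding smooth_vector_map_def by blast
    show "e ` M \<subseteq> e ` (topspace X \<inter> E)" using M openin_subset[OF M(1)] by auto
  qed
  have s\<nu>: "smooth_on (e ` M) (\<nu> \<circ> inv_into E e)"
  proof (rule smooth_on_subset)
    show "smooth_on (e ` (W0 \<inter> E)) (\<nu> \<circ> inv_into E e)"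
      using W0(2) E(1) unfolding unit_normal_field_def smooth_vector_map_def by blast
    show "e ` M \<subseteq> e ` (W0 \<inter> E)" using M by auto
  qed
  let ?F = "f \<circ> inv_into D c" and ?N = "\<nu> \<circ> inv_into D c" and ?\<kappa> = "\<lambda>y. c (inv_into E e y)"
  note F = O1.smooth_in_c[OF sf] and N = O1.smooth_in_c[OF s\<nu>]
  have normal: "frechet_derivative ?F (at (c q)) v \<bullet> ?N (c q) = 0" if q: "q \<in> M" for q v
  proof -
    have lin: "linear (frechet_derivative ?\<kappa> (at (e q)))"
      using linear_frechet_derivative[OF smooth_on_differentiable[OF O1.smooth_to_c]] q by blast
    obtain u where "v = frechet_derivative ?\<kappa> (at (e q)) u"
      using linear_injective_imp_surjective[OF lin O1.coordinate_change_inj[OF q]] by (metis surjD)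
    moreover have "frechet_derivative (f \<circ> inv_into E e) (at (e q)) u \<bullet> \<nu> q = 0"
      using W0(2) E(1) q M unfolding unit_normal_field_def by blast
    ultimately show ?thesis using O1.derivative_in_c[OF sf q, of u] by (simp add: O1.inv_c[OF q])
  qed
  have sM: "c ` M \<subseteq> c ` D" using M(2) by auto
  have "fst (c p) = 0"
  proof (rule ccontr)
    assume nz: "fst (c p) \<noteq> 0"
    have x: "c p \<in> c ` D" "c p \<in> c ` M" using p(2) M by auto
    have "U (fst (c p)) > 0" using coords(2) x(1) by (intro U(2)) auto
    then have "inj (frechet_derivative ?F (at (c p)))"
      using linear_frechet_derivative[OF smooth_on_differentiable[OF F x(2)]] metric[OF x(1)] nz
      by (intro edge_metric_inj[of _ k U "c p"]) (auto simp: first_fundamental_form_def)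
    from inj_compose[OF this O1.coordinate_change_inj[OF M(6)]]
    have "inj (frechet_derivative (f \<circ> inv_into E e) (at (e p)))"
      using O1.derivative_in_c[OF sf M(6)] by (simp add: inj_def)
    with ninj show False by blast
  qed
  then obtain t0 where cp: "c p = (0, t0)" by (metis prod.collapse)
  have normal': "partial_u ?F x \<bullet> ?N x = 0" "partial_v ?F x \<bullet> ?N x = 0" if "x \<in> c ` M" for x
    using normal that unfolding partial_u_def partial_v_def by blast+
  have generic: "partial_v (partial_v ?F) (0, t0) \<bullet> ?N (0, t0) \<noteq> 0"
  proof
    assume z: "partial_v (partial_v ?F) (0, t0) \<bullet> ?N (0, t0) = 0"
    let ?\<psi> = "\<lambda>x. c (inv_into D2 c2 x)" and ?H = "f \<circ> inv_into D2 c2"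
    have "smooth_on (c2 ` M) (\<lambda>x. ?\<kappa> (e (inv_into D2 c2 x)))"
      by (rule smooth_on_compose[OF O2.open_c_image O1.open_e_image _ O2.smooth_to_e O1.smooth_to_c])
         (auto simp: O2.inv_c)
    then have \<psi>: "smooth_on (c2 ` M) ?\<psi>"
      by (rule smooth_on_cong[OF O2.open_c_image, THEN iffD1, rotated]) (auto simp: O2.inv_c O1.inv_e)
    have y: "c2 p \<in> c2 ` M" "?\<psi> (c2 p) = (0, t0)" using M(6) cp by (auto simp: O2.inv_c)
    have img: "?\<psi> ` (c2 ` M) \<subseteq> c ` M" by (auto simp: O2.inv_c)
    have "partial_u ?F (0, t0) \<bullet> partial_u ?F (0, t0) = 0"
      using metric[OF imageI[OF p(2)], of "(1, 0)" "(1, 0)"] k unfolding cp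
      by (simp add: first_fundamental_form_def edge_metric_def partial_u_def power_0_left)
    then have F0: "partial_u ?F (?\<psi> (c2 p)) = 0" unfolding y(2) by simp
    have H: "?H x = ?F (?\<psi> x)" if "x \<in> c2 ` M" for x using that by (auto simp: O2.inv_c O1.inv_c)
    from normal_curvature_change[where H = ?H, OF O2.open_c_image y(1) O1.open_c_image \<psi> img F N normal' F0 H]
    have "partial_v (partial_v ?H) (c2 p) \<bullet> ?N (0, t0) = 0" unfolding y(2) z by simp
    moreover have "?N (0, t0) = \<nu> p" using O1.inv_c[OF M(6)] by (simp add: cp)
    ultimately show False using curv by (simp add: limiting_normal_curvature_def Let_def)
  qed
  obtain \<Omega> B where \<Omega>: "open \<Omega>" "c p \<in> \<Omega>" "\<Omega> \<subseteq> c ` M"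
    and tang: "\<And>x. x \<in> \<Omega> \<Longrightarrow> \<exists>\<alpha> \<beta>. velocity G (?F x) = \<alpha> *\<^sub>R partial_u ?F x + \<beta> *\<^sub>R partial_v ?F x \<and> \<bar>\<alpha>\<bar> \<le> B"
    by (rule O1.tangential_velocity[OF \<phi> inv G f M(6)]) (assumption | rule that)+
  have \<Omega>J: "\<Omega> \<subseteq> J \<times> UNIV" using \<Omega>(3) sM coords(2) by blast
  obtain m h e2 d q T where patch: "m > 0" "e2 \<in> {1, -1}" "d > 0" "{-d<..<d} \<subseteq> J" "q > 0"
    "star_condition {-d<..<d} U V h m" "bour_defined {-d<..<d} U h m" "rigid_motion T"
    and eq: "\<And>s t. \<bar>s\<bar> < d \<Longrightarrow> \<bar>t - t0\<bar> < q \<Longrightarrow> ?F (s, t) = T (bour_map k m h U V 1 1 e2 (s, t))"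
  proof (rule helicoidal_patch[OF k U V \<Omega>(1) \<Omega>(2)[unfolded cp] \<Omega>J smooth_on_subset[OF F \<Omega>(3)], of "velocity G" B ?N])
    show "first_fundamental_form ?F x v w = edge_metric k U x v w" if "x \<in> \<Omega>" for x v w
      using metric \<Omega>(3) sM that by blast
    show "?N x \<bullet> partial_u ?F x = 0" if "x \<in> \<Omega>" for x
      using normal'(1)[of x] \<Omega>(3) that by (auto simp: inner_commute)
    show "?N (0, t0) \<bullet> partial_v (partial_v ?F) (0, t0) \<noteq> 0" using generic by (simp add: inner_commute)
    show "continuous_on \<Omega> ?N" by (rule continuous_on_subset[OF smooth_on_imp_continuous_on[OF N] \<Omega>(3)])
  qed (rule velocity_skew[OF G] | rule velocity_nonzero[OF G] | erule tang | assumption | rule that)+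
  define W where "W = {x \<in> topspace (subtopology X D). c x \<in> {-d<..<d} \<times> {t0 - q<..<t0 + q}}"
  have cm: "continuous_map (subtopology X D) (top_of_set UNIV) c"
    using coords(1) by (simp add: coordinates_def diffeo_manifold_def smooth_manifold_map_def)
  have oD: "openin X D" by (rule coordinates_openin[OF coords(1)])
  have "openin (subtopology X D) W"
    unfolding W_def by (rule openin_continuous_map_preimage[OF cm]) (auto intro: open_Times)
  then have oW: "openin X W" using oD openin_trans_full by blast
  show ?thesis
  proof (rule that[of m e2 d h T W])
    show "p \<in> W" using patch openin_subset[OF oD] p(2) by (auto simp: W_def cp)
    show "f x = T (bour_map k m h U V 1 1 e2 (c x))" if "x \<in> W" for x
    proof -
      obtain s t where st: "c x = (s, t)" by (cases "c x")
      have x: "x \<in> D" "\<bar>s\<bar> < d" "\<bar>t - t0\<bar> < q" using that st by (auto simp: W_def)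
      have "f x = ?F (c x)" using x(1) O1.inj_c by simp
      then show ?thesis using eq[OF x(2,3)] by (simp only: st)
    qed
  qed (use patch oW in \<open>auto simp: W_def\<close>)
qed

theorem theorem3p4:
  fixes k :: nat and J :: "real set" and U V :: "real \<Rightarrow> real"
  assumes "k > 0"
    and "open J" and "is_interval J" and "0 \<in> J"
    and "smooth_on J U" and "\<forall>s\<in>J. U s > 0"
    and "\<forall>i\<in>{1..k}. (deriv ^^ i) U 0 = 0"
    and "smooth_on J V" and "\<forall>s\<in>J. deriv U s = s ^ k * V s"
  shows
    "(\<forall>m h. \<forall>\<epsilon>0\<in>{1, -1}. \<forall>\<epsilon>1\<in>{1, -1}. \<forall>\<epsilon>2\<in>{1, -1}.
        m > 0 \<and> star_condition J U V h m \<and> bour_defined J U h m \<longrightarrow>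
        generic_helicoidal_edge (k + 1) (top_of_set (J \<times> UNIV)) (plane_atlas (J \<times> UNIV))
          (bour_map k m h U V \<epsilon>0 \<epsilon>1 \<epsilon>2) \<and>
        (\<forall>x\<in>J \<times> UNIV. \<forall>v w.
          first_fundamental_form (bour_map k m h U V \<epsilon>0 \<epsilon>1 \<epsilon>2) x v w = edge_metric k U x v w))
     \<and>
     (\<forall>(X :: 'a topology) A f p D c.
        generic_helicoidal_edge (k + 1) X A f \<and> p \<in> singular_points X A f \<and>
        p \<in> D \<and> coordinates X A D c \<and> c ` D \<subseteq> J \<times> UNIV \<and>
        (\<forall>x\<in>c ` D. \<forall>v w.
          first_fundamental_form (f \<circ> inv_into D c) x v w = edge_metric k U x v w) \<longrightarrow>
        (\<exists>m h. \<exists>\<epsilon>0\<in>{1, -1}. \<exists>\<epsilon>1\<in>{1, -1}. \<exists>\<epsilon>2\<in>{1, -1}. \<exists>J' T W.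
          m > 0 \<and> open J' \<and> is_interval J' \<and> 0 \<in> J' \<and> J' \<subseteq> J \<and>
          star_condition J' U V h m \<and> bour_defined J' U h m \<and>
          rigid_motion T \<and> openin X W \<and> p \<in> W \<and> W \<subseteq> D \<and> c ` W \<subseteq> J' \<times> UNIV \<and>
          (\<forall>q\<in>W. f q = T (bour_map k m h U V \<epsilon>0 \<epsilon>1 \<epsilon>2 (c q)))))"
proof (intro conjI allI ballI impI, goal_cases)
  have U': "(U has_real_derivative s ^ k * V s) (at s)" if s: "s \<in> J" for s
  proof -
    obtain U' where U': "(U has_real_derivative U' s) (at s)"
      using smooth_on_real_derivativeE[OF assms(5)] s by blast
    have "deriv U s = s ^ k * V s" using assms(9) s by blast
    then have "U' s = s ^ k * V s" using DERIV_imp_deriv[OF U'] by simp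
    with U' show ?thesis by simp
  qed
  have Upos: "U s > 0" if "s \<in> J" for s using assms(6) that by blast
  have family: "helicoidal_family k J U V m h e0 e1 e2"
    if "m > 0 \<and> star_condition J U V h m \<and> bour_defined J U h m"
      "e0 \<in> {1, -1}" "e1 \<in> {1, -1}" "e2 \<in> {1, -1}" for m h e0 e1 e2
    by unfold_locales (use assms(1-5,8) U' Upos that in auto)
  {
    case (1 m h e0 e1 e2)
    interpret helicoidal_family k J U V m h e0 e1 e2 by (rule family[OF 1(4,1-3)])
    show ?case using generic_helicoidal_edge_F unfolding F_def .
  next
    case (2 m h e0 e1 e2 x v w)
    interpret helicoidal_family k J U V m h e0 e1 e2 by (rule family[OF 2(4,1-3)])
    show ?case using first_fundamental_form_F[OF 2(5)] unfolding F_def .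
  next
    case (3 X A f p D c)
    then have hyp: "generic_helicoidal_edge (k + 1) X A f" "p \<in> singular_points X A f" "p \<in> D"
      "coordinates X A D c" "c ` D \<subseteq> J \<times> UNIV"
      and metric: "\<And>x v w. x \<in> c ` D \<Longrightarrow> first_fundamental_form (f \<circ> inv_into D c) x v w = edge_metric k U x v w"
      by blast+
    obtain m h e2 d T W where *: "m > 0" "e2 \<in> {1, -1}" "d > 0" "{-d<..<d} \<subseteq> J"
      "star_condition {-d<..<d} U V h m" "bour_defined {-d<..<d} U h m" "rigid_motion T"
      "openin X W" "p \<in> W" "W \<subseteq> D" "c ` W \<subseteq> {-d<..<d} \<times> UNIV"
      "\<And>q. q \<in> W \<Longrightarrow> f q = T (bour_map k m h U V 1 1 e2 (c q))"
      by (rule helicoidal_edge_local_form[OF assms(1,5) Upos assms(8) U' hyp metric])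
         (assumption | rule that)+
    have "is_interval {-d<..<d}" "0 \<in> {-d<..<d}" using *(3) by (simp_all add: is_interval_oo)
    with * show ?case
      by (intro exI[of _ m] exI[of _ h] bexI[of _ 1] bexI[of _ e2] exI[of _ "{-d<..<d}"] exI[of _ T] exI[of _ W]
          conjI ballI open_greaterThanLessThan) simp_all
  }
qed

end
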